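(* Let $X_n=B_n$, $C_n$ or $F_4$, and assume that $t_r=2$ and $s\in2\mathbb Z+1$, $s\geq 1$. Let $\lambda\in\overline P$. Then $$\lim\ q^{-c(\{m^{(a)}_{i,0}\})}M(W^{(r)\otimes L}_s,\lambda,q)=\sum_{\xi,\eta,\zeta}\frac{q^{\phi}\,M(W(\eta),\lambda,q^{-1})\,M_{\frac{s-1}2}(W(\xi),q^{-1})}{\Bigl(\prod_{1\le a\le n}(q)_{\eta_a}(q)_{\xi_a}\Bigr)\prod_{1\le a\le n,\,t_a=2}(q)_{\zeta_a}},$$ $$W(\eta)=\bigotimes_{a=1}^nW^{(a)\otimes\eta_a}_1,\qquad W(\xi)=\bigotimes_{a=1}^nW^{(a)\otimes\xi_a}_1,$$ $$\phi=\frac12\Bigl|\sum_{a=1}^n(\eta_a-\xi_a)\overline\Lambda_a\Bigr|^2+\sum_{1\le a,b\le n,\ t_a=t_b=2}D^{-1}_{ab}\Bigl(\zeta_a-\frac{\xi_a+\eta_a}2\Bigr)\Bigl(\zeta_b-\frac{\xi_b+\eta_b}2\Bigr).$$ The limit $L\to\infty$ is taken with: for $B_n$, $L\in2\mathbb Z$ if $n$ is odd and $L\in4\mathbb Z$ if $n$ is even; for $C_n$, $L\in2n\mathbb Z$; for $F_4$, $L\in3\mathbb Z$. The sum runs over non-negative integers $\eta_a,\xi_a$ ($1\le a\le n$) and $\zeta_a$ ($1\le a\le n$, $t_a=2$) satisfying - $B_n$: $\ \xi_n,\ \ \eta_n,\ \ \zeta_n+\sum_{a=1}^{n-1}a(\xi_a+\eta_a)+\frac{n-1}2(\xi_n+\eta_n)\in2\mathbb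 Z$; - $C_n$: $\ \sum_{a=1}^na\xi_a,\ \sum_{a=1}^na\eta_a\in2\mathbb Z$ and $\sum_{a=1}^{n-1}a\zeta_a-\frac12\sum_{a=1}^na(\xi_a+\eta_a)\in n\mathbb Z$; - $F_4$: $\ \xi_3+2\xi_4+\eta_3+2\eta_4+\zeta_3+2\zeta_4\in3\mathbb Z$. For $s=1$, $\xi=0$ is understood (all $\xi_a=0$), with $M_0$ of the trivial (empty) $W$ equal to $1$.
   Context: Lie algebra notation. $X_n$ is $B_n\,(n\ge2)$, $C_n\,(n\ge2)$ or $F_4$ (with $n=4$), Dynkin diagram a chain $1,\dots,n$; in $B_n$ only $\alpha_n$ is short, in $C_n$ only $\alpha_n$ is long, in $F_4$ $\alpha_3,\alpha_4$ are short. $\alpha_a,\overline\Lambda_a$ are simple roots and fundamental weights, $\overline P=\bigoplus_a\mathbb Z\overline\Lambda_a$; $(\cdot|\cdot)$ is normalized so long roots have square length $2$, $|x|^2=(x|x)$; $t_a=2/(\alpha_a|\alpha_a)$, $C_{ab}=t_a(\alpha_a|\alpha_b)$, $C^{-1}_{ab}=t_a(\overline\Lambda_a|\overline\Lambda_b)$. With $K^{(l)}_{i,j}=\min(i,j)-ij/l$, for $t_a=t_b=2$: $D^{-1}_{ab}=\frac12\delta_{an}\delta_{bn}$ for $B_n$, $D^{-1}_{ab}=K^{(n)}_{a,b}$ for $C_n$, $D^{-1}_{ab}=K^{(3)}_{a-2,b-2}$ for $F_4$. The point $m^{(a)}_{j,0}$ ($1\le a\le n$, $j\ge1$), depending on $L$: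 - $B_n$: $m^{(a)}_{j,0}=\frac{La}2(\delta_{j,\frac{s-1}2}+\delta_{j,\frac{s+1}2})$ for $1\le a\le n-1$, and $m^{(n)}_{j,0}=\frac L4\bigl((n-1)(\delta_{j,s-1}+\delta_{j,s+1})+2\delta_{j,s}\bigr)$; - $C_n$: $m^{(a)}_{j,0}=\frac{Lar}{2n}(\delta_{j,\frac{t_a}2(s-1)}+\delta_{j,\frac{t_a}2(s+1)})+L(\min(a,r)-\frac{ar}n)\delta_{j,\frac{t_a}2s}$; - $F_4$: $m^{(a)}_{j,0}=\frac L3(2\delta_{r,3}+\delta_{r,4})\bigl(C^{-1}_{2a}(\delta_{j,\frac{t_a}2(s-1)}+\delta_{j,\frac{t_a}2(s+1)})+\delta_{a,3}\delta_{j,s}\bigr)+\frac L3(\delta_{r,3}+2\delta_{r,4})\delta_{a,4}\delta_{j,s}$, where $(C^{-1}_{2a})_{a=1,\dots,4}=(3,6,4,2)$. $q$-notation. $(q)_k=\prod_{i=1}^k(1-q^i)$. For $m\in\mathbb Z_{\ge0}$, $p\in\mathbb Z$, $\left[{p+m\atop m}\right]_q$ is the usual $q$-binomial coefficient $\frac{(q)_{p+m}}{(q)_p(q)_m}$ if $p\ge0$ and $0$ if $p<0$. The limit is coefficientwise, as formal power series in $q$. Fermionic forms. The symbol $W=\bigotimes_{a=1}^n\bigotimes_{j\ge1}(W^{(a)}_j)^{\otimes\nu^{(a)}_j}$ records data $\nu^{(a)}_j\in\mathbb Z_{\ge0}$, finitely many non-zero. For $\lambda\in\overline P$, $$M(W,\lambda,q)=\sum_{\{m\}}q^{c(\{m\})}\prod_{1\le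 a\le n,\,i\ge1}\left[{p^{(a)}_i+m^{(a)}_i\atop m^{(a)}_i}\right]_q,$$ $$c(\{m\})=\tfrac12\sum_{a,b}(\alpha_a|\alpha_b)\sum_{j,k\ge1}\min(t_bj,t_ak)m^{(a)}_jm^{(b)}_k-\sum_a\sum_{j,k\ge1}\nu^{(a)}_j\min(j,k)m^{(a)}_k,$$ $$p^{(a)}_i=\sum_{j\ge1}\nu^{(a)}_j\min(i,j)-\sum_b(\alpha_a|\alpha_b)\sum_{k\ge1}\min(t_bi,t_ak)m^{(b)}_k,$$ summed over $m^{(a)}_i\in\mathbb Z_{\ge0}$ with all $p^{(a)}_i\ge0$ and $\sum_{a,i}i\,m^{(a)}_i\alpha_a=\sum_{a,i}i\,\nu^{(a)}_i\overline\Lambda_a-\lambda$. For $l\in\mathbb Z_{\ge1}$ let $H_l=\{(a,j)\mid1\le a\le n,\ 1\le j\le t_al\}$; for $W=\bigotimes_{(a,j)\in H_l}(W^{(a)}_j)^{\otimes\nu^{(a)}_j}$, $$M_l(W,q)=\sum_{\{m\}}q^{c_l(\{m\})}\prod_{(a,i)\in H_l}\left[{p^{(a)}_i+m^{(a)}_i\atop m^{(a)}_i}\right]_q,$$ where $c_l$ and $p^{(a)}_i$ are given by the same formulas as $c$ and $p^{(a)}_i$ above with all sums over $(a,j),(b,k)$ restricted to $H_l$, and the sum is over $\{m^{(a)}_i\in\mathbb Z_{\ge0}\mid(a,i)\in H_l\}$ with all $p^{(a)}_i\ge0$ and $\sum_{(a,i)\in H_l}i\,m^{(a)}_i\alpha_a=\sum_{(a,i)\in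 H_l}i\,\nu^{(a)}_i\overline\Lambda_a$. In the theorem, $c$ is the quadratic form attached to $W^{(r)\otimes L}_s$, i.e. to $\nu^{(a)}_j=L\delta_{a,r}\delta_{j,s}$. *)

theory Defs
  imports
    "HOL-Computational_Algebra.Formal_Laurent_Series"
    "HOL-Analysis.Infinite_Sum"
begin

section \<open>Root data\<close>

text \<open>
  The nodes of the Dynkin diagram are \<open>1, ..., n\<close>, arranged as a chain.
  Objects indexed by the nodes are functions on \<^typ>\<open>nat\<close>.
\<close>

datatype cartan_type = TypeB nat | TypeC nat | TypeF4

fun rank :: "cartan_type \<Rightarrow> nat" where
  "rank (TypeB n) = n"
| "rank (TypeC n) = n"
| "rank TypeF4 = 4"

fun admissible_type :: "cartan_type \<Rightarrow> bool" where
  "admissible_type (TypeB n) \<longleftrightarrow> n \<ge> 2"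
| "admissible_type (TypeC n) \<longleftrightarrow> n \<ge> 2"
| "admissible_type TypeF4 \<longleftrightarrow> True"

definition nodes :: "cartan_type \<Rightarrow> nat set" where
  "nodes X = {1..rank X}"

fun short_root :: "cartan_type \<Rightarrow> nat \<Rightarrow> bool" where
  "short_root (TypeB n) a \<longleftrightarrow> a = n"
| "short_root (TypeC n) a \<longleftrightarrow> a \<noteq> n"
| "short_root TypeF4 a \<longleftrightarrow> a = 3 \<or> a = 4"

definition short_nodes :: "cartan_type \<Rightarrow> nat set" where
  "short_nodes X = {a \<in> nodes X. short_root X a}"

definition root_sqlen :: "cartan_type \<Rightarrow> nat \<Rightarrow> rat" where
  "root_sqlen X a = (if short_root X a then 1 else 2)"

text \<open>
  \<open>root_form X a b\<close> is \<open>(\<alpha>\<^sub>a|\<alpha>\<^sub>b)\<close>.  In a non simply laced diagram, for neighbouring nodes,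
  \<open>2 (\<alpha>\<^sub>a|\<alpha>\<^sub>b)\<close> divided by the larger of the two square lengths is \<open>-1\<close>.
\<close>

definition root_form :: "cartan_type \<Rightarrow> nat \<Rightarrow> nat \<Rightarrow> rat" where
  "root_form X a b =
     (if a = b then root_sqlen X a
      else if b = a + 1 \<or> a = b + 1 then - max (root_sqlen X a) (root_sqlen X b) / 2
      else 0)"

definition tt :: "cartan_type \<Rightarrow> nat \<Rightarrow> nat" where
  "tt X a = (if short_root X a then 2 else 1)"

lemma of_nat_tt: "of_nat (tt X a) = 2 / root_form X a a"
  by (simp add: tt_def root_form_def root_sqlen_def)

text \<open>
  A vector of the rational span of the roots is represented by its coordinates with respect to
  the simple roots, a function vanishing outside \<^term>\<open>nodes X\<close>.
\<close>

type_synonym weight = "nat \<Rightarrow> rat"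

definition weight_form :: "cartan_type \<Rightarrow> weight \<Rightarrow> weight \<Rightarrow> rat" where
  "weight_form X x y = (\<Sum>a\<in>nodes X. \<Sum>b\<in>nodes X. root_form X a b * x a * y b)"

definition simple_root :: "nat \<Rightarrow> weight" where
  "simple_root a = (\<lambda>b. if b = a then 1 else 0)"

text \<open>
  The fundamental weights exist and are unique because \<^const>\<open>root_form\<close> is positive definite.
\<close>

definition fund_weight :: "cartan_type \<Rightarrow> nat \<Rightarrow> weight" where
  "fund_weight X a = (THE w. (\<forall>b. b \<notin> nodes X \<longrightarrow> w b = 0) \<and>
     (\<forall>b\<in>nodes X. of_nat (tt X b) * weight_form X (simple_root b) w = (if b = a then 1 else 0)))"

definition weight_comb :: "cartan_type \<Rightarrow> (nat \<Rightarrow> rat) \<Rightarrow> weight" where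
  "weight_comb X k = (\<lambda>b. \<Sum>a\<in>nodes X. k a * fund_weight X a b)"

definition weight_lattice :: "cartan_type \<Rightarrow> weight set" where
  "weight_lattice X = range (\<lambda>k :: nat \<Rightarrow> int. weight_comb X (\<lambda>a. of_int (k a)))"

section \<open>\<open>q\<close>-notation\<close>

text \<open>
  Everything below is a function of an element \<open>q\<close> of a field, used with \<open>q\<close> the indeterminate of
  the field of formal Laurent series (\<^const>\<open>fls_X\<close>) and with its inverse.
  In both cases \<open>q\<close> is not a root of unity, so all divisions are by non-zero elements.
\<close>

definition qpoch :: "'a::field \<Rightarrow> nat \<Rightarrow> 'a" where
  "qpoch q k = (\<Prod>i=1..k. 1 - q ^ i)"

definition qbinomial :: "'a::field \<Rightarrow> int \<Rightarrow> nat \<Rightarrow> 'a" where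
  "qbinomial q p m =
     (if p < 0 then 0 else qpoch q (nat p + m) / (qpoch q (nat p) * qpoch q m))"

text \<open>
  The exponents and the vacancy numbers \<open>p\<close> below are computed as rational numbers, because
  the bilinear form is rational valued.  The floor is only applied to values which are integers:
  \<open>(\<alpha>\<^sub>a|\<alpha>\<^sub>b) min (t\<^sub>b j) (t\<^sub>a k)\<close> is an integer, and equals \<open>2 min j k\<close> for \<open>a = b\<close>, so \<open>p\<close> and \<open>c\<close>
  are integral at integral arguments; the point \<open>m_zero\<close> below is integral for the admitted
  values of \<open>L\<close>; and \<open>\<phi>\<close> is integral on the summation range, by virtue of the congruences.
\<close>

definition qpow :: "'a::field \<Rightarrow> rat \<Rightarrow> 'a" where
  "qpow q x = q powi \<lfloor>x\<rfloor>"

section \<open>Fermionic forms\<close>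

text \<open>
  \<open>\<nu> (a, j)\<close> is the multiplicity of \<open>W\<^sup>(\<^sup>a\<^sup>)\<^sub>j\<close> in \<open>W\<close>, and \<open>m (a, i)\<close> stands for \<open>m\<^sup>(\<^sup>a\<^sup>)\<^sub>i\<close>.
  The index set \<open>H\<close> is \<open>all_index X\<close> for \<open>M\<close> and \<open>level_index X l\<close> for \<open>M\<^sub>l\<close>.
  Sums and products over the (possibly infinite) index set use the library's \<^const>\<open>sum'\<close> and
  \<^const>\<open>prod'\<close>, which range over the support.
\<close>

definition all_index :: "cartan_type \<Rightarrow> (nat \<times> nat) set" where
  "all_index X = {(a, j). a \<in> nodes X \<and> j \<ge> 1}"

definition level_index :: "cartan_type \<Rightarrow> nat \<Rightarrow> (nat \<times> nat) set" where
  "level_index X l = {(a, j). a \<in> nodes X \<and> 1 \<le> j \<and> j \<le> tt X a * l}"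

definition cc ::
  "cartan_type \<Rightarrow> (nat \<times> nat) set \<Rightarrow> (nat \<times> nat \<Rightarrow> nat) \<Rightarrow> (nat \<times> nat \<Rightarrow> rat) \<Rightarrow> rat" where
  "cc X H \<nu> m =
     1 / 2 * sum' (\<lambda>((a, j), (b, k)).
        root_form X a b * of_nat (min (tt X b * j) (tt X a * k)) * m (a, j) * m (b, k)) (H \<times> H)
     - sum' (\<lambda>((a, j), (b, k)). of_nat (\<nu> (a, j) * min j k) * m (a, k))
         {((a, j), (b, k)). (a, j) \<in> H \<and> (b, k) \<in> H \<and> b = a}"

definition pp ::
  "cartan_type \<Rightarrow> (nat \<times> nat) set \<Rightarrow> (nat \<times> nat \<Rightarrow> nat) \<Rightarrow> (nat \<times> nat \<Rightarrow> rat) \<Rightarrow> nat \<times> nat \<Rightarrow> rat"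
where
  "pp X H \<nu> m = (\<lambda>(a, i).
     sum' (\<lambda>j. of_nat (\<nu> (a, j) * min i j)) {j. (a, j) \<in> H}
     - sum' (\<lambda>(b, k). root_form X a b * of_nat (min (tt X b * i) (tt X a * k)) * m (b, k)) H)"

definition configs ::
  "cartan_type \<Rightarrow> (nat \<times> nat) set \<Rightarrow> (nat \<times> nat \<Rightarrow> nat) \<Rightarrow> weight \<Rightarrow> (nat \<times> nat \<Rightarrow> nat) set" where
  "configs X H \<nu> lam = {m.
     finite {x. m x \<noteq> 0} \<and> {x. m x \<noteq> 0} \<subseteq> H \<and>
     (\<forall>x\<in>H. pp X H \<nu> (\<lambda>y. of_nat (m y)) x \<ge> 0) \<and>
     (\<forall>b\<in>nodes X.
        sum' (\<lambda>(a, i). of_nat (i * m (a, i)) * simple_root a b) H =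
        sum' (\<lambda>(a, i). of_nat (i * \<nu> (a, i)) * fund_weight X a b) H - lam b)}"

text \<open>
  The sum over \<^const>\<open>configs\<close> is finite, since the weight condition fixes
  \<open>\<Sum>\<^sub>i i m (a, i)\<close> for every node \<open>a\<close>.
\<close>

definition fermionic_form ::
  "cartan_type \<Rightarrow> (nat \<times> nat) set \<Rightarrow> (nat \<times> nat \<Rightarrow> nat) \<Rightarrow> weight \<Rightarrow> 'a::field \<Rightarrow> 'a" where
  "fermionic_form X H \<nu> lam q =
     (\<Sum>m\<in>configs X H \<nu> lam.
        qpow q (cc X H \<nu> (\<lambda>x. of_nat (m x))) *
        prod' (\<lambda>x. qbinomial q \<lfloor>pp X H \<nu> (\<lambda>y. of_nat (m y)) x\<rfloor> (m x)) H)"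

definition MM :: "cartan_type \<Rightarrow> (nat \<times> nat \<Rightarrow> nat) \<Rightarrow> weight \<Rightarrow> 'a::field \<Rightarrow> 'a" where
  "MM X \<nu> lam q = fermionic_form X (all_index X) \<nu> lam q"

text \<open>For \<open>l = 0\<close> the index set is empty, and \<^term>\<open>MM_level X 0 \<nu> q\<close> is \<open>1\<close>.\<close>

definition MM_level :: "cartan_type \<Rightarrow> nat \<Rightarrow> (nat \<times> nat \<Rightarrow> nat) \<Rightarrow> 'a::field \<Rightarrow> 'a" where
  "MM_level X l \<nu> q = fermionic_form X (level_index X l) \<nu> (\<lambda>_. 0) q"

definition W_power :: "nat \<Rightarrow> nat \<Rightarrow> nat \<Rightarrow> nat \<times> nat \<Rightarrow> nat" where
  "W_power r s L = (\<lambda>(a, j). if a = r \<and> j = s then L else 0)"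

definition W_vec :: "(nat \<Rightarrow> nat) \<Rightarrow> nat \<times> nat \<Rightarrow> nat" where
  "W_vec \<eta> = (\<lambda>(a, j). if j = 1 then \<eta> a else 0)"

section \<open>The data of the limit formula\<close>

definition kdelta :: "'a \<Rightarrow> 'a \<Rightarrow> rat" where
  "kdelta x y = (if x = y then 1 else 0)"

text \<open>
  The Kronecker deltas compare rational numbers: a delta at a non-integral position vanishes.
\<close>

fun m_zero :: "cartan_type \<Rightarrow> nat \<Rightarrow> nat \<Rightarrow> nat \<Rightarrow> nat \<times> nat \<Rightarrow> rat" where
  "m_zero (TypeB n) r s L (a, j) =
     (let j' = of_nat j :: rat; s' = of_nat s :: rat in
      if a \<noteq> n then
        of_nat L * of_nat a / 2 * (kdelta j' ((s' - 1) / 2) + kdelta j' ((s' + 1) / 2))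
      else
        of_nat L / 4 * ((of_nat n - 1) * (kdelta j' (s' - 1) + kdelta j' (s' + 1))
                         + 2 * kdelta j' s'))"
| "m_zero (TypeC n) r s L (a, j) =
     (let j' = of_nat j :: rat; s' = of_nat s :: rat; h = of_nat (tt (TypeC n) a) / 2 :: rat in
      of_nat L * of_nat a * of_nat r / (2 * of_nat n) *
        (kdelta j' (h * (s' - 1)) + kdelta j' (h * (s' + 1)))
      + of_nat L * (of_nat (min a r) - of_nat a * of_nat r / of_nat n) * kdelta j' (h * s'))"
| "m_zero TypeF4 r s L (a, j) =
     (let j' = of_nat j :: rat; s' = of_nat s :: rat; h = of_nat (tt TypeF4 a) / 2 :: rat in
      of_nat L / 3 * (2 * kdelta r 3 + kdelta r 4) *
        (of_nat (tt TypeF4 2) * weight_form TypeF4 (fund_weight TypeF4 2) (fund_weight TypeF4 a) *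
           (kdelta j' (h * (s' - 1)) + kdelta j' (h * (s' + 1)))
         + kdelta a 3 * kdelta j' s')
      + of_nat L / 3 * (kdelta r 3 + 2 * kdelta r 4) * kdelta a 4 * kdelta j' s')"

definition KK :: "nat \<Rightarrow> nat \<Rightarrow> nat \<Rightarrow> rat" where
  "KK l i j = of_nat (min i j) - of_nat (i * j) / of_nat l"

text \<open>Only used for short nodes \<open>a\<close> and \<open>b\<close>.\<close>

fun D_inv :: "cartan_type \<Rightarrow> nat \<Rightarrow> nat \<Rightarrow> rat" where
  "D_inv (TypeB n) a b = 1 / 2 * kdelta a n * kdelta b n"
| "D_inv (TypeC n) a b = KK n a b"
| "D_inv TypeF4 a b = KK 3 (a - 2) (b - 2)"

definition phi ::
  "cartan_type \<Rightarrow> (nat \<Rightarrow> nat) \<Rightarrow> (nat \<Rightarrow> nat) \<Rightarrow> (nat \<Rightarrow> nat) \<Rightarrow> rat" where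
  "phi X \<xi> \<eta> \<zeta> =
     (let v = weight_comb X (\<lambda>a. of_nat (\<eta> a) - of_nat (\<xi> a)) in
      1 / 2 * weight_form X v v
      + (\<Sum>a\<in>short_nodes X. \<Sum>b\<in>short_nodes X. D_inv X a b *
           (of_nat (\<zeta> a) - of_nat (\<xi> a + \<eta> a) / 2) *
           (of_nat (\<zeta> b) - of_nat (\<xi> b + \<eta> b) / 2)))"

text \<open>
  In \<open>C\<^sub>n\<close>, and in \<open>B\<^sub>n\<close> in the presence of the first two conditions, the divisions by \<open>2\<close> are exact.
\<close>

fun congruences ::
  "cartan_type \<Rightarrow> (nat \<Rightarrow> nat) \<Rightarrow> (nat \<Rightarrow> nat) \<Rightarrow> (nat \<Rightarrow> nat) \<Rightarrow> bool" where
  "congruences (TypeB n) \<xi> \<eta> \<zeta> \<longleftrightarrow>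
     even (\<xi> n) \<and> even (\<eta> n) \<and>
     even (\<zeta> n + (\<Sum>a=1..n-1. a * (\<xi> a + \<eta> a)) + (n - 1) * ((\<xi> n + \<eta> n) div 2))"
| "congruences (TypeC n) \<xi> \<eta> \<zeta> \<longleftrightarrow>
     even (\<Sum>a=1..n. a * \<xi> a) \<and> even (\<Sum>a=1..n. a * \<eta> a) \<and>
     int n dvd int (\<Sum>a=1..n-1. a * \<zeta> a) - int ((\<Sum>a=1..n. a * (\<xi> a + \<eta> a)) div 2)"
| "congruences TypeF4 \<xi> \<eta> \<zeta> \<longleftrightarrow>
     3 dvd \<xi> 3 + 2 * \<xi> 4 + \<eta> 3 + 2 * \<eta> 4 + \<zeta> 3 + 2 * \<zeta> 4"

definition summation_range ::
  "cartan_type \<Rightarrow> nat \<Rightarrow> ((nat \<Rightarrow> nat) \<times> (nat \<Rightarrow> nat) \<times> (nat \<Rightarrow> nat)) set" where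
  "summation_range X s = {(\<xi>, \<eta>, \<zeta>).
     (\<forall>a. a \<notin> nodes X \<longrightarrow> \<xi> a = 0 \<and> \<eta> a = 0) \<and>
     (\<forall>a. a \<notin> short_nodes X \<longrightarrow> \<zeta> a = 0) \<and>
     congruences X \<xi> \<eta> \<zeta> \<and>
     (s = 1 \<longrightarrow> (\<forall>a. \<xi> a = 0))}"

fun L_modulus :: "cartan_type \<Rightarrow> nat" where
  "L_modulus (TypeB n) = (if odd n then 2 else 4)"
| "L_modulus (TypeC n) = 2 * n"
| "L_modulus TypeF4 = 3"

end

theory Submission
  imports Defs
begin

text \<open>
  Put \<open>s = 2 l + 1\<close> and give the column \<open>(a, j)\<close> the position \<open>x = 2 j / t\<^sub>a\<close>. Then
  \<open>(\<alpha>\<^sub>a|\<alpha>\<^sub>b) min (t\<^sub>b j) (t\<^sub>a k) = G\<^sub>a\<^sub>b min x y\<close>, where \<open>G\<close> is half the Gram matrix of the coroots. At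
  \<open>m\<^sub>0\<close> all vacancy numbers vanish, so \<open>c m - c m\<^sub>0\<close> is the pure quadratic form \<open>E d\<close> of the fluctuation
  \<open>d = m - m\<^sub>0\<close>, and the vacancy numbers depend on \<open>d\<close> only. Only the columns at positions \<open>2 l\<close>,
  \<open>2 l + 1\<close>, \<open>2 l + 2\<close> grow with \<open>L\<close>; there the \<open>q\<close>-binomials tend to \<open>1 / (q)\<^sub>p\<close> with \<open>p\<close> equal to
  \<open>\<xi>\<close>, \<open>\<zeta>\<close> and \<open>\<eta>\<close>. Since \<open>G\<close> is positive definite, finitely many fluctuations have bounded energy
  and the limit may be taken termwise. A fluctuation is the same as its boundary data \<open>(\<xi>, \<eta>, \<zeta>)\<close>
  together with its columns to the right of the centre, a configuration for \<open>W(\<eta>)\<close>, and its columns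
  to the left read backwards, a configuration for \<open>W(\<xi>)\<close>; the central columns are determined by these,
  and are integral exactly under the congruences. Finally \<open>E d\<close> is \<open>\<phi>\<close> plus the energies of the
  two halves, which is what inverting \<open>q\<close> produces from \<open>c\<close>.
\<close>

section \<open>Graded limits of formal Laurent series\<close>

unbundle fps_syntax

text \<open>For each node the moment \<open>mom\<close> of a row is a piecewise linear function of
  the position: it vanishes at 0, is constant beyond the last column, and the entries of the row are
  its drops of slope. This is why a configuration can be cut: either side, read outward from the cut
  with the boundary value subtracted, is again of this kind. The only loss is at the origin, where
  the reflected left half ends with a nonzero slope. One new column has to carry it, and its sign is
  the delicate point, settled by a minimum principle for \<open>gram\<close>. Long rows have columns
  at even positions only, so at the middle position just the short rows can bend. Hence two
  inversions occur: the data at \<open>2 l\<close> and \<open>2 l + 2\<close> are solved for with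
  the inverse of \<open>gram\<close>, which yields the square length in \<open>phi\<close>; the bend
  at \<open>2 l + 1\<close> is solved for with the inverse of the short block, which is
  \<open>D_inv\<close>. The reference point obeys the same rule: it spreads a single source of
  strength \<open>L\<close> at position \<open>2 l + 1\<close> over the three central positions so
  that no vacancy number at an actual column notices.\<close>

lemma dist_fls_less:
  assumes "\<And>k. k \<le> int N \<Longrightarrow> f $$ k = g $$ k"
  shows "dist f g < inverse (2 ^ N :: real)"
proof (cases "f = g")
  case False
  have "fls_subdegree (f - g) \<ge> int N + 1"
    using False assms by (intro fls_subdegree_geI) auto
  hence sd: "fls_subdegree (f - g) \<ge> 0" and N: "N < nat (fls_subdegree (f - g))"
    by linarith+
  have "inverse (2 ^ nat (fls_subdegree (f - g))) < inverse (2 ^ N :: real)"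
    using N by (intro less_imp_inverse_less power_strict_increasing) auto
  with False sd show ?thesis by (simp add: dist_fls_def)
qed simp

text \<open>The range \<open>k \<le> int N\<close> includes all negative indices: convergence in the
  metric requires agreement from the bottom up, while separate convergence of each coefficient would
  still allow poles of unbounded order.\<close>

lemma tendsto_flsI:
  fixes l :: "'a::group_add fls"
  assumes "\<And>N. eventually (\<lambda>x. \<forall>k\<le>int N. f x $$ k = l $$ k) F"
  shows "(f \<longlongrightarrow> l) F"
proof (rule tendstoI)
  fix e :: real assume "e > 0"
  then obtain N where N: "inverse (2 ^ N) < e"
    using real_arch_pow_inv[of e "1/2"] by (auto simp: power_divide inverse_eq_divide)
  show "eventually (\<lambda>x. dist (f x) l < e) F"
    using assms[of N] by eventually_elim (blast intro: less_trans[OF dist_fls_less N])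
qed

lemma fls_sum_nth: "(\<Sum>i\<in>A. f i) $$ k = (\<Sum>i\<in>A. f i $$ k)"
  by (induction A rule: infinite_finite_induct) auto

text \<open>Every finite set between \<open>F\<close> and \<open>I\<close> has the same coefficients
  up to \<open>N\<close>, because the added terms vanish there; so the net of finite partial sums is
  eventually constant in that range.\<close>

lemma has_sum_flsI:
  fixes g :: "'i \<Rightarrow> 'a::ab_group_add fls"
  assumes "\<And>N. \<exists>F. finite F \<and> F \<subseteq> I \<and> (\<forall>i\<in>I - F. \<forall>k\<le>int N. g i $$ k = 0) \<and>
             (\<forall>k\<le>int N. S $$ k = (\<Sum>i\<in>F. g i $$ k))"
  shows "(g has_sum S) I"
  unfolding has_sum_def
proof (rule tendsto_flsI)
  fix N
  from assms[of N] obtain F where F: "finite F" "F \<subseteq> I"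
    "\<And>i k. i \<in> I - F \<Longrightarrow> k \<le> int N \<Longrightarrow> g i $$ k = 0"
    "\<And>k. k \<le> int N \<Longrightarrow> S $$ k = (\<Sum>i\<in>F. g i $$ k)"
    by blast
  have "sum g Y $$ k = S $$ k" if "finite Y" "F \<subseteq> Y" "Y \<subseteq> I" "k \<le> int N" for Y k
    unfolding fls_sum_nth F(4)[OF that(4)]
    by (rule sum.mono_neutral_right) (use that F(3) in auto)
  with F(1,2) show "eventually (\<lambda>Y. \<forall>k\<le>int N. sum g Y $$ k = S $$ k) (finite_subsets_at_top I)"
    by (auto simp: eventually_finite_subsets_at_top intro!: exI[of _ F])
qed

text \<open>Tannery's theorem for graded series. Since the order of each term is at least
  \<open>E\<close>, only the finitely many \<open>d\<close> with \<open>E d \<le> N\<close> matter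
  up to order \<open>N\<close>, in the limit and for every \<open>L\<close> alike. Finitely many
  eventual agreements hold jointly, and regrouping along the fibres of \<open>proj\<close> is, order
  by order, a finite rearrangement.\<close>

lemma graded_limit:
  fixes E :: "'d \<Rightarrow> int" and g :: "'d \<Rightarrow> 'a::ab_group_add fls" and gL :: "'l \<Rightarrow> 'd \<Rightarrow> 'a fls"
  assumes E0: "\<And>d. d \<in> T \<Longrightarrow> E d \<ge> 0"
    and fin: "\<And>N. finite {d \<in> T. E d \<le> N}"
    and g0: "\<And>d k. d \<in> T \<Longrightarrow> k < E d \<Longrightarrow> g d $$ k = 0"
    and gL0: "\<And>L d k. d \<in> C L \<Longrightarrow> k < E d \<Longrightarrow> gL L d $$ k = 0"
    and C: "\<And>L. P L \<Longrightarrow> C L \<subseteq> T \<and> finite (C L)" "eventually P F"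
    and ev: "\<And>d N. d \<in> T \<Longrightarrow> eventually (\<lambda>L. d \<in> C L \<and> (\<forall>k\<le>int N. gL L d $$ k = g d $$ k)) F"
    and proj: "\<And>d. d \<in> T \<Longrightarrow> proj d \<in> I"
    and fib: "\<And>t. t \<in> I \<Longrightarrow> finite {d \<in> T. proj d = t}"
    and rhs: "\<And>t. t \<in> I \<Longrightarrow> rhs t = (\<Sum>d | d \<in> T \<and> proj d = t. g d)"
  shows "\<exists>S. (rhs has_sum S) I \<and> ((\<lambda>L. \<Sum>d\<in>C L. gL L d) \<longlongrightarrow> S) F"
proof -
  \<comment> \<open>Coefficient \<open>n\<close> needs only the terms with
    \<open>E d \<le> n\<close>; by \<open>g0\<close> any larger cutoff gives the same value, which
    is the next fact.\<close>
  define S where "S = fps_to_fls (Abs_fps (\<lambda>n. \<Sum>d | d \<in> T \<and> E d \<le> int n. g d $$ int n))"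
  have S: "S $$ k = (\<Sum>d | d \<in> T \<and> E d \<le> int N. g d $$ k)" if "k \<le> int N" for k N
  proof (cases "k < 0")
    case True
    have "(\<Sum>d | d \<in> T \<and> E d \<le> int N. g d $$ k) = 0"
      using True E0 g0 by (intro sum.neutral) force
    thus ?thesis using True by (simp add: S_def)
  next
    case False
    hence "S $$ k = (\<Sum>d | d \<in> T \<and> E d \<le> k. g d $$ k)" by (simp add: S_def)
    also have "\<dots> = (\<Sum>d | d \<in> T \<and> E d \<le> int N. g d $$ k)"
      using that g0 fin by (intro sum.mono_neutral_left) (auto intro: leI)
    finally show ?thesis .
  qed
  have g0': "E d \<le> int N" if "d \<in> T" "k \<le> int N" "g d $$ k \<noteq> 0" for d k N
    using g0[of d k] that by force
  have "(rhs has_sum S) I"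
  proof (rule has_sum_flsI)
    fix N
    define TN where "TN = {d \<in> T. E d \<le> int N}"
    have fTN: "finite TN" using fin by (simp add: TN_def)
    have r: "rhs t $$ k = (\<Sum>d | d \<in> TN \<and> proj d = t. g d $$ k)" if "t \<in> I" "k \<le> int N" for t k
      unfolding rhs[OF that(1)] fls_sum_nth
      by (rule sum.mono_neutral_right) (use that fib[OF that(1)] g0' in \<open>auto simp: TN_def\<close>)
    show "\<exists>F. finite F \<and> F \<subseteq> I \<and> (\<forall>i\<in>I - F. \<forall>k\<le>int N. rhs i $$ k = 0) \<and>
             (\<forall>k\<le>int N. S $$ k = (\<Sum>i\<in>F. rhs i $$ k))"
    proof (intro exI conjI ballI allI impI)
      show "finite (proj ` TN)" using fTN by simp
      show "proj ` TN \<subseteq> I" using proj by (auto simp: TN_def)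
      show "rhs i $$ k = 0" if "i \<in> I - proj ` TN" "k \<le> int N" for i k
        using that by (auto simp: r intro!: sum.neutral)
      fix k assume k: "k \<le> int N"
      have "S $$ k = (\<Sum>d\<in>TN. g d $$ k)" using S[OF k] by (simp add: TN_def)
      also have "\<dots> = (\<Sum>t\<in>proj ` TN. \<Sum>d | d \<in> TN \<and> proj d = t. g d $$ k)"
        using fTN by (rule sum.image_gen)
      also have "\<dots> = (\<Sum>t\<in>proj ` TN. rhs t $$ k)"
        using r[OF _ k] proj by (intro sum.cong) (auto simp: TN_def)
      finally show "S $$ k = (\<Sum>t\<in>proj ` TN. rhs t $$ k)" .
    qed
  qed
  moreover have "((\<lambda>L. \<Sum>d\<in>C L. gL L d) \<longlongrightarrow> S) F"
  proof (rule tendsto_flsI)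
    fix N
    define TN where "TN = {d \<in> T. E d \<le> int N}"
    have fTN: "finite TN" using fin by (simp add: TN_def)
    have "eventually (\<lambda>L. \<forall>d\<in>TN. d \<in> C L \<and> (\<forall>k\<le>int N. gL L d $$ k = g d $$ k)) F"
      using ev by (intro eventually_ball_finite fTN) (auto simp: TN_def)
    with C(2) show "eventually (\<lambda>L. \<forall>k\<le>int N. (\<Sum>d\<in>C L. gL L d) $$ k = S $$ k) F"
    proof eventually_elim
      case (elim L)
      show ?case
      proof (intro allI impI)
        fix k assume k: "k \<le> int N"
        have "E d \<le> int N" if "d \<in> C L" "gL L d $$ k \<noteq> 0" for d
          using gL0[of d L k] that k by force
        hence "(\<Sum>d\<in>C L. gL L d $$ k) = (\<Sum>d\<in>TN. gL L d $$ k)"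
          using C(1)[OF elim(1)] elim(2) k
          by (intro sum.mono_neutral_right) (auto simp: TN_def)
        also have "\<dots> = (\<Sum>d\<in>TN. g d $$ k)" using elim(2) k by simp
        finally show "(\<Sum>d\<in>C L. gL L d) $$ k = S $$ k"
          using S[OF k] by (simp add: TN_def fls_sum_nth)
      qed
    qed
  qed
  ultimately show ?thesis by blast
qed

section \<open>q-Pochhammer symbols and q-binomials as formal power series\<close>

definition qp :: "nat \<Rightarrow> rat fps" where
  "qp k = (\<Prod>i=1..k. 1 - fps_X ^ i)"

text \<open>Written with inverses inside the ring of power series, which exist because
  \<open>qp\<close> has constant coefficient 1; congruences modulo powers of \<open>q\<close> can
  then be multiplied factor by factor.\<close>

definition qb :: "nat \<Rightarrow> nat \<Rightarrow> rat fps" where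
  "qb p m = qp (p + m) * inverse (qp p) * inverse (qp m)"

lemma fps_to_fls_prod: "fps_to_fls (\<Prod>i\<in>A. f i :: 'a::comm_ring_1 fps) = (\<Prod>i\<in>A. fps_to_fls (f i))"
  by (induction A rule: infinite_finite_induct) (auto simp: fls_times_fps_to_fls)

lemma qpoch_fls_X: "qpoch fls_X k = fps_to_fls (qp k)"
  by (simp add: qpoch_def qp_def fps_to_fls_prod fps_to_fls_power)

lemma qp_Suc: "qp (Suc k) = qp k * (1 - fps_X ^ Suc k)"
  by (simp add: qp_def)

lemma qp_0 [simp]: "qp 0 = 1"
  by (simp add: qp_def)

lemma qp_nth_0 [simp]: "fps_nth (qp k) 0 = 1"
  by (induction k) (simp_all add: qp_Suc)

lemma fps_to_fls_inverse_qp: "fps_to_fls (inverse (qp k)) = inverse (qpoch fls_X k)"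
  by (simp add: qpoch_fls_X fls_inverse_fps_to_fls subdegree_eq_0_iff)

lemma qbinomial_fls_X:
  "p \<ge> 0 \<Longrightarrow> qbinomial fls_X p m = fps_to_fls (qb (nat p) m)"
  by (simp add: qbinomial_def qb_def fls_times_fps_to_fls fps_to_fls_inverse_qp qpoch_fls_X[symmetric]
      divide_simps)

lemma qb_0_right [simp]: "qb p 0 = 1"
  by (simp add: qb_def inverse_mult_eq_1')

lemma qb_0_left [simp]: "qb 0 m = 1"
  by (simp add: qb_def inverse_mult_eq_1')

text \<open>Congruence modulo \<open>fps_X ^ Suc N\<close>.\<close>

definition fps_eq_upto :: "nat \<Rightarrow> rat fps \<Rightarrow> rat fps \<Rightarrow> bool" where
  "fps_eq_upto N f g \<longleftrightarrow> (\<forall>k\<le>N. fps_nth f k = fps_nth g k)"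

lemma fps_eq_upto_refl [simp]: "fps_eq_upto N f f"
  by (simp add: fps_eq_upto_def)

lemma fps_eq_upto_mult:
  "fps_eq_upto N f g \<Longrightarrow> fps_eq_upto N f' g' \<Longrightarrow> fps_eq_upto N (f * f') (g * g')"
  by (auto simp: fps_eq_upto_def fps_mult_nth intro!: sum.cong)

lemma fps_eq_upto_prod:
  "(\<And>i. i \<in> A \<Longrightarrow> fps_eq_upto N (f i) (g i)) \<Longrightarrow> fps_eq_upto N (\<Prod>i\<in>A. f i) (\<Prod>i\<in>A. g i)"
  by (induction A rule: infinite_finite_induct) (auto intro: fps_eq_upto_mult)

text \<open>The quotient of \<open>qp (p + m)\<close> by \<open>qp m\<close> is the product of
  \<open>1 - fps_X ^ (m + i)\<close> over \<open>1 \<le> i \<le> p\<close>, and each factor is 1 up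
  to order \<open>m\<close>.\<close>

lemma qb_eq_upto:
  assumes "m \<ge> N"
  shows "fps_eq_upto N (qb p m) (inverse (qp p))"
proof -
  have "fps_eq_upto N (qp (p + m)) (qp m)"
  proof (induction p)
    case (Suc p)
    have "fps_eq_upto N (1 - fps_X ^ Suc (p + m)) 1"
      using assms by (auto simp: fps_eq_upto_def fps_X_power_nth simp del: power_Suc)
    from fps_eq_upto_mult[OF Suc this] show ?case by (simp add: qp_Suc)
  qed simp
  hence "fps_eq_upto N (qp (p + m) * inverse (qp p) * inverse (qp m))
           (qp m * inverse (qp p) * inverse (qp m))"
    by (intro fps_eq_upto_mult) auto
  moreover have "qp m * inverse (qp p) * inverse (qp m) = inverse (qp p)"
    using inverse_mult_eq_1'[of "qp m"] by (simp add: ac_simps)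
  ultimately show ?thesis by (simp add: qb_def)
qed

lemma qpoch_inverse:
  fixes q :: "'a::field"
  assumes "q \<noteq> 0"
  shows "qpoch (inverse q) k = (-1) ^ k * inverse q ^ (\<Sum>i=1..k. i) * qpoch q k"
  using assms by (induction k) (simp_all add: qpoch_def power_add field_simps)

lemma sum_upto_add: "(\<Sum>i=Suc 0..p+m. i) = (\<Sum>i=Suc 0..p. i) + (\<Sum>i=Suc 0..m. i) + p * m"
  by (induction p) simp_all

text \<open>Each Pochhammer factor changes by \<open>- q^(-i)\<close> under inversion. The signs
  cancel between numerator and denominator, and the triangular numbers leave
  \<open>T(p + m) - T(p) - T(m) = p m\<close>.\<close>

lemma qbinomial_inverse:
  fixes q :: "'a::field"
  assumes "q \<noteq> 0" "p \<ge> 0"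
  shows "qbinomial (inverse q) p m = q powi (- (p * int m)) * qbinomial q p m"
proof -
  have "q powi (- (p * int m)) = inverse q ^ (nat p * m)"
    using assms by (metis power_int_minus power_int_of_nat int_nat_eq of_nat_mult power_inverse)
  moreover have "((-1::'a) ^ k) \<noteq> 0" for k by simp
  ultimately show ?thesis using assms
    by (simp add: qbinomial_def qpoch_inverse sum_upto_add power_add)
qed

section \<open>The coroot Gram matrix\<close>

text \<open>The spacing of the columns in a row: short rows occupy all integer positions, long rows
  the even ones.\<close>

definition stp :: "cartan_type \<Rightarrow> nat \<Rightarrow> nat" where
  "stp X a = (if short_root X a then 1 else 2)"

definition gram :: "cartan_type \<Rightarrow> nat \<Rightarrow> nat \<Rightarrow> rat" where
  "gram X a b = root_form X a b * of_nat (tt X a) * of_nat (tt X b) / 2"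

text \<open>These are the numbers \<open>2 (\<Lambda>_a|\<Lambda>_b)\<close>: the fundamental
  weights are dual to the coroots, whose Gram matrix is twice \<open>gram\<close>. The closed table
  allows the inverse to be verified entry by entry.\<close>

fun gram_inv :: "cartan_type \<Rightarrow> nat \<Rightarrow> nat \<Rightarrow> rat" where
  "gram_inv (TypeB n) a b =
     (if a = n \<and> b = n then of_nat n / 2
      else if a = n \<or> b = n then of_nat (min a b) else 2 * of_nat (min a b))"
| "gram_inv (TypeC n) a b = of_nat (min a b)"
| "gram_inv TypeF4 a b =
     [[4, 6, 4, 2], [6, 12, 8, 4], [4, 8, 6, 3], [2, 4, 3, 2]] ! (a - 1) ! (b - 1)"

lemma finite_nodes [simp]: "finite (nodes X)"
  by (simp add: nodes_def)

lemma finite_short_nodes [simp]: "finite (short_nodes X)"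
  by (simp add: short_nodes_def)

lemma short_nodes_subset: "short_nodes X \<subseteq> nodes X"
  by (auto simp: short_nodes_def)

lemma stp_pos [simp]: "stp X a > 0"
  by (simp add: stp_def)

lemma tt_pos [simp]: "tt X a > 0" "tt X a \<noteq> 0"
  by (simp_all add: tt_def)

lemma tt_stp: "tt X a * stp X a = 2"
  by (simp add: tt_def stp_def)

lemma of_nat_tt_stp: "(of_nat (tt X a) :: rat) = 2 / of_nat (stp X a)"
  by (simp add: tt_def stp_def)

lemma gram_eq:
  "gram X a b = (if a = b then 2 / of_nat (stp X a)
     else if b = a + 1 \<or> a = b + 1 then - 1 / of_nat (min (stp X a) (stp X b)) else 0)"
  by (auto simp: gram_def root_form_def root_sqlen_def tt_def stp_def)

lemma gram_sym: "gram X a b = gram X b a"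
  by (auto simp: gram_eq min.commute)

lemma gram_offdiag: "a \<noteq> b \<Longrightarrow> gram X a b \<le> 0"
  by (auto simp: gram_eq)

text \<open>Scaling the positions \<open>2 j / t_a\<close> and \<open>2 k / t_b\<close> by
  \<open>t_a t_b / 2\<close> gives \<open>t_b j\<close> and \<open>t_a k\<close>.\<close>

lemma root_form_min:
  "root_form X a b * of_nat (min (tt X b * j) (tt X a * k)) =
   gram X a b * of_nat (min (stp X a * j) (stp X b * k))"
proof -
  have "(of_nat (min (tt X b * j) (tt X a * k)) :: rat) =
        of_nat (tt X a) * of_nat (tt X b) / 2 * of_nat (min (stp X a * j) (stp X b * k))"
    by (auto simp: tt_def stp_def min_def)
  thus ?thesis by (simp add: gram_def)
qed

text \<open>The only non-integral entries of \<open>gram\<close> are the \<open>-1/2\<close> between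
  neighbouring long nodes, and there both positions are even.\<close>

lemma gram_min_Ints: "gram X a b * of_nat (min (stp X a * j) (stp X b * k)) \<in> \<int>"
proof -
  have "\<exists>c::int. gram X a b * of_nat (min (stp X a * j) (stp X b * k)) = of_int c"
    by (cases "a = b"; cases "short_root X a"; cases "short_root X b")
       (auto simp: gram_eq stp_def min_mult_distrib_left[symmetric] simp flip: of_nat_mult
         intro: exI[of _ "2 * int (min j k)"] exI[of _ "- int (min j k)"]
                exI[of _ "- int (min (2*j) k)"] exI[of _ "- int (min j (2*k))"])
  thus ?thesis by auto
qed

lemma gram_diag_min: "gram X a a * of_nat (min (stp X a * j) (stp X a * k)) = 2 * of_nat (min j k)"
  by (auto simp: gram_eq stp_def min_def)

lemma sum_chain:
  fixes f u :: "nat \<Rightarrow> rat"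
  assumes "a \<in> {1..n}"
  shows "(\<Sum>b\<in>{1..n}. (if a = b then d else if b = a + 1 \<or> a = b + 1 then u b else 0) * f b) =
    d * f a + (if a < n then u (a + 1) * f (a + 1) else 0) + (if 1 < a then u (a - 1) * f (a - 1) else 0)"
proof -
  have "(\<Sum>b\<in>{1..n}. (if a = b then d else if b = a + 1 \<or> a = b + 1 then u b else 0) * f b) =
    (\<Sum>b\<in>{1..n}. (if b = a then d * f a else 0) + (if b = a + 1 then u (a + 1) * f (a + 1) else 0)
       + (if b = a - 1 then (if a > 1 then u (a - 1) * f (a - 1) else 0) else 0))"
    using assms by (intro sum.cong) auto
  also have "\<dots> = d * f a + (if a < n then u (a + 1) * f (a + 1) else 0)
      + (if 1 < a then u (a - 1) * f (a - 1) else 0)"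
    using assms by (cases "a > 1") (auto simp: sum.distrib sum.delta)
  finally show ?thesis .
qed

lemma nodes_F4: "nodes TypeF4 = {1, 2, 3, 4}"
  by (auto simp: nodes_def)

lemma short_nodes_B: "1 \<le> n \<Longrightarrow> short_nodes (TypeB n) = {n}"
  by (auto simp: short_nodes_def nodes_def)

lemma short_nodes_C: "short_nodes (TypeC n) = {1..n - 1}"
  by (auto simp: short_nodes_def nodes_def)

lemma short_nodes_F4: "short_nodes TypeF4 = {3, 4}"
  by (auto simp: short_nodes_def nodes_def)

lemma gram_inv_sym: 
  assumes "a \<in> nodes X" "b \<in> nodes X" 
  shows "gram_inv X a b = gram_inv X b a"
proof (cases X)
  case TypeF4
  then show ?thesis using assms by (auto simp: nodes_F4)
qed (auto simp: min.commute)

lemma gram_inv_pos: 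
  assumes "a \<in> nodes X" "b \<in> nodes X" 
  shows "gram_inv X a b > 0"
proof (cases X)
  case TypeF4
  then show ?thesis using assms by (auto simp: nodes_F4)
qed (use assms in \<open>auto simp: nodes_def\<close>)

text \<open>In the two infinite families a column of the table is a multiple of
  \<open>min a c\<close>, up to a rescaling at the short end of B. This is the Green function of a
  chain: linear in \<open>a\<close> except for a bend at \<open>a = c\<close>.\<close>

lemma gram_inverse:
  assumes X: "admissible_type X" and a: "a \<in> nodes X" and c: "c \<in> nodes X"
  shows "(\<Sum>b\<in>nodes X. gram X a b * gram_inv X b c) = (if a = c then 1 else 0)"
proof (cases X)
  case TypeF4
  then show ?thesis using a c by (auto simp: nodes_F4 gram_eq stp_def)
next
  case (TypeB n)
  from a c TypeB obtain a' c' where [simp]: "a = Suc a'" "c = Suc c'" and an: "a' < n" "c' < n"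
    by (cases a; cases c) (auto simp: nodes_def)
  have "(\<Sum>b\<in>nodes X. gram X a b * gram_inv X b c) =
      2 / of_nat (stp X a) * gram_inv X a c +
      (if a < n then (- 1 / of_nat (min (stp X a) (stp X (a + 1)))) * gram_inv X (a + 1) c else 0) +
      (if 1 < a then (- 1 / of_nat (min (stp X a) (stp X (a - 1)))) * gram_inv X (a - 1) c else 0)"
  proof -
    have "nodes X = {1..n}" "a \<in> {1..n}" using a TypeB by (auto simp: nodes_def)
    thus ?thesis unfolding gram_eq by (simp only:) (rule sum_chain)
  qed
  also have "\<dots> = (if a = c then 1 else 0)"
    using an X TypeB by (auto simp: stp_def min_def field_simps)
  finally show ?thesis .
next
  case (TypeC n)
  from a c TypeC obtain a' c' where [simp]: "a = Suc a'" "c = Suc c'" and an: "a' < n" "c' < n"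
    by (cases a; cases c) (auto simp: nodes_def)
  have "(\<Sum>b\<in>nodes X. gram X a b * gram_inv X b c) =
      2 / of_nat (stp X a) * gram_inv X a c +
      (if a < n then (- 1 / of_nat (min (stp X a) (stp X (a + 1)))) * gram_inv X (a + 1) c else 0) +
      (if 1 < a then (- 1 / of_nat (min (stp X a) (stp X (a - 1)))) * gram_inv X (a - 1) c else 0)"
  proof -
    have "nodes X = {1..n}" "a \<in> {1..n}" using a TypeC by (auto simp: nodes_def)
    thus ?thesis unfolding gram_eq by (simp only:) (rule sum_chain)
  qed
  also have "\<dots> = (if a = c then 1 else 0)"
    using an X TypeC by (auto simp: stp_def min_def field_simps)
  finally show ?thesis .
qed

lemma KK_sym: "KK n a b = KK n b a"
  by (simp add: KK_def min.commute mult.commute)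

lemma D_inv_sym: 
  "a \<in> short_nodes X \<Longrightarrow> b \<in> short_nodes X \<Longrightarrow> D_inv X a b = D_inv X b a"
  by (cases X) (auto simp: KK_sym)

text \<open>The short nodes form a simply laced chain, so the restricted matrix is the Cartan matrix
  of type A with 1, \<open>n - 1\<close> or 2 nodes, and \<open>KK l\<close> is the inverse Cartan
  matrix of the chain with \<open>l - 1\<close> nodes.\<close>

lemma D_inv_inverse:
  assumes X: "admissible_type X" and a: "a \<in> short_nodes X" and c: "c \<in> short_nodes X"
  shows "(\<Sum>b\<in>short_nodes X. gram X a b * D_inv X b c) = (if a = c then 1 else 0)"
proof (cases X)
  case TypeF4
  then show ?thesis using a c by (auto simp: short_nodes_F4 gram_eq stp_def KK_def)
next
  case (TypeB n)
  then show ?thesis using a c X by (auto simp: short_nodes_B gram_eq stp_def kdelta_def)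
next
  case (TypeC n)
  from a c TypeC obtain a' c' where [simp]: "a = Suc a'" "c = Suc c'" 
    and an: "a' < n - 1" "c' < n - 1"
    by (cases a; cases c) (auto simp: short_nodes_C)
  have "(\<Sum>b\<in>short_nodes X. gram X a b * D_inv X b c) =
      2 / of_nat (stp X a) * D_inv X a c +
      (if a < n - 1 then (- 1 / of_nat (min (stp X a) (stp X (a + 1)))) * D_inv X (a + 1) c else 0) +
      (if 1 < a then (- 1 / of_nat (min (stp X a) (stp X (a - 1)))) * D_inv X (a - 1) c else 0)"
  proof -
    have "short_nodes X = {1..n - 1}" "a \<in> {1..n - 1}" using a TypeC by (auto simp: short_nodes_C)
    thus ?thesis unfolding gram_eq by (simp only:) (rule sum_chain)
  qed
  also have "\<dots> = (if a = c then 1 else 0)"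
  proof -
    define t where "t = (of_nat c / of_nat n :: rat)"
    have D: "D_inv X b c = of_nat (min b c) - of_nat b * t" for b
      by (cases "n = 0") (simp_all add: TypeC KK_def t_def field_simps)
    have t: "of_nat n * t = of_nat c" using an by (simp add: t_def)
    show ?thesis
    \<comment> \<open>At the end of the chain the missing neighbour \<open>n\<close> would
      contribute \<open>c - n t = 0\<close>, so the three-term recurrence persists there.\<close>
    proof (cases "a = n - 1")
      case True
      hence n: "n = Suc (Suc a')" using an by simp
      show ?thesis unfolding D using t an TypeC unfolding n
        by (auto simp: stp_def min_def algebra_simps)
    next
      case False
      thus ?thesis unfolding D using an TypeC by (auto simp: stp_def min_def algebra_simps)
    qed
  qed
  finally show ?thesis .
qed

text \<open>An equivalence, because \<open>fund_weight\<close> is a definite description: it gives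
  existence and uniqueness together.\<close>

lemma fund_weight_unique:
  assumes X: "admissible_type X" and a: "a \<in> nodes X"
  shows "(\<forall>b. b \<notin> nodes X \<longrightarrow> w b = 0) \<and>
     (\<forall>b\<in>nodes X. of_nat (tt X b) * weight_form X (simple_root b) w = (if b = a then 1 else 0))
     \<longleftrightarrow> w = (\<lambda>b. if b \<in> nodes X then of_nat (tt X b) * gram_inv X a b / 2 else 0)"
proof -
  \<comment> \<open>The coordinates of \<open>w\<close> with respect to the halved coroots
    \<open>t_b \<alpha>_b / 2\<close>; in these, pairing with the coroots becomes the matrix
    \<open>gram\<close>.\<close>
  define v where "v = (\<lambda>b. if b \<in> nodes X then 2 * w b / of_nat (tt X b) else 0)"
  have wf: "of_nat (tt X b) * weight_form X (simple_root b) w = (\<Sum>c\<in>nodes X. gram X b c * v c)"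
    if "b \<in> nodes X" for b
  proof -
    have "weight_form X (simple_root b) w =
        (\<Sum>a\<in>nodes X. if a = b then (\<Sum>c\<in>nodes X. root_form X b c * w c) else 0)"
      unfolding weight_form_def by (intro sum.cong) (auto simp: simple_root_def)
    also have "\<dots> = (\<Sum>c\<in>nodes X. root_form X b c * w c)"
      using that by (simp add: sum.delta)
    finally show ?thesis
      by (simp add: sum_distrib_left gram_def v_def field_simps cong: sum.cong)
  qed
  have giv: "(\<Sum>c\<in>nodes X. gram_inv X b c * (\<Sum>d\<in>nodes X. gram X c d * v d)) = v b"
    if "b \<in> nodes X" for b
  proof -
    have "(\<Sum>c\<in>nodes X. gram_inv X b c * (\<Sum>d\<in>nodes X. gram X c d * v d)) =
        (\<Sum>d\<in>nodes X. \<Sum>c\<in>nodes X. gram_inv X b c * gram X c d * v d)"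
      unfolding sum_distrib_left mult.assoc by (rule sum.swap)
    also have "\<dots> = (\<Sum>d\<in>nodes X. (\<Sum>c\<in>nodes X. gram X d c * gram_inv X c b) * v d)"
      using that by (auto simp: sum_distrib_left gram_sym gram_inv_sym mult_ac intro!: sum.cong)
    also have "\<dots> = (\<Sum>d\<in>nodes X. if d = b then v d else 0)"
      using that X by (intro sum.cong) (auto simp: gram_inverse)
    finally show ?thesis using that by simp
  qed
  have "(\<forall>b\<in>nodes X. of_nat (tt X b) * weight_form X (simple_root b) w = (if b = a then 1 else 0))
     \<longleftrightarrow> (\<forall>b\<in>nodes X. v b = gram_inv X a b)" (is "?l \<longleftrightarrow> ?r")
  proof
    assume ?l
    hence h: "(\<Sum>d\<in>nodes X. gram X c d * v d) = (if c = a then 1 else 0)" if "c \<in> nodes X" for c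
      using that by (simp add: wf)
    show ?r
    proof
      fix b assume b: "b \<in> nodes X"
      have "v b = (\<Sum>c\<in>nodes X. gram_inv X b c * (if c = a then 1 else 0))"
        using giv[OF b] h by simp
      also have "\<dots> = (\<Sum>c\<in>nodes X. if c = a then gram_inv X b a else 0)"
        by (intro sum.cong) auto
      finally show "v b = gram_inv X a b" using a b by (simp add: gram_inv_sym)
    qed
  next
    assume ?r
    thus ?l using a X by (auto simp: wf gram_inverse gram_inv_sym[of a] cong: sum.cong)
  qed
  moreover have "(\<forall>b. b \<notin> nodes X \<longrightarrow> w b = 0) \<and> (\<forall>b\<in>nodes X. v b = gram_inv X a b) \<longleftrightarrow>
     w = (\<lambda>b. if b \<in> nodes X then of_nat (tt X b) * gram_inv X a b / 2 else 0)"
    by (auto simp: v_def fun_eq_iff field_simps)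
  ultimately show ?thesis by blast
qed

lemma fund_weight_eq:
  assumes "admissible_type X" "a \<in> nodes X"
  shows "fund_weight X a b = (if b \<in> nodes X then of_nat (tt X b) * gram_inv X a b / 2 else 0)"
  unfolding fund_weight_def fund_weight_unique[OF assms] by simp

lemma gram_gram_inv_vec:
  assumes "admissible_type X" "a \<in> nodes X"
  shows "(\<Sum>b\<in>nodes X. gram X a b * (\<Sum>c\<in>nodes X. gram_inv X b c * v c)) = v a"
proof -
  have "(\<Sum>b\<in>nodes X. gram X a b * (\<Sum>c\<in>nodes X. gram_inv X b c * v c)) =
        (\<Sum>c\<in>nodes X. (\<Sum>b\<in>nodes X. gram X a b * gram_inv X b c) * v c)"
    unfolding sum_distrib_left sum_distrib_right mult.assoc by (rule sum.swap)
  also have "\<dots> = (\<Sum>c\<in>nodes X. if c = a then v a else 0)"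
    using assms by (intro sum.cong) (auto simp: gram_inverse)
  finally show ?thesis using assms by simp
qed

lemma gram_inv_gram_vec:
  assumes "admissible_type X" "a \<in> nodes X"
  shows "(\<Sum>b\<in>nodes X. gram_inv X a b * (\<Sum>c\<in>nodes X. gram X b c * v c)) = v a"
proof -
  have "(\<Sum>b\<in>nodes X. gram_inv X a b * (\<Sum>c\<in>nodes X. gram X b c * v c)) =
        (\<Sum>c\<in>nodes X. (\<Sum>b\<in>nodes X. gram X c b * gram_inv X b a) * v c)"
    unfolding sum_distrib_left sum_distrib_right
    by (subst sum.swap) (use assms in \<open>auto simp: gram_sym gram_inv_sym intro!: sum.cong\<close>)
  also have "\<dots> = (\<Sum>c\<in>nodes X. if c = a then v a else 0)"
    using assms by (intro sum.cong) (auto simp: gram_inverse)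
  finally show ?thesis using assms by simp
qed

lemma D_inv_gram_vec:
  assumes "admissible_type X" "a \<in> short_nodes X"
  shows "(\<Sum>b\<in>short_nodes X. D_inv X a b * (\<Sum>c\<in>short_nodes X. gram X b c * v c)) = v a"
proof -
  have "(\<Sum>b\<in>short_nodes X. D_inv X a b * (\<Sum>c\<in>short_nodes X. gram X b c * v c)) =
        (\<Sum>c\<in>short_nodes X. (\<Sum>b\<in>short_nodes X. gram X c b * D_inv X b a) * v c)"
    unfolding sum_distrib_left sum_distrib_right
    by (subst sum.swap) (use assms in \<open>auto simp: gram_sym D_inv_sym intro!: sum.cong\<close>)
  also have "\<dots> = (\<Sum>c\<in>short_nodes X. if c = a then v a else 0)"
    using assms by (intro sum.cong) (auto simp: D_inv_inverse)
  finally show ?thesis using assms by simp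
qed

lemma gram_D_inv_vec:
  assumes "admissible_type X" "a \<in> short_nodes X"
  shows "(\<Sum>b\<in>short_nodes X. gram X a b * (\<Sum>c\<in>short_nodes X. D_inv X b c * v c)) = v a"
proof -
  have "(\<Sum>b\<in>short_nodes X. gram X a b * (\<Sum>c\<in>short_nodes X. D_inv X b c * v c)) =
        (\<Sum>c\<in>short_nodes X. (\<Sum>b\<in>short_nodes X. gram X a b * D_inv X b c) * v c)"
    unfolding sum_distrib_left sum_distrib_right mult.assoc by (rule sum.swap)
  also have "\<dots> = (\<Sum>c\<in>short_nodes X. if c = a then v a else 0)"
    using assms by (intro sum.cong) (auto simp: D_inv_inverse)
  finally show ?thesis using assms by simp
qed

lemma weight_form_comb:
  assumes "admissible_type X"
  shows "weight_form X (weight_comb X k) (weight_comb X k) =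
    (\<Sum>a\<in>nodes X. k a * (\<Sum>b\<in>nodes X. gram_inv X a b * k b)) / 2"
proof -
  define v where "v a = (\<Sum>b\<in>nodes X. gram_inv X a b * k b)" for a
  have wc: "weight_comb X k b = of_nat (tt X b) * v b / 2" if "b \<in> nodes X" for b
    using that assms by (auto simp: weight_comb_def fund_weight_eq v_def sum_distrib_left
        sum_divide_distrib gram_inv_sym mult_ac intro!: sum.cong)
  have "weight_form X (weight_comb X k) (weight_comb X k) =
     (\<Sum>a\<in>nodes X. v a * (\<Sum>b\<in>nodes X. gram X a b * v b)) / 2"
    unfolding weight_form_def sum_distrib_left sum_divide_distrib
    by (intro sum.cong) (auto simp: wc gram_def)
  also have "\<dots> = (\<Sum>a\<in>nodes X. v a * k a) / 2"
    using assms by (simp add: v_def gram_gram_inv_vec cong: sum.cong)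
  finally show ?thesis by (simp add: v_def mult.commute)
qed

lemma weight_form_fund_F4:
  assumes "a \<in> nodes TypeF4"
  shows "weight_form TypeF4 (fund_weight TypeF4 2) (fund_weight TypeF4 a) = gram_inv TypeF4 2 a / 2"
proof -
  have X: "admissible_type TypeF4" by simp
  have n: "2 \<in> nodes TypeF4" "1 \<in> nodes TypeF4" "3 \<in> nodes TypeF4" "4 \<in> nodes TypeF4"
    by (auto simp: nodes_F4)
  show ?thesis using assms
    unfolding weight_form_def fund_weight_eq[OF X n(1)] fund_weight_eq[OF X assms]
    by (auto simp: nodes_F4 tt_def root_form_def root_sqlen_def)
qed

section \<open>The reference point and the congruences\<close>

lemma of_int_div_Ints:
  "m \<noteq> 0 \<Longrightarrow> (of_int k / of_int m :: rat) \<in> \<int> \<longleftrightarrow> m dvd k"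
  by (auto simp: Ints_def field_simps dvd_def simp flip: of_int_mult)

lemma of_int_div_numeral_Ints:
  "(of_int k / numeral m :: rat) \<in> \<int> \<longleftrightarrow> numeral m dvd k"
  using of_int_div_Ints[of "numeral m" k] by simp

text \<open>\<open>L * gap\<close> is the value of the reference point at position \<open>s\<close>,
  and \<open>L * edge\<close> its value at \<open>s - 1\<close> and \<open>s + 1\<close>. The two
  are fixed by \<open>2 * edge + gap = gram_inv\<close> and by the requirement that the short rows
  of \<open>gram\<close> annihilate \<open>edge\<close>.\<close>

definition gap :: "cartan_type \<Rightarrow> nat \<Rightarrow> nat \<Rightarrow> rat" where
  "gap X r a = (if short_root X a then D_inv X a r else 0)"

definition edge :: "cartan_type \<Rightarrow> nat \<Rightarrow> nat \<Rightarrow> rat" where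
  "edge X r a = (gram_inv X a r - gap X r a) / 2"

text \<open>The three families of reference points become one formula once columns are named by
  their positions; the fractions in \<open>m_zero\<close> are entries of \<open>gram_inv\<close> and
  \<open>D_inv\<close>.\<close>

lemma m_zero_eq:
  assumes r: "r \<in> short_nodes X" and a: "a \<in> nodes X" and s: "odd s"
  shows "m_zero X r s L (a, j) = of_nat L *
    (if stp X a * j + 1 = s \<or> stp X a * j = s + 1 then edge X r a
     else if stp X a * j = s then gap X r a else 0)"
proof -
  have k: "((of_nat j :: rat) = (of_nat s - 1) / 2) = (of_nat (2 * j + 1) = (of_nat s :: rat))"
       "((of_nat j :: rat) = (of_nat s + 1) / 2) = (of_nat (2 * j) = (of_nat (s + 1) :: rat))"
       "((of_nat j :: rat) = of_nat s / 2) = (of_nat (2 * j) = (of_nat s :: rat))"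
       "((of_nat j :: rat) = of_nat s - 1) = (of_nat (j + 1) = (of_nat s :: rat))"
       "((of_nat j :: rat) = of_nat s + 1) = (of_nat j = (of_nat (s + 1) :: rat))"
    by (auto simp: field_simps)
  have kd: "kdelta (of_nat j :: rat) ((of_nat s - 1) / 2) = (if 2 * j + 1 = s then 1 else 0)"
       "kdelta (of_nat j :: rat) ((of_nat s + 1) / 2) = (if 2 * j = s + 1 then 1 else 0)"
       "kdelta (of_nat j :: rat) (of_nat s / 2) = (if 2 * j = s then 1 else 0)"
       "kdelta (of_nat j :: rat) (of_nat s - 1) = (if j + 1 = s then 1 else 0)"
       "kdelta (of_nat j :: rat) (of_nat s + 1) = (if j = s + 1 then 1 else 0)"
       "kdelta (of_nat j :: rat) (of_nat s) = (if j = s then 1 else 0)"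
    unfolding kdelta_def k of_nat_eq_iff by auto
  have kd': "kdelta (of_nat j :: rat) (of_nat (tt X a) / 2 * (of_nat s - 1)) = (if stp X a * j + 1 = s then 1 else 0)"
       "kdelta (of_nat j :: rat) (of_nat (tt X a) / 2 * (of_nat s + 1)) = (if stp X a * j = s + 1 then 1 else 0)"
       "kdelta (of_nat j :: rat) (of_nat (tt X a) / 2 * of_nat s) = (if stp X a * j = s then 1 else 0)"
  proof -
    have h: "(of_nat (tt X a) / 2 :: rat) = (if short_root X a then 1 else 1 / 2)"
      by (simp add: tt_def)
    show "kdelta (of_nat j :: rat) (of_nat (tt X a) / 2 * (of_nat s - 1)) = (if stp X a * j + 1 = s then 1 else 0)"
       "kdelta (of_nat j :: rat) (of_nat (tt X a) / 2 * (of_nat s + 1)) = (if stp X a * j = s + 1 then 1 else 0)"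
       "kdelta (of_nat j :: rat) (of_nat (tt X a) / 2 * of_nat s) = (if stp X a * j = s then 1 else 0)"
      unfolding h stp_def
      by (cases "short_root X a"; simp only: if_True if_False times_divide_eq_left mult_1 kd)+
  qed
  \<comment> \<open>As \<open>s\<close> is odd, no column of a long row sits at position
    \<open>s\<close>.\<close>
  have [simp]: "2 * j \<noteq> s" using s by auto
  show ?thesis
  proof (cases X)
    case (TypeB n)
    then show ?thesis using r a
      by (simp only: m_zero.simps Let_def kd)
         (auto simp: nodes_def edge_def gap_def stp_def kdelta_def field_simps short_nodes_def)
  next
    case (TypeC n)
    then show ?thesis using r a
      by (simp only: m_zero.simps Let_def kd'[unfolded TypeC])
         (auto simp: short_nodes_C nodes_def edge_def gap_def stp_def KK_def field_simps)
  next
    case TypeF4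
    have "weight_form TypeF4 (fund_weight TypeF4 2) (fund_weight TypeF4 a) = gram_inv TypeF4 2 a / 2"
      using a TypeF4 by (intro weight_form_fund_F4) auto
    then show ?thesis using r a TypeF4
      by (simp only: m_zero.simps Let_def kd'[unfolded TypeF4])
         (auto simp: short_nodes_F4 nodes_F4 edge_def gap_def stp_def tt_def KK_def kdelta_def)
  qed
qed

text \<open>With \<open>gap_pos\<close> this makes every central column grow linearly in
  \<open>L\<close>.\<close>

lemma edge_pos:
  assumes X: "admissible_type X" and r: "r \<in> short_nodes X" and a: "a \<in> nodes X"
  shows "edge X r a > 0"
proof (cases X)
  case (TypeB n)
  then show ?thesis using r a X
    by (auto simp: short_nodes_B nodes_def edge_def gap_def kdelta_def)
next
  case (TypeC n)
  then show ?thesis using r a X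
    by (auto simp: short_nodes_C nodes_def edge_def gap_def KK_def)
next
  case TypeF4
  then show ?thesis using r a
    by (auto simp: short_nodes_F4 nodes_F4 edge_def gap_def KK_def)
qed

lemma gap_pos:
  assumes X: "admissible_type X" and r: "r \<in> short_nodes X" and a: "a \<in> short_nodes X"
  shows "gap X r a > 0"
proof (cases X)
  case (TypeB n)
  then show ?thesis using r a X
    by (auto simp: short_nodes_B gap_def kdelta_def)
next
  case (TypeC n)
  hence "a < n" "r < n" "a > 0" "r > 0" using a r by (auto simp: short_nodes_C)
  hence "max a r < n" "min a r > 0" "a * r = min a r * max a r" by (auto simp: min_def max_def)
  hence "a * r < min a r * n" by simp
  hence "(of_nat (a * r) :: rat) < of_nat (min a r * n)" by (simp only: of_nat_less_iff)
  then show ?thesis using \<open>a < n\<close> TypeC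
    by (simp add: gap_def KK_def field_simps del: of_nat_min)
next
  case TypeF4
  then show ?thesis using r a
    by (auto simp: short_nodes_F4 gap_def KK_def)
qed

text \<open>\<open>L_modulus\<close> clears the denominators. In C the entries of
  \<open>edge\<close> are \<open>a r / (2 n)\<close>, in F4 they are multiples of 1/3; in B the
  worst one is \<open>(n - 1) / 4\<close> at node \<open>n\<close>, whence the dependence on the
  parity of \<open>n\<close>.\<close>

lemma edge_gap_Ints:
  assumes X: "admissible_type X" and r: "r \<in> short_nodes X" and a: "a \<in> nodes X"
    and L: "L_modulus X dvd L"
  shows "of_nat L * edge X r a \<in> \<int>" "of_nat L * gap X r a \<in> \<int>"
proof -
  have I: "rat_of_nat n \<in> \<int>" for n by simp
  show "of_nat L * edge X r a \<in> \<int>" 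
  proof (cases X)
    case (TypeB n)
    obtain k where "L = (if odd n then 2 else 4) * k" using L TypeB by auto
    moreover have "odd n \<Longrightarrow> \<exists>i. n = 2 * i + 1" by (metis oddE)
    ultimately show ?thesis using r a X TypeB I[of "k * a"] I[of "2 * k * a"] I[of "k * (n - 1)"]
      by (auto simp: short_nodes_B nodes_def edge_def gap_def kdelta_def of_nat_diff algebra_simps
         diff_divide_distrib add_divide_distrib
         split: if_splits)
  next
    case (TypeC n)
    obtain k where "L = 2 * n * k" using L TypeC by auto
    then show ?thesis using r a X TypeC I[of "k * a * r"] I[of "k * n * r"]
      by (auto simp: short_nodes_C nodes_def edge_def gap_def KK_def algebra_simps min_def)
  next
    case TypeF4
    obtain k where "L = 3 * k" using L TypeF4 by auto
    then show ?thesis using r a I[of "k * _"] TypeF4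
      by (auto simp: short_nodes_F4 nodes_F4 edge_def gap_def KK_def)
  qed
  show "of_nat L * gap X r a \<in> \<int>" 
  proof (cases X)
    case (TypeB n)
    obtain k where "L = (if odd n then 2 else 4) * k" using L TypeB by auto
    then show ?thesis using r a X TypeB 
      by (auto simp: short_nodes_B nodes_def gap_def kdelta_def split: if_splits)
  next
    case (TypeC n)
    obtain k where "L = 2 * n * k" using L TypeC by auto
    then show ?thesis using r a X TypeC I[of "2 * k * a * r"] I[of "2 * k * n * min a r"]
      by (auto simp: short_nodes_C nodes_def gap_def KK_def algebra_simps min_def)
  next
    case TypeF4
    obtain k where "L = 3 * k" using L TypeF4 by auto
    then show ?thesis using r a TypeF4
      by (auto simp: short_nodes_F4 nodes_F4 gap_def KK_def)
  qed
qed

section \<open>Integrality of the central columns and the congruences\<close>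

definition ginv_vec :: "cartan_type \<Rightarrow> (nat \<Rightarrow> nat) \<Rightarrow> nat \<Rightarrow> rat" where
  "ginv_vec X \<xi> a = (\<Sum>b\<in>nodes X. gram_inv X a b * of_nat (\<xi> b))"

text \<open>For a fluctuation with boundary data \<open>\<xi>\<close>, \<open>\<eta>\<close>,
  \<open>\<zeta>\<close> this is its column at position \<open>2 l + 1\<close>, as
  \<open>boundary_centre\<close> shows; long rows have no such column and get 0. Likewise
  \<open>ginv_vec\<close> of \<open>\<xi>\<close> and \<open>\<eta>\<close> is minus the moment at
  \<open>2 l\<close> and at \<open>2 l + 2\<close>.\<close>

definition centre ::
  "cartan_type \<Rightarrow> (nat \<Rightarrow> nat) \<Rightarrow> (nat \<Rightarrow> nat) \<Rightarrow> (nat \<Rightarrow> nat) \<Rightarrow> nat \<Rightarrow> rat" where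
  "centre X \<xi> \<eta> \<zeta> a = (if a \<in> short_nodes X then
     (\<Sum>b\<in>short_nodes X. D_inv X a b * (of_nat (\<xi> b) + of_nat (\<eta> b) - 2 * of_nat (\<zeta> b))) else 0)"

lemma sum_nodes_last:
  fixes f :: "nat \<Rightarrow> 'a :: comm_monoid_add"
  shows "n \<ge> 1 \<Longrightarrow> (\<Sum>b\<in>{Suc 0..n}. f b) = (\<Sum>b\<in>{Suc 0..n-1}. f b) + f n"
  by (cases n) auto

text \<open>The right-hand side is integrality of the centre. The quotients by \<open>stp\<close>
  express that the moments of a long row, whose positions are even, are even. The last quotient is
  the right boundary column together with everything to its right; its counterpart on the left is
  minus this quotient minus \<open>centre\<close>, hence integral as well.\<close>

lemma congruences_iff:
  assumes X: "admissible_type X"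
  shows "congruences X \<xi> \<eta> \<zeta> \<longleftrightarrow>
    (\<forall>a\<in>nodes X. ginv_vec X \<xi> a / of_nat (stp X a) \<in> \<int> \<and> ginv_vec X \<eta> a / of_nat (stp X a) \<in> \<int>) \<and>
    (\<forall>a\<in>short_nodes X. centre X \<xi> \<eta> \<zeta> a \<in> \<int> \<and>
        (ginv_vec X \<xi> a - ginv_vec X \<eta> a - centre X \<xi> \<eta> \<zeta> a) / 2 \<in> \<int>)"
proof (cases X)
  case (TypeB n)
  with X have n: "n \<ge> 2" by simp
  define S where "S \<xi> = (\<Sum>b\<in>{1..n-1}. b * \<xi> b)" for \<xi> :: "nat \<Rightarrow> nat"
  define S' where "S' a \<xi> = (\<Sum>b\<in>{1..n-1}. min a b * \<xi> b)" for a and \<xi> :: "nat \<Rightarrow> nat"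
  have gn: "ginv_vec X \<xi> n = of_nat (S \<xi>) + of_nat n * of_nat (\<xi> n) / 2" for \<xi>
    unfolding ginv_vec_def using n TypeB
    by (auto simp: nodes_def sum_nodes_last[of n] S_def intro!: sum.cong)
  have ga: "ginv_vec X \<xi> a = 2 * of_nat (S' a \<xi>) + of_nat a * of_nat (\<xi> n)" if "a \<in> {1..n-1}" for \<xi> a
  proof -
    have "a \<noteq> n" using that n by auto
    thus ?thesis unfolding ginv_vec_def using n TypeB that
      by (auto simp: nodes_def sum_nodes_last[of n] S'_def sum_distrib_left intro!: sum.cong)
  qed
  have c: "centre X \<xi> \<eta> \<zeta> n = (of_nat (\<xi> n) + of_nat (\<eta> n)) / 2 - of_nat (\<zeta> n)"
    using n TypeB by (simp add: centre_def short_nodes_B kdelta_def field_simps)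
  \<comment> \<open>Node 1 is long as \<open>n \<ge> 2\<close>, and \<open>\<xi> n\<close> enters
    its row with coefficient 1 before the halving, so integrality there already forces
    \<open>\<xi> n\<close> to be even.\<close>
  have ev: "even (\<xi> n)" if "ginv_vec X \<xi> 1 / of_nat (stp X 1) \<in> \<int>" for \<xi>
  proof -
    have "ginv_vec X \<xi> 1 / of_nat (stp X 1) = of_nat (S' 1 \<xi>) + of_int (int (\<xi> n)) / 2"
      using n TypeB ga[of 1 \<xi>] by (simp add: stp_def field_simps)
    hence "of_int (int (\<xi> n)) / 2 \<in> (\<int> :: rat set)"
      using that by (metis Ints_diff Ints_of_nat add_diff_cancel_left')
    thus ?thesis by (simp add: of_int_div_numeral_Ints del: of_int_of_nat_eq)
  qed
  \<comment> \<open>What is left is the parity of the right column of the only short node, which is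
    the third congruence.\<close>
  have main: "congruences X \<xi> \<eta> \<zeta> \<longleftrightarrow> 
     centre X \<xi> \<eta> \<zeta> n \<in> \<int> \<and> (ginv_vec X \<xi> n - ginv_vec X \<eta> n - centre X \<xi> \<eta> \<zeta> n) / 2 \<in> \<int>"
    if e: "even (\<xi> n)" "even (\<eta> n)"
  proof -
    from e obtain x y where xy: "\<xi> n = 2 * x" "\<eta> n = 2 * y" by (auto elim!: evenE)
    have "(\<Sum>a=1..n-1. a * (\<xi> a + \<eta> a)) = S \<xi> + S \<eta>"
      by (simp add: S_def sum.distrib distrib_left)
    hence "congruences X \<xi> \<eta> \<zeta> \<longleftrightarrow> even (\<zeta> n + (S \<xi> + S \<eta>) + (n - 1) * (x + y))"
      using e by (simp add: TypeB xy)
    also have "\<dots> \<longleftrightarrow> even (int (S \<xi>) + int n * int x - int (S \<eta>) - int n * int y - (int x + int y - int (\<zeta> n)))"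
      using n by (cases n) auto
    also have "\<dots> \<longleftrightarrow> (of_int (int (S \<xi>) + int n * int x - int (S \<eta>) - int n * int y - (int x + int y - int (\<zeta> n))) / 2 :: rat) \<in> \<int>"
      by (simp only: of_int_div_numeral_Ints)
    also have "(of_int (int (S \<xi>) + int n * int x - int (S \<eta>) - int n * int y - (int x + int y - int (\<zeta> n))) / 2 :: rat)
       = (ginv_vec X \<xi> n - ginv_vec X \<eta> n - centre X \<xi> \<eta> \<zeta> n) / 2"
      by (simp add: gn c xy field_simps)
    finally show ?thesis by (simp add: c xy add_divide_distrib)
  qed
  have g: "ginv_vec X \<xi> a / of_nat (stp X a) \<in> \<int>" if a: "a \<in> nodes X" and e: "even (\<xi> n)" for a \<xi>
  proof -
    from e obtain x where x: "\<xi> n = 2 * x" by (auto elim!: evenE)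
    show ?thesis
    proof (cases "a = n")
      case True
      show ?thesis unfolding True gn x stp_def by (simp add: TypeB)
    next
      case False
      hence "a \<in> {1..n-1}" using a TypeB n by (auto simp: nodes_def)
      hence "ginv_vec X \<xi> a / of_nat (stp X a) = of_nat (S' a \<xi> + a * x)"
        using False by (subst ga) (auto simp: TypeB x stp_def)
      thus ?thesis by (simp only: Ints_of_nat)
    qed
  qed
  have 1: "1 \<in> nodes X" using TypeB n by (simp add: nodes_def)
  have evc: "congruences X \<xi> \<eta> \<zeta> \<Longrightarrow> even (\<xi> n) \<and> even (\<eta> n)" using TypeB by simp
  have sh: "short_nodes X = {n}" using TypeB n by (simp add: short_nodes_B)
  show ?thesis using main ev evc g 1 unfolding sh by blast
next
  case (TypeC n)
  with X have n: "n \<ge> 2" by simp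
  define S where "S \<xi> = (\<Sum>b\<in>{1..n-1}. int b * \<xi> b)" for \<xi> :: "nat \<Rightarrow> int"
  define S' where "S' a \<xi> = (\<Sum>b\<in>{1..n-1}. int (min a b) * \<xi> b)" for a and \<xi> :: "nat \<Rightarrow> int"
  have ga: "ginv_vec X \<xi> a = of_int (S' a (int \<circ> \<xi>) + int a * int (\<xi> n))" if "a \<in> nodes X" for \<xi> a
    unfolding ginv_vec_def using n TypeC that
    by (auto simp: nodes_def sum_nodes_last[of n] S'_def min_def intro!: sum.cong)
  have S'n: "S' n \<xi> = S \<xi>" for \<xi>
    unfolding S'_def S_def by (intro sum.cong) auto
  have tot: "int (\<Sum>a=1..n. a * \<xi> a) = S (int \<circ> \<xi>) + int n * int (\<xi> n)" for \<xi> :: "nat \<Rightarrow> nat"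
    using n by (simp add: sum_nodes_last[of n] S_def)
  define x where "x b = int (\<xi> b) + int (\<eta> b) - 2 * int (\<zeta> b)" for b
  have c: "centre X \<xi> \<eta> \<zeta> a = of_int (S' a x) - of_nat a * of_int (S x) / of_nat n"
    if "a \<in> short_nodes X" for a
    using that n TypeC
    by (simp add: centre_def short_nodes_C KK_def S'_def S_def x_def sum_distrib_left sum_divide_distrib
        left_diff_distrib sum_subtractf mult_ac)
  have Sx: "S x = S (int \<circ> \<xi>) + S (int \<circ> \<eta>) - 2 * S (int \<circ> \<zeta>)"
    by (simp add: S_def x_def sum_distrib_left sum.distrib sum_subtractf algebra_simps)
  have S'x: "S' a x = S' a (int \<circ> \<xi>) + S' a (int \<circ> \<eta>) - 2 * S' a (int \<circ> \<zeta>)" for a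
    by (simp add: S'_def x_def sum_distrib_left sum.distrib sum_subtractf algebra_simps)
  \<comment> \<open>\<open>n\<close> is the only long node, and its row of \<open>gram_inv\<close>
    has the entries \<open>b\<close>.\<close>
  have lng: "(\<forall>a\<in>nodes X. ginv_vec X \<xi> a / of_nat (stp X a) \<in> \<int>) \<longleftrightarrow> even (\<Sum>a=1..n. a * \<xi> a)" for \<xi>
  proof -
    have "(\<forall>a\<in>nodes X. ginv_vec X \<xi> a / of_nat (stp X a) \<in> \<int>) \<longleftrightarrow> 
          ginv_vec X \<xi> n / of_nat (stp X n) \<in> \<int>"
    proof -
      have "ginv_vec X \<xi> a / of_nat (stp X a) \<in> \<int>" if "a \<in> nodes X" "a \<noteq> n" for a
        using that(2) unfolding ga[OF that(1)] stp_def by (simp add: TypeC)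
      moreover have "n \<in> nodes X" using TypeC n by (simp add: nodes_def)
      ultimately show ?thesis by blast
    qed
    also have "\<dots> \<longleftrightarrow> even (int (\<Sum>a=1..n. a * \<xi> a))"
      using TypeC n unfolding tot
      by (subst ga) (simp_all add: nodes_def stp_def S'n of_int_div_numeral_Ints del: of_int_add of_int_mult)
    finally show ?thesis by (simp only: even_of_nat)
  qed
  show ?thesis
  proof (cases "even (\<Sum>a=1..n. a * \<xi> a) \<and> even (\<Sum>a=1..n. a * \<eta> a)")
    case False
    thus ?thesis using lng TypeC by (auto simp: ball_conj_distrib)
  next
    case True
    then obtain u v where uv: "(\<Sum>a=1..n. a * \<xi> a) = 2 * u" "(\<Sum>a=1..n. a * \<eta> a) = 2 * v"
      by (auto elim!: evenE)
    \<comment> \<open>Up to sign the number that the third congruence wants divisible by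
      \<open>n\<close>. It enters \<open>centre\<close> and the right column only through
      \<open>a * w / n\<close>, so node 1 decides.\<close>
    define w where "w = int u + int v - S (int \<circ> \<zeta>)"
    have Su: "S (int \<circ> \<xi>) = 2 * int u - int n * int (\<xi> n)" "S (int \<circ> \<eta>) = 2 * int v - int n * int (\<eta> n)"
      using tot[of \<xi>, unfolded uv] tot[of \<eta>, unfolded uv] by simp_all
    have c': "centre X \<xi> \<eta> \<zeta> a = of_int (S' a x + int a * (int (\<xi> n) + int (\<eta> n))) - 2 * (of_int (int a * w) / of_int (int n))"
      if "a \<in> short_nodes X" for a
      using n unfolding c[OF that] Sx Su w_def by (simp add: field_simps)
    have d': "(ginv_vec X \<xi> a - ginv_vec X \<eta> a - centre X \<xi> \<eta> \<zeta> a) / 2 = 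
         of_int (S' a (int \<circ> \<zeta>) - S' a (int \<circ> \<eta>) - int a * int (\<eta> n)) + of_int (int a * w) / of_int (int n)"
      if a: "a \<in> short_nodes X" for a
      using a short_nodes_subset[of X] unfolding c'[OF a] S'x
      by (subst (1 2) ga) (auto simp: field_simps)
    have "congruences X \<xi> \<eta> \<zeta> \<longleftrightarrow> int n dvd w"
    proof -
      have "(\<Sum>a=1..n. a * (\<xi> a + \<eta> a)) = 2 * (u + v)"
        using uv by (simp add: distrib_left sum.distrib)
      hence "congruences X \<xi> \<eta> \<zeta> \<longleftrightarrow> int n dvd S (int \<circ> \<zeta>) - int (u + v)"
        using True TypeC by (simp add: S_def)
      also have "\<dots> \<longleftrightarrow> int n dvd w" unfolding w_def
        by (subst dvd_minus_iff[symmetric]) (simp add: algebra_simps)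
      finally show ?thesis .
    qed
    also have "\<dots> \<longleftrightarrow> (\<forall>a\<in>short_nodes X. centre X \<xi> \<eta> \<zeta> a \<in> \<int> \<and>
        (ginv_vec X \<xi> a - ginv_vec X \<eta> a - centre X \<xi> \<eta> \<zeta> a) / 2 \<in> \<int>)"
    proof
      assume "int n dvd w"
      hence h: "(of_int (int a * w) / of_int (int n) :: rat) \<in> \<int>" for a
        using n by (subst of_int_div_Ints) auto
      show "\<forall>a\<in>short_nodes X. centre X \<xi> \<eta> \<zeta> a \<in> \<int> \<and>
        (ginv_vec X \<xi> a - ginv_vec X \<eta> a - centre X \<xi> \<eta> \<zeta> a) / 2 \<in> \<int>"
      proof (intro ballI conjI)
        fix a assume a: "a \<in> short_nodes X"
        show "centre X \<xi> \<eta> \<zeta> a \<in> \<int>"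
          unfolding c'[OF a] by (intro Ints_diff Ints_mult Ints_of_int Ints_numeral h)
        show "(ginv_vec X \<xi> a - ginv_vec X \<eta> a - centre X \<xi> \<eta> \<zeta> a) / 2 \<in> \<int>"
          unfolding d'[OF a] by (intro Ints_add Ints_of_int h)
      qed
    next
      assume *: "\<forall>a\<in>short_nodes X. centre X \<xi> \<eta> \<zeta> a \<in> \<int> \<and>
        (ginv_vec X \<xi> a - ginv_vec X \<eta> a - centre X \<xi> \<eta> \<zeta> a) / 2 \<in> \<int>"
      have 1: "1 \<in> short_nodes X" using n TypeC by (simp add: short_nodes_C)
      have "(of_int (int 1 * w) / of_int (int n) :: rat) \<in> \<int>"
        using * 1 d'[OF 1] by (metis Ints_diff Ints_of_int add_diff_cancel_left')
      thus "int n dvd w" using n by (subst (asm) of_int_div_Ints) auto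
    qed
    finally show ?thesis using True lng by (auto simp: ball_conj_distrib)
  qed
next
  case TypeF4
  define x where "x b = int (\<xi> b) + int (\<eta> b) - 2 * int (\<zeta> b)" for b
  have g: "ginv_vec X \<xi> 1 = of_int (2 * int (2 * \<xi> 1 + 3 * \<xi> 2 + 2 * \<xi> 3 + \<xi> 4))"
       "ginv_vec X \<xi> 2 = of_int (2 * int (3 * \<xi> 1 + 6 * \<xi> 2 + 4 * \<xi> 3 + 2 * \<xi> 4))"
       "ginv_vec X \<xi> 3 = of_int (int (4 * \<xi> 1 + 8 * \<xi> 2 + 6 * \<xi> 3 + 3 * \<xi> 4))"
       "ginv_vec X \<xi> 4 = of_int (int (2 * \<xi> 1 + 4 * \<xi> 2 + 3 * \<xi> 3 + 2 * \<xi> 4))" for \<xi>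
    using TypeF4 by (simp_all add: ginv_vec_def nodes_F4)
  have c: "centre X \<xi> \<eta> \<zeta> 3 = of_int (2 * x 3 + x 4) / 3"
          "centre X \<xi> \<eta> \<zeta> 4 = of_int (x 3 + 2 * x 4) / 3"
    using TypeF4 by (simp_all add: centre_def short_nodes_F4 KK_def x_def field_simps)
  have h: "(of_int i - of_int j - of_int k / 3) / 2 = (of_int (3 * i - 3 * j - k) / 6 :: rat)" for i j k
    by (simp add: field_simps)
  have i: "2 * of_int k / 2 = (of_int k :: rat)" for k by simp
  have no: "nodes X = {1, 2, 3, 4}" and sh: "short_nodes X = {3, 4}"
    using TypeF4 by (simp_all add: nodes_F4 short_nodes_F4)
  have st: "(of_nat (stp X 1) :: rat) = 2" "(of_nat (stp X 2) :: rat) = 2"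
     "(of_nat (stp X 3) :: rat) = 1" "(of_nat (stp X 4) :: rat) = 1"
    using TypeF4 by (simp_all add: stp_def)
  have cg: "congruences X \<xi> \<eta> \<zeta> \<longleftrightarrow>
      3 dvd \<xi> 3 + 2 * \<xi> 4 + \<eta> 3 + 2 * \<eta> 4 + \<zeta> 3 + 2 * \<zeta> 4"
    using TypeF4 by simp
  \<comment> \<open>The denominator 6 comes from the factor 3 of \<open>D_inv\<close> and the
    halving; the parity half is automatic by \<open>e3\<close> and \<open>e4\<close>.\<close>
  have six: "6 dvd 3 * i - 3 * j - k \<longleftrightarrow> 3 dvd k" if "even (i - j - k)" for i j k :: int
    using that by presburger
  have e3: "even (int (4 * \<xi> 1 + 8 * \<xi> 2 + 6 * \<xi> 3 + 3 * \<xi> 4) -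
       int (4 * \<eta> 1 + 8 * \<eta> 2 + 6 * \<eta> 3 + 3 * \<eta> 4) - (2 * x 3 + x 4))"
    and e4: "even (int (2 * \<xi> 1 + 4 * \<xi> 2 + 3 * \<xi> 3 + 2 * \<xi> 4) -
       int (2 * \<eta> 1 + 4 * \<eta> 2 + 3 * \<eta> 3 + 2 * \<eta> 4) - (x 3 + 2 * x 4))"
    by (simp_all add: x_def)
  have x: "3 dvd \<xi> 3 + 2 * \<xi> 4 + \<eta> 3 + 2 * \<eta> 4 + \<zeta> 3 + 2 * \<zeta> 4 \<longleftrightarrow> 3 dvd x 3 + 2 * x 4"
  proof -
    have "int (\<xi> 3 + 2 * \<xi> 4 + \<eta> 3 + 2 * \<eta> 4 + \<zeta> 3 + 2 * \<zeta> 4) =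
       (x 3 + 2 * x 4) + 3 * (int (\<zeta> 3) + 2 * int (\<zeta> 4))" by (simp add: x_def)
    hence "int 3 dvd int (\<xi> 3 + 2 * \<xi> 4 + \<eta> 3 + 2 * \<eta> 4 + \<zeta> 3 + 2 * \<zeta> 4) \<longleftrightarrow> 3 dvd x 3 + 2 * x 4"
      by (metis dvd_add_left_iff dvd_triv_left of_nat_numeral)
    thus ?thesis by (simp only: of_nat_dvd_iff)
  qed
  \<comment> \<open>Modulo 3, \<open>2 x3 + x4\<close> is \<open>2 (x3 + 2 x4)\<close>, so nodes 3
    and 4 impose the same condition.\<close>
  have x': "3 dvd 2 * x 3 + x 4 \<longleftrightarrow> 3 dvd x 3 + 2 * x 4"
    by presburger
  show ?thesis unfolding cg x
    by (simp only: no sh st ball_simps g c h div_by_1 of_int_div_numeral_Ints Ints_of_int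
        simp_thms dvd_triv_left six[OF e3] six[OF e4] x')
qed

section \<open>Quadratic forms on configurations\<close>

text \<open>Stated in \<open>comm_monoid_set\<close>, like the two splittings after it, so that they
  serve the energies as \<open>sum'\<close> and the q-binomial factors as
  \<open>prod'\<close>.\<close>

lemma (in comm_monoid_set) G_atLeast_1:
  fixes g :: "nat \<Rightarrow> 'a"
  assumes "\<And>k. k > K \<Longrightarrow> g k = \<^bold>1"
  shows "G g {1..} = F g {1..K}"
proof -
  have "G g {1..} = G g {1..K}"
    using assms by (intro mono_neutral_right') (auto simp: not_le)
  thus ?thesis by simp
qed

text \<open>
  The boundary columns of node \<open>a\<close> are \<open>u = t\<^sub>a l\<close> and \<open>u + t\<close> with \<open>t = t\<^sub>a\<close>; for \<open>t = 2\<close> there is one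
  more column between them. The columns to the left of \<open>u\<close> are numbered backwards from \<open>u\<close>.
\<close>

lemma (in comm_monoid_set) G_split:
  fixes g :: "nat \<Rightarrow> 'a"
  assumes fin: "finite {k. g k \<noteq> \<^bold>1}" and t: "t = 1 \<or> t = 2"
  shows "G g {1..} = F (\<lambda>j. g (u - j)) {1..<u} \<^bold>* (if u > 0 then g u else \<^bold>1) \<^bold>*
    (if t = 2 then g (Suc u) else \<^bold>1) \<^bold>* g (u + t) \<^bold>* G (\<lambda>j. g (u + t + j)) {1..}"
proof -
  obtain K where K: "\<And>k. k > K \<Longrightarrow> g k = \<^bold>1"
    using fin by (metis (mono_tags, lifting) finite_nat_set_iff_bounded_le mem_Collect_eq not_less)
  have "G g {1..} = F g {1..u + t + K}"
    by (rule G_atLeast_1) (use K in auto)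
  also have "{1..u + t + K} = {1..<u} \<union> ({u} - {0}) \<union> (if t = 2 then {Suc u} else {}) \<union> {u + t} \<union> {u + t + 1..u + t + K}"
    using t by auto
  also have "F g \<dots> = F g ({1..<u} \<union> ({u} - {0}) \<union> (if t = 2 then {Suc u} else {}) \<union> {u + t}) \<^bold>*
      F g {u + t + 1..u + t + K}"
    using t by (intro union_disjoint) auto
  also have "F g ({1..<u} \<union> ({u} - {0}) \<union> (if t = 2 then {Suc u} else {}) \<union> {u + t}) =
      F g ({1..<u} \<union> ({u} - {0}) \<union> (if t = 2 then {Suc u} else {})) \<^bold>* F g {u + t}"
    using t by (intro union_disjoint) auto
  also have "F g ({1..<u} \<union> ({u} - {0}) \<union> (if t = 2 then {Suc u} else {})) =
      F g ({1..<u} \<union> ({u} - {0})) \<^bold>* F g (if t = 2 then {Suc u} else {})"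
    by (intro union_disjoint) auto
  also have "F g ({1..<u} \<union> ({u} - {0})) = F g {1..<u} \<^bold>* F g ({u} - {0})"
    by (intro union_disjoint) auto
  also have "F g {u + t} = g (u + t)" by simp
  also have "F g {1..<u} = F (\<lambda>j. g (u - j)) {1..<u}"
    by (rule reindex_bij_witness[of _ "\<lambda>j. u - j" "\<lambda>j. u - j"]) auto
  also have "F g ({u} - {0}) = (if u > 0 then g u else \<^bold>1)" by simp
  also have "F g (if t = 2 then {Suc u} else {}) = (if t = 2 then g (Suc u) else \<^bold>1)" by simp
  also have "F g {u + t + 1..u + t + K} = F (\<lambda>j. g (u + t + j)) {1..K}"
    by (rule reindex_bij_witness[of _ "\<lambda>j. u + t + j" "\<lambda>j. j - (u + t)"]) auto
  also have "\<dots> = G (\<lambda>j. g (u + t + j)) {1..}"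
    by (rule G_atLeast_1[symmetric]) (use K in auto)
  finally show ?thesis .
qed

lemma (in comm_monoid_set) G_sites:
  fixes g :: "nat \<times> nat \<Rightarrow> 'a"
  assumes H: "H \<subseteq> all_index X" and K: "\<And>a k. g (a, k) \<noteq> \<^bold>1 \<Longrightarrow> a \<in> nodes X \<Longrightarrow> (a, k) \<in> H \<and> k \<le> K"
  shows "G g H = F (\<lambda>a. F (\<lambda>k. g (a, k)) {1..K}) (nodes X)"
    and "G g H = F (\<lambda>a. G (\<lambda>k. g (a, k)) {1..}) (nodes X)"
proof -
  have "G g H = G g (nodes X \<times> {1..K} \<inter> H)"
    using K H by (intro mono_neutral_right') (auto simp: all_index_def)
  also have "\<dots> = G g (nodes X \<times> {1..K})"
    using K by (intro mono_neutral_left') auto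
  also have "\<dots> = F (\<lambda>a. F (\<lambda>k. g (a, k)) {1..K}) (nodes X)"
    by (simp add: cartesian_product)
  finally show *: "G g H = F (\<lambda>a. F (\<lambda>k. g (a, k)) {1..K}) (nodes X)" .
  have "F (\<lambda>k. g (a, k)) {1..K} = G (\<lambda>k. g (a, k)) {1..}" if "a \<in> nodes X" for a
    by (rule G_atLeast_1[symmetric]) (use K that in force)
  with * show "G g H = F (\<lambda>a. G (\<lambda>k. g (a, k)) {1..}) (nodes X)"
    by (simp cong: cong)
qed

section \<open>Moments, the quadratic form and its gradient\<close>

definition fin_conf :: "cartan_type \<Rightarrow> (nat \<times> nat \<Rightarrow> rat) \<Rightarrow> bool" where
  "fin_conf X m \<longleftrightarrow> finite {z. m z \<noteq> 0} \<and> {z. m z \<noteq> 0} \<subseteq> all_index X"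

lemma fin_conf_bound:
  assumes "fin_conf X m"
  obtains K where "\<And>a k. k > K \<Longrightarrow> m (a, k) = 0"
proof -
  have "finite (snd ` {z. m z \<noteq> 0})" using assms by (simp add: fin_conf_def)
  then obtain K where "\<And>k. k \<in> snd ` {z. m z \<noteq> 0} \<Longrightarrow> k \<le> K"
    by (metis finite_nat_set_iff_bounded_le)
  hence "m (a, k) = 0" if "k > K" for a k using that by force
  thus ?thesis by (rule that)
qed

lemma fin_conf_boundI:
  assumes "\<And>a k. k > K \<Longrightarrow> m (a, k) = 0" "\<And>z. z \<notin> all_index X \<Longrightarrow> m z = 0"
  shows "fin_conf X m"
proof -
  have "{z. m z \<noteq> 0} \<subseteq> nodes X \<times> {1..K}"
    using assms by (force simp: all_index_def not_le)
  thus ?thesis using assms(2) by (auto simp: fin_conf_def intro: finite_subset)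
qed

lemma fin_conf_0:
  assumes "fin_conf X m"
  shows "m (a, 0) = 0" "a \<notin> nodes X \<Longrightarrow> m (a, k) = 0" "z \<notin> all_index X \<Longrightarrow> m z = 0"
  using assms by (auto simp: fin_conf_def all_index_def)

lemma fin_conf_row: "fin_conf X m \<Longrightarrow> finite {k. m (a, k) \<noteq> 0}"
  by (rule fin_conf_bound[of X m]) (auto simp: finite_nat_set_iff_bounded_le, metis not_le)

definition mom :: "nat \<Rightarrow> (nat \<Rightarrow> rat) \<Rightarrow> nat \<Rightarrow> rat" where
  "mom c d x = sum' (\<lambda>k. of_nat (min x (c * k)) * d k) {1..}"

text \<open>The eventual value of \<open>mom c d x\<close> for large \<open>x\<close>; it expresses
  the weight condition of a row in units of positions.\<close>

definition wtot :: "nat \<Rightarrow> (nat \<Rightarrow> rat) \<Rightarrow> rat" where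
  "wtot c d = sum' (\<lambda>k. of_nat (c * k) * d k) {1..}"

text \<open>The gradient of the form \<open>pair_sum X (quad_vec X m) m / 2\<close>. Thus
  \<open>cc\<close> is this form minus the linear form of \<open>src\<close>, and \<open>pp\<close>
  is minus the gradient of \<open>cc\<close>.\<close>

definition quad_vec :: "cartan_type \<Rightarrow> (nat \<times> nat \<Rightarrow> rat) \<Rightarrow> nat \<times> nat \<Rightarrow> rat" where
  "quad_vec X m = (\<lambda>(a, i). \<Sum>b\<in>nodes X. gram X a b * mom (stp X b) (\<lambda>k. m (b, k)) (stp X a * i))"

definition pair_sum :: "cartan_type \<Rightarrow> (nat \<times> nat \<Rightarrow> rat) \<Rightarrow> (nat \<times> nat \<Rightarrow> rat) \<Rightarrow> rat" where
  "pair_sum X f m = (\<Sum>a\<in>nodes X. sum' (\<lambda>i. f (a, i) * m (a, i)) {1..})"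

definition src :: "(nat \<times> nat) set \<Rightarrow> (nat \<times> nat \<Rightarrow> nat) \<Rightarrow> nat \<times> nat \<Rightarrow> rat" where
  "src H \<nu> = (\<lambda>(a, i). sum' (\<lambda>j. of_nat (\<nu> (a, j) * min i j)) {j. (a, j) \<in> H})"

lemma mom_eq_sum:
  assumes "\<And>k. k > K \<Longrightarrow> d k = 0"
  shows "mom c d x = (\<Sum>k=1..K. of_nat (min x (c * k)) * d k)"
  unfolding mom_def by (rule sum.G_atLeast_1) (use assms in auto)

lemma pp_eq:
  assumes m: "fin_conf X m" and H: "H \<subseteq> all_index X" and mH: "\<And>z. m z \<noteq> 0 \<Longrightarrow> z \<in> H"
  shows "pp X H \<nu> m z = src H \<nu> z - quad_vec X m z"
proof (cases z)
  case (Pair a i)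
  from fin_conf_bound[OF m] obtain K where K: "\<And>a k. k > K \<Longrightarrow> m (a, k) = 0" by blast
  have "sum' (\<lambda>(b, k). root_form X a b * of_nat (min (tt X b * i) (tt X a * k)) * m (b, k)) H =
     (\<Sum>b\<in>nodes X. sum' (\<lambda>k. root_form X a b * of_nat (min (tt X b * i) (tt X a * k)) * m (b, k)) {1..})"
  proof -
    define g where "g = (\<lambda>(b, k). root_form X a b * of_nat (min (tt X b * i) (tt X a * k)) * m (b, k))"
    have "(b, k) \<in> H \<and> k \<le> K" if "g (b, k) \<noteq> 0" for b k
    proof -
      have "m (b, k) \<noteq> 0" using that by (auto simp: g_def)
      thus ?thesis using mH[of "(b, k)"] K[of k b] by (meson not_le)
    qed
    hence "sum' g H = (\<Sum>b\<in>nodes X. sum' (\<lambda>k. g (b, k)) {1..})"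
      by (intro sum.G_sites(2)[OF H, of _ K]) blast
    thus ?thesis by (simp add: g_def)
  qed
  also have "\<dots> = (\<Sum>b\<in>nodes X. gram X a b * mom (stp X b) (\<lambda>k. m (b, k)) (stp X a * i))"
  proof (intro sum.cong refl)
    fix b
    have "sum' (\<lambda>k. root_form X a b * of_nat (min (tt X b * i) (tt X a * k)) * m (b, k)) {1..} =
      (\<Sum>k=1..K. root_form X a b * of_nat (min (tt X b * i) (tt X a * k)) * m (b, k))"
      by (rule sum.G_atLeast_1) (use K in auto)
    also have "\<dots> = gram X a b * mom (stp X b) (\<lambda>k. m (b, k)) (stp X a * i)"
      unfolding root_form_min by (subst mom_eq_sum[of K]) (use K in \<open>auto simp: sum_distrib_left mult.assoc\<close>)
    finally show "sum' (\<lambda>k. root_form X a b * of_nat (min (tt X b * i) (tt X a * k)) * m (b, k)) {1..} =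
      gram X a b * mom (stp X b) (\<lambda>k. m (b, k)) (stp X a * i)" .
  qed
  finally show ?thesis by (simp add: Pair pp_def src_def quad_vec_def)
qed

lemma pair_sum_eq_sum:
  assumes "\<And>a k. k > K \<Longrightarrow> m (a, k) = 0"
  shows "pair_sum X f m = (\<Sum>z\<in>nodes X \<times> {1..K}. f z * m z)"
  unfolding pair_sum_def sum.cartesian_product[symmetric]
  by (simp only: sum.cartesian_product', intro sum.cong refl sum.G_atLeast_1) (use assms in auto)

lemma quad_vec_eq_sum:
  assumes "\<And>a k. k > K \<Longrightarrow> m (a, k) = 0"
  shows "quad_vec X m z = (\<Sum>w\<in>nodes X \<times> {1..K}.
     gram X (fst z) (fst w) * of_nat (min (stp X (fst z) * snd z) (stp X (fst w) * snd w)) * m w)"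
  unfolding quad_vec_def using mom_eq_sum[of K, OF assms]
  by (simp add: case_prod_beta sum.cartesian_product' sum_distrib_left mult.assoc)

lemma cc_eq:
  assumes m: "fin_conf X m" and H: "H \<subseteq> all_index X" and mH: "\<And>z. m z \<noteq> 0 \<Longrightarrow> z \<in> H"
    and \<nu>: "finite {z \<in> H. \<nu> z \<noteq> 0}"
  shows "cc X H \<nu> m = 1 / 2 * pair_sum X (quad_vec X m) m - pair_sum X (src H \<nu>) m"
proof -
  from fin_conf_bound[OF m] obtain K0 where K0: "\<And>a k. k > K0 \<Longrightarrow> m (a, k) = 0" by blast
  have "finite (snd ` {z \<in> H. \<nu> z \<noteq> 0})" using \<nu> by simp
  then obtain K1 where K1: "\<And>k. k \<in> snd ` {z \<in> H. \<nu> z \<noteq> 0} \<Longrightarrow> k \<le> K1"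
    by (metis finite_nat_set_iff_bounded_le)
  define K where "K = max K0 K1"
  have K: "m (a, k) = 0" if "k > K" for a k using K0 that by (simp add: K_def)
  have N: "k \<le> K" if "(a, k) \<in> H" "\<nu> (a, k) \<noteq> 0" for a k using K1[of k] that by (force simp: K_def)
  define B where "B = nodes X \<times> {1..K}"
  have fB: "finite B" by (simp add: B_def)
  have mB: "z \<in> B" if "m z \<noteq> 0" for z
    using that K mH H by (cases z) (force simp: B_def all_index_def not_le[symmetric])
  have "sum' (\<lambda>((a, j), (b, k)).
        root_form X a b * of_nat (min (tt X b * j) (tt X a * k)) * m (a, j) * m (b, k)) (H \<times> H)
     = sum' (\<lambda>((a, j), (b, k)).
        root_form X a b * of_nat (min (tt X b * j) (tt X a * k)) * m (a, j) * m (b, k)) ((H \<times> H) \<inter> (B \<times> B))"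
    using mB by (intro sum.mono_neutral_right') auto
  also have "\<dots> = sum' (\<lambda>((a, j), (b, k)).
        root_form X a b * of_nat (min (tt X b * j) (tt X a * k)) * m (a, j) * m (b, k)) (B \<times> B)"
    using mH by (intro sum.mono_neutral_left') auto
  also have "\<dots> = (\<Sum>z\<in>B. \<Sum>w\<in>B. root_form X (fst z) (fst w) *
      of_nat (min (tt X (fst w) * snd z) (tt X (fst z) * snd w)) * m z * m w)"
    using fB by (simp add: case_prod_beta sum.cartesian_product')
  also have "\<dots> = (\<Sum>z\<in>B. quad_vec X m z * m z)"
    unfolding root_form_min using K
    by (simp add: quad_vec_eq_sum[of K] B_def sum_distrib_right sum_distrib_left mult_ac)
  also have "\<dots> = pair_sum X (quad_vec X m) m"
    using K by (simp add: pair_sum_eq_sum[of K] B_def)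
  finally have 1: "sum' (\<lambda>((a, j), (b, k)).
        root_form X a b * of_nat (min (tt X b * j) (tt X a * k)) * m (a, j) * m (b, k)) (H \<times> H) =
        pair_sum X (quad_vec X m) m" .
  let ?f = "\<lambda>((a, j), (b, k)). of_nat (\<nu> (a, j) * min j k) * m (a, k)"
  \<comment> \<open>The linear part of \<open>cc\<close> runs over a node and two of its columns.
    \<open>C\<close> parametrises a finite set containing the support by the site \<open>z\<close>
    of \<open>m\<close> and the source column \<open>j\<close>, so that summing over
    \<open>j\<close> first produces \<open>src\<close>.\<close>
  define C where "C = (\<lambda>(z, j). ((fst z, j), z)) ` (SIGMA z:B. {j \<in> {1..K}. (fst z, j) \<in> H})"
  have "sum' ?f {((a, j), (b, k)). (a, j) \<in> H \<and> (b, k) \<in> H \<and> b = a} =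
     sum' ?f ({((a, j), (b, k)). (a, j) \<in> H \<and> (b, k) \<in> H \<and> b = a} \<inter> C)"
  proof (rule sum.mono_neutral_right')
    show "\<forall>i\<in>{((a, j), (b, k)). (a, j) \<in> H \<and> (b, k) \<in> H \<and> b = a} -
         ({((a, j), (b, k)). (a, j) \<in> H \<and> (b, k) \<in> H \<and> b = a} \<inter> C). ?f i = 0"
    proof (intro ballI)
      fix z assume z: "z \<in> {((a, j), (b, k)). (a, j) \<in> H \<and> (b, k) \<in> H \<and> b = a} -
         ({((a, j), (b, k)). (a, j) \<in> H \<and> (b, k) \<in> H \<and> b = a} \<inter> C)"
      then obtain a j k where a: "z = ((a, j), (a, k))" "(a, j) \<in> H" "(a, k) \<in> H"
        "((a, j), (a, k)) \<notin> C" by auto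
      show "?f z = 0"
      proof (rule ccontr)
        assume "?f z \<noteq> 0"
        hence "\<nu> (a, j) \<noteq> 0" "m (a, k) \<noteq> 0" "j \<noteq> 0" by (auto simp: a)
        hence "j \<in> {1..K}" "(a, k) \<in> B" using N[OF a(2)] mB by auto
        hence "((a, j), a, k) \<in> C" using a(2) by (force simp: C_def)
        thus False using a by simp
      qed
    qed
  qed auto
  also have "\<dots> = sum' ?f C"
    using mH by (intro sum.mono_neutral_left') (auto simp: C_def)
  also have "\<dots> = sum ?f C"
    using fB by (intro sum.eq_sum) (auto simp: C_def)
  also have "\<dots> = (\<Sum>(z, j)\<in>(SIGMA z:B. {j \<in> {1..K}. (fst z, j) \<in> H}). of_nat (\<nu> (fst z, j) * min j (snd z)) * m z)"
    unfolding C_def by (subst sum.reindex) (auto simp: inj_on_def case_prod_beta)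
  also have "\<dots> = (\<Sum>z\<in>B. \<Sum>j\<in>{j \<in> {1..K}. (fst z, j) \<in> H}. of_nat (\<nu> (fst z, j) * min j (snd z)) * m z)"
    using fB by (subst sum.Sigma) auto
  also have "\<dots> = (\<Sum>z\<in>B. src H \<nu> z * m z)"
  proof (intro sum.cong refl)
    fix z
    have "src H \<nu> z = sum' (\<lambda>j. of_nat (\<nu> (fst z, j) * min (snd z) j)) {j. (fst z, j) \<in> H}"
      by (simp add: src_def case_prod_beta)
    also have "\<dots> = sum' (\<lambda>j. of_nat (\<nu> (fst z, j) * min (snd z) j)) {j \<in> {1..K}. (fst z, j) \<in> H}"
      using N by (intro sum.mono_neutral_right') force+
    also have "\<dots> = (\<Sum>j\<in>{j \<in> {1..K}. (fst z, j) \<in> H}. of_nat (\<nu> (fst z, j) * min j (snd z)))"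
      by (subst sum.eq_sum) (auto simp: min.commute)
    finally show "(\<Sum>j\<in>{j \<in> {1..K}. (fst z, j) \<in> H}. of_nat (\<nu> (fst z, j) * min j (snd z)) * m z) =
       src H \<nu> z * m z" by (simp add: sum_distrib_right)
  qed
  also have "\<dots> = pair_sum X (src H \<nu>) m"
    using K by (simp add: pair_sum_eq_sum[of K] B_def)
  finally show ?thesis unfolding cc_def 1 by simp
qed

lemma src_W_power: "s \<ge> 1 \<Longrightarrow> a \<in> nodes X \<Longrightarrow>
  src (all_index X) (W_power r s L) (a, i) = (if a = r then of_nat (L * min i s) else 0)"
proof -
  assume s: "s \<ge> 1" and a: "a \<in> nodes X"
  have "src (all_index X) (W_power r s L) (a, i) = 
     sum' (\<lambda>j. of_nat ((if a = r \<and> j = s then L else 0) * min i j)) {1..}"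
    using a by (auto simp: src_def all_index_def W_power_def atLeast_def intro!: sum.cong')
  also have "\<dots> = sum' (\<lambda>j. of_nat ((if a = r \<and> j = s then L else 0) * min i j)) {s}"
    using s by (intro sum.mono_neutral_right') auto
  finally show ?thesis by simp
qed

lemma src_W_vec: 
  assumes "(a, 1) \<in> H" "i \<ge> 1"
  shows "src H (W_vec \<eta>) (a, i) = of_nat (\<eta> a)"
proof -
  have "src H (W_vec \<eta>) (a, i) = 
     sum' (\<lambda>j. of_nat ((if j = 1 then \<eta> a else 0) * min i j)) {1}"
    unfolding src_def prod.case W_vec_def
    using assms by (intro sum.mono_neutral_right') auto
  thus ?thesis using assms by simp
qed

section \<open>Reflecting and shifting one row\<close>

definition tot :: "(nat \<Rightarrow> rat) \<Rightarrow> rat" where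
  "tot d = sum' d {1..}"

text \<open>Read backwards from \<open>u\<close>, the drops of slope reappear in reversed order.
  Near the old origin the moment has slope \<open>tot d\<close>, and as \<open>mom\<close> is
  constant beyond its last column, column \<open>u\<close> has to absorb this slope, with the
  opposite sign.\<close>

definition lower :: "nat \<Rightarrow> (nat \<Rightarrow> rat) \<Rightarrow> nat \<Rightarrow> rat" where
  "lower u d j = (if j = 0 \<or> u < j then 0 else if j = u then - tot d else d (u - j))"

definition upper :: "nat \<Rightarrow> (nat \<Rightarrow> rat) \<Rightarrow> nat \<Rightarrow> rat" where
  "upper v d j = (if j = 0 then 0 else d (v + j))"

text \<open>A long row has \<open>c = 2\<close> and \<open>t = 1\<close>, a short row
  \<open>c = 1\<close> and \<open>t = 2\<close>. In both cases the columns \<open>u\<close> and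
  \<open>u + t\<close> sit at positions \<open>2 l\<close> and \<open>2 l + 2\<close>.\<close>

locale node_row =
  fixes c t l u :: nat and d :: "nat \<Rightarrow> rat"
  assumes ct: "c = 1 \<and> t = 2 \<or> c = 2 \<and> t = 1" and u: "u = t * l"
    and fin: "finite {k. d k \<noteq> 0}"
begin

lemma cu: "c * u = 2 * l" and cut: "c * (u + t) = 2 * l + 2" and cutj: "c * (u + t + j) = 2 * l + 2 + c * j"
  using ct by (auto simp: u algebra_simps)

lemma t: "t = 1 \<or> t = 2" using ct by auto

lemma u_pos: "u > 0 \<longleftrightarrow> l > 0" using ct by (auto simp: u)

lemma row_split:
  assumes "\<And>k. d k = 0 \<Longrightarrow> f k = (0 :: rat)"
  shows "sum' f {1..} = (\<Sum>j=1..<u. f (u - j)) + (if u > 0 then f u else 0) +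
     (if t = 2 then f (Suc u) else 0) + f (u + t) + sum' (\<lambda>j. f (u + t + j)) {1..}"
  by (rule sum.G_split[OF finite_subset[OF _ fin] t]) (use assms in auto)

lemma tot_upper: "tot (upper (u + t) d) = sum' (\<lambda>j. d (u + t + j)) {1..}"
  unfolding tot_def by (rule sum.cong') (auto simp: upper_def)

lemma mom_upper: "mom c (upper (u + t) d) x = sum' (\<lambda>j. of_nat (min x (c * j)) * d (u + t + j)) {1..}"
  unfolding mom_def by (rule sum.cong') (auto simp: upper_def)

lemma wtot_upper: "wtot c (upper (u + t) d) = sum' (\<lambda>j. of_nat (c * j) * d (u + t + j)) {1..}"
  unfolding wtot_def by (rule sum.cong') (auto simp: upper_def)

lemma tot_split: "tot d = (\<Sum>j=1..<u. d (u - j)) + (if u > 0 then d u else 0) +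
     (if t = 2 then d (Suc u) else 0) + d (u + t) + tot (upper (u + t) d)"
  unfolding tot_upper unfolding tot_def by (rule row_split)

lemma mom_split: "mom c d x = (\<Sum>j=1..<u. of_nat (min x (c * (u - j))) * d (u - j)) +
   (if u > 0 then of_nat (min x (2 * l)) * d u else 0) +
     (if t = 2 then of_nat (min x (2 * l + 1)) * d (Suc u) else 0) + of_nat (min x (2 * l + 2)) * d (u + t) +
     sum' (\<lambda>j. of_nat (min x (2 * l + 2 + c * j)) * d (u + t + j)) {1..}"
proof -
  have e: "(if t = 2 then of_nat (min x (c * Suc u)) * d (Suc u) else 0) = (if t = 2 then of_nat (min x (2 * l + 1)) * d (Suc u) else (0::rat))"
    using ct u by auto
  have "mom c d x = (\<Sum>j=1..<u. of_nat (min x (c * (u - j))) * d (u - j)) +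
   (if u > 0 then of_nat (min x (c * u)) * d u else 0) +
     (if t = 2 then of_nat (min x (c * Suc u)) * d (Suc u) else 0) + of_nat (min x (c * (u + t))) * d (u + t) +
     sum' (\<lambda>j. of_nat (min x (c * (u + t + j))) * d (u + t + j)) {1..}"
    unfolding mom_def by (rule row_split) simp
  thus ?thesis unfolding e cu cut cutj .
qed

lemma wtot_split: "wtot c d = (\<Sum>j=1..<u. of_nat (c * (u - j)) * d (u - j)) +
   (if u > 0 then of_nat (2 * l) * d u else 0) +
     (if t = 2 then of_nat (2 * l + 1) * d (Suc u) else 0) + of_nat (2 * l + 2) * d (u + t) +
     sum' (\<lambda>j. of_nat (2 * l + 2 + c * j) * d (u + t + j)) {1..}"
proof -
  have e: "(if t = 2 then of_nat (c * Suc u) * d (Suc u) else 0) = (if t = 2 then of_nat (2 * l + 1) * d (Suc u) else (0::rat))"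
    using ct u by auto
  have "wtot c d = (\<Sum>j=1..<u. of_nat (c * (u - j)) * d (u - j)) +
   (if u > 0 then of_nat (c * u) * d u else 0) +
     (if t = 2 then of_nat (c * Suc u) * d (Suc u) else 0) + of_nat (c * (u + t)) * d (u + t) +
     sum' (\<lambda>j. of_nat (c * (u + t + j)) * d (u + t + j)) {1..}"
    unfolding wtot_def by (rule row_split) simp
  thus ?thesis unfolding e cu cut cutj .
qed

lemma fin_d_up: "finite {j \<in> A. f j * d (u + t + j) \<noteq> 0}"
  by (rule finite_subset[OF _ finite_vimageI[OF fin, of "\<lambda>j. u + t + j"]]) 
     (auto simp: inj_on_def)

lemma sum'_up_add:
  "sum' (\<lambda>j. (f j + g j) * d (u + t + j)) {1..} =
   sum' (\<lambda>j. f j * d (u + t + j)) {1..} + sum' (\<lambda>j. g j * d (u + t + j)) {1..}"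
  unfolding distrib_right by (rule sum.distrib') (rule fin_d_up)+

lemma sum'_up_const:
  "sum' (\<lambda>j. b * d (u + t + j)) {1..} = b * tot (upper (u + t) d)"
proof -
  obtain K where K: "\<And>k. k > K \<Longrightarrow> d (u + t + k) = 0"
    using fin by (metis (mono_tags, lifting) finite_nat_set_iff_bounded_le le_add2 le_trans mem_Collect_eq not_less)
  have "sum' (\<lambda>j. b * d (u + t + j)) {1..} = (\<Sum>j=1..K. b * d (u + t + j))"
    by (rule sum.G_atLeast_1) (use K in auto)
  moreover have "sum' (\<lambda>j. d (u + t + j)) {1..} = (\<Sum>j=1..K. d (u + t + j))"
    by (rule sum.G_atLeast_1) (use K in auto)
  ultimately show ?thesis by (simp add: tot_upper sum_distrib_left)
qed

text \<open>Up to position \<open>2 l\<close> every column from \<open>u\<close> on contributes its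
  multiplicity times \<open>x\<close>.\<close>

lemma mom_small: "x \<le> 2 * l \<Longrightarrow> mom c d x = (\<Sum>j=1..<u. of_nat (min x (c * (u - j))) * d (u - j)) +
   of_nat x * (tot d - (\<Sum>j=1..<u. d (u - j)))"
proof -
  assume x: "x \<le> 2 * l"
  have "sum' (\<lambda>j. of_nat (min x (2 * l + 2 + c * j)) * d (u + t + j)) {1..} = of_nat x * tot (upper (u + t) d)"
    using x unfolding sum'_up_const[symmetric] by (intro sum.cong' refl) (simp add: min_absorb1)
  thus ?thesis using x unfolding mom_split[of x] tot_split
    by (simp add: min_absorb1 algebra_simps)
qed

text \<open>The columns up to \<open>u + t\<close> lie at or below \<open>2 l + 2\<close> and
  contribute their own positions; for those beyond, \<open>min\<close> splits as
  \<open>2 l + 2\<close> plus a minimum measured from there.\<close>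

lemma mom_big: 
  "mom c d (2 * l + 2 + x) = (\<Sum>j=1..<u. of_nat (c * (u - j)) * d (u - j)) + of_nat (2 * l) * (if u > 0 then d u else 0) +
     (if t = 2 then of_nat (2 * l + 1) * d (Suc u) else 0) + of_nat (2 * l + 2) * (d (u + t) + tot (upper (u + t) d))
     + mom c (upper (u + t) d) x"
proof -
  have "sum' (\<lambda>j. of_nat (min (2 * l + 2 + x) (2 * l + 2 + c * j)) * d (u + t + j)) {1..} = 
     sum' (\<lambda>j. (of_nat (2 * l + 2) + of_nat (min x (c * j))) * d (u + t + j)) {1..}"
    by (intro sum.cong' refl) (simp add: min_add_distrib_right[symmetric] min_def)
  also have "\<dots> = of_nat (2 * l + 2) * tot (upper (u + t) d) + mom c (upper (u + t) d) x"
    unfolding sum'_up_add sum'_up_const mom_upper ..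
  finally have 1: "sum' (\<lambda>j. of_nat (min (2 * l + 2 + x) (2 * l + 2 + c * j)) * d (u + t + j)) {1..} =
      of_nat (2 * l + 2) * tot (upper (u + t) d) + mom c (upper (u + t) d) x" .
  have 2: "min (2 * l + 2 + x) (c * (u - j)) = c * (u - j)" for j
    using cu by (simp add: diff_mult_distrib2)
  show ?thesis unfolding mom_split[of "2 * l + 2 + x"] 1 2 by (simp add: algebra_simps)
qed

lemma mom_0 [simp]: "mom c f 0 = 0"
  by (simp add: mom_def sum.G_def)

lemma mom_up: "mom c d (2 * l + 2 + x) = mom c d (2 * l + 2) + mom c (upper (u + t) d) x"
  using mom_big[of x] mom_big[of 0] by simp

lemma wtot_up: "wtot c d = mom c d (2 * l + 2) + wtot c (upper (u + t) d)"
proof -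
  have "sum' (\<lambda>j. of_nat (2 * l + 2 + c * j) * d (u + t + j)) {1..} =
     sum' (\<lambda>j. (of_nat (2 * l + 2) + of_nat (c * j)) * d (u + t + j)) {1..}"
    by (simp only: of_nat_add)
  also have "\<dots> = of_nat (2 * l + 2) * tot (upper (u + t) d) + wtot c (upper (u + t) d)"
    unfolding sum'_up_add sum'_up_const wtot_upper ..
  finally show ?thesis
    using mom_big[of 0] unfolding wtot_split by (simp add: algebra_simps)
qed

text \<open>The slope is the mass still to the right: on the first unit interval this includes the
  middle column, on the second it does not.\<close>

lemma mom_diff: "mom c d (2 * l + 2) - mom c d (2 * l) =
   (if t = 2 then d (Suc u) else 0) + 2 * (d (u + t) + tot (upper (u + t) d))"
proof -
  have 2: "min (2 * l) (c * (u - j)) = c * (u - j)" for j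
    using cu by (simp add: diff_mult_distrib2)
  have "mom c d (2 * l) = (\<Sum>j=1..<u. of_nat (c * (u - j)) * d (u - j)) +
      of_nat (2 * l) * (tot d - (\<Sum>j=1..<u. d (u - j)))"
    using mom_small[of "2 * l"] unfolding 2 by simp
  thus ?thesis using mom_big[of 0] unfolding tot_split by (simp add: algebra_simps)
qed

text \<open>Minus the second difference at \<open>2 l + 1\<close>, which sees only the column
  sitting there.\<close>

lemma mom_centre: "2 * mom c d (2 * l + 1) = mom c d (2 * l) + mom c d (2 * l + 2) + (if t = 2 then d (Suc u) else 0)"
proof -
  have 2: "min (2 * l + 1) (c * (u - j)) = c * (u - j)" "min (2 * l) (c * (u - j)) = c * (u - j)" for j
    using cu by (simp_all add: diff_mult_distrib2)
  have "mom c d (2 * l) = (\<Sum>j=1..<u. of_nat (c * (u - j)) * d (u - j)) +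
      of_nat (2 * l) * (tot d - (\<Sum>j=1..<u. d (u - j)))"
    using mom_small[of "2 * l"] unfolding 2 by simp
  moreover have "sum' (\<lambda>j. of_nat (min (2 * l + 1) (2 * l + 2 + c * j)) * d (u + t + j)) {1..} =
     of_nat (2 * l + 1) * tot (upper (u + t) d)"
    unfolding sum'_up_const[symmetric] by (intro sum.cong' refl) (simp add: min_absorb1)
  ultimately show ?thesis using mom_big[of 0] unfolding mom_split[of "2 * l + 1"] 2 tot_split
    by (simp add: algebra_simps)
qed

lemma lower_sum:
  assumes "\<And>j. lower u d j = 0 \<Longrightarrow> g j = (0::rat)"
  shows "sum' g {1..} = (\<Sum>j=1..<u. g j) + (if u > 0 then g u else 0)"
proof -
  have "sum' g {1..} = (\<Sum>j=1..u. g j)"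
    by (rule sum.G_atLeast_1) (auto intro!: assms simp: lower_def)
  also have "\<dots> = (\<Sum>j=1..<u. g j) + (if u > 0 then g u else 0)"
    by (cases u) (auto simp: atLeastLessThanSuc_atLeastAtMost)
  finally show ?thesis .
qed

lemma mom_lower: "mom c (lower u d) x = (\<Sum>j=1..<u. of_nat (min x (c * j)) * d (u - j)) -
    (if u > 0 then of_nat (min x (2 * l)) * tot d else 0)"
  unfolding mom_def by (subst lower_sum) (auto simp: cu lower_def)

text \<open>Columnwise \<open>min (2 l - x) (2 l - c j) = 2 l - c j - x + min x (c j)\<close>. The
  terms \<open>- x\<close>, together with those of the columns from \<open>u\<close> on, add up to
  \<open>- x * tot d\<close>, the share of the last column of \<open>lower\<close>.\<close>

lemma mom_low:
  assumes x: "x \<le> 2 * l"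
  shows "mom c d (2 * l - x) = mom c d (2 * l) + mom c (lower u d) x"
proof -
  have le: "c * j \<le> 2 * l" if "j \<in> {1..<u}" for j
    using that cu by (metis atLeastLessThan_iff less_imp_le mult_le_mono2)
  have "(\<Sum>j=1..<u. of_nat (min (2 * l - x) (c * (u - j))) * d (u - j)) =
    (\<Sum>j=1..<u. (of_nat (min (2 * l) (c * (u - j))) - of_nat x + of_nat (min x (c * j))) * d (u - j))"
  proof (intro sum.cong refl arg_cong2[where f = "(*)"])
    fix j assume "j \<in> {1..<u}"
    hence "min (2 * l - x) (2 * l - c * j) + x = min (2 * l) (2 * l - c * j) + min x (c * j)"
      using le[of j] x by linarith
    from arg_cong[OF this, of "of_nat :: nat \<Rightarrow> rat"]
    show "(of_nat (min (2 * l - x) (c * (u - j))) :: rat) =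
       of_nat (min (2 * l) (c * (u - j))) - of_nat x + of_nat (min x (c * j))"
      unfolding of_nat_add diff_mult_distrib2 cu by linarith
  qed
  also have "\<dots> = (\<Sum>j=1..<u. of_nat (min (2 * l) (c * (u - j))) * d (u - j)) - of_nat x * (\<Sum>j=1..<u. d (u - j))
     + (\<Sum>j=1..<u. of_nat (min x (c * j)) * d (u - j))"
    by (simp add: algebra_simps sum.distrib sum_subtractf sum_distrib_left)
  finally show ?thesis using x u_pos
    unfolding mom_small[OF diff_le_self, of x] mom_small[OF order.refl] mom_lower
    by (cases "u > 0") (simp_all add: of_nat_diff min_absorb1 algebra_simps)
qed

end

section \<open>Splitting a configuration at the central columns\<close>

text \<open>Minus \<open>quad_vec\<close> as a function of the position, also where row
  \<open>a\<close> has no column. For a fluctuation this is the vacancy number, because the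
  reference point cancels the source.\<close>

definition vacancy :: "cartan_type \<Rightarrow> (nat \<times> nat \<Rightarrow> rat) \<Rightarrow> nat \<Rightarrow> nat \<Rightarrow> rat" where
  "vacancy X d a x = - (\<Sum>b\<in>nodes X. gram X a b * mom (stp X b) (\<lambda>k. d (b, k)) x)"

definition upper_conf :: "cartan_type \<Rightarrow> nat \<Rightarrow> (nat \<times> nat \<Rightarrow> rat) \<Rightarrow> nat \<times> nat \<Rightarrow> rat" where
  "upper_conf X l d = (\<lambda>(a, j). if a \<in> nodes X then upper (tt X a * l + tt X a) (\<lambda>k. d (a, k)) j else 0)"

definition lower_conf :: "cartan_type \<Rightarrow> nat \<Rightarrow> (nat \<times> nat \<Rightarrow> rat) \<Rightarrow> nat \<times> nat \<Rightarrow> rat" where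
  "lower_conf X l d = (\<lambda>(a, j). if a \<in> nodes X then lower (tt X a * l) (\<lambda>k. d (a, k)) j else 0)"

definition boundary_values ::
  "cartan_type \<Rightarrow> nat \<Rightarrow> (nat \<times> nat \<Rightarrow> rat) \<Rightarrow> (nat \<Rightarrow> nat) \<Rightarrow> (nat \<Rightarrow> nat) \<Rightarrow> (nat \<Rightarrow> nat) \<Rightarrow> bool" where
  "boundary_values X l d \<xi> \<eta> \<zeta> \<longleftrightarrow>
     (\<forall>a\<in>nodes X. of_nat (\<xi> a) = vacancy X d a (2 * l) \<and> of_nat (\<eta> a) = vacancy X d a (2 * l + 2)) \<and>
     (\<forall>a\<in>short_nodes X. of_nat (\<zeta> a) = vacancy X d a (2 * l + 1))"

lemma quad_vec_vacancy: "quad_vec X d (a, i) = - vacancy X d a (stp X a * i)"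
  by (simp add: quad_vec_def vacancy_def)

lemma vacancy_0 [simp]: "vacancy X d a 0 = 0"
  by (simp add: vacancy_def mom_def sum.G_def)

lemma node_row_conf: "fin_conf X d \<Longrightarrow> node_row (stp X b) (tt X b) l (tt X b * l) (\<lambda>k. d (b, k))"
  by unfold_locales (auto simp: stp_def tt_def fin_conf_row)

lemma fin_conf_upper_conf:
  assumes "fin_conf X d"
  shows "fin_conf X (upper_conf X l d)"
proof -
  from fin_conf_bound[OF assms] obtain K where K: "\<And>a k. k > K \<Longrightarrow> d (a, k) = 0" by blast
  show ?thesis
    by (rule fin_conf_boundI[of K]) (use K in \<open>auto simp: upper_conf_def upper_def all_index_def split: if_splits\<close>)
qed

lemma fin_conf_lower_conf:
  assumes "fin_conf X d"
  shows "fin_conf X (lower_conf X l d)"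
  by (rule fin_conf_boundI[of "2 * l"]) (auto simp: lower_conf_def lower_def all_index_def tt_def split: if_splits)

lemma vacancy_up:
  assumes "fin_conf X d"
  shows "vacancy X d a (2 * l + 2 + x) = vacancy X d a (2 * l + 2) + vacancy X (upper_conf X l d) a x"
proof -
  have "mom (stp X b) (\<lambda>k. d (b, k)) (2 * l + 2 + x) = mom (stp X b) (\<lambda>k. d (b, k)) (2 * l + 2) +
     mom (stp X b) (\<lambda>k. upper_conf X l d (b, k)) x" if "b \<in> nodes X" for b
    using node_row.mom_up[OF node_row_conf[OF assms]] that by (simp add: upper_conf_def)
  thus ?thesis unfolding vacancy_def by (simp add: algebra_simps sum.distrib)
qed

lemma vacancy_low:
  assumes "fin_conf X d" "x \<le> 2 * l"
  shows "vacancy X d a (2 * l - x) = vacancy X d a (2 * l) + vacancy X (lower_conf X l d) a x"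
proof -
  have "mom (stp X b) (\<lambda>k. d (b, k)) (2 * l - x) = mom (stp X b) (\<lambda>k. d (b, k)) (2 * l) +
     mom (stp X b) (\<lambda>k. lower_conf X l d (b, k)) x" if "b \<in> nodes X" for b
    using node_row.mom_low[OF node_row_conf[OF assms(1)] assms(2)] that by (simp add: lower_conf_def)
  thus ?thesis unfolding vacancy_def by (simp add: algebra_simps sum.distrib)
qed

lemma ginv_vacancy:
  assumes "admissible_type X" "b \<in> nodes X"
  shows "mom (stp X b) (\<lambda>k. d (b, k)) x = - (\<Sum>a\<in>nodes X. gram_inv X b a * vacancy X d a x)"
  using gram_inv_gram_vec[OF assms, of "\<lambda>b. mom (stp X b) (\<lambda>k. d (b, k)) x"]
  by (simp add: vacancy_def sum_negf)

lemma tt_2_iff: "tt X a = 2 \<longleftrightarrow> short_root X a"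
  by (simp add: tt_def)

lemma short_nodes_iff: "a \<in> short_nodes X \<longleftrightarrow> a \<in> nodes X \<and> short_root X a"
  by (simp add: short_nodes_def)

lemma sum_short: "(\<Sum>b\<in>nodes X. if b \<in> short_nodes X then f b else 0) = (\<Sum>b\<in>short_nodes X. f b :: rat)"
  using short_nodes_subset[of X] by (simp add: sum.inter_restrict[symmetric] Int_absorb1)

context
  fixes X l d \<xi> \<eta> \<zeta>
  assumes X: "admissible_type X" and d: "fin_conf X d" and bv: "boundary_values X l d \<xi> \<eta> \<zeta>"
begin

lemma boundary_mom:
  assumes a: "a \<in> nodes X"
  shows "mom (stp X a) (\<lambda>k. d (a, k)) (2 * l) = - ginv_vec X \<xi> a"
    and "mom (stp X a) (\<lambda>k. d (a, k)) (2 * l + 2) = - ginv_vec X \<eta> a"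
  using bv by (simp_all add: ginv_vacancy[OF X a] ginv_vec_def boundary_values_def)

text \<open>The second difference of the vacancy numbers at the middle position is
  \<open>gram\<close> applied to the middle columns. Those live on the short nodes, and only there
  is the middle vacancy number prescribed, so the square block inverted by \<open>D_inv\<close>
  determines them.\<close>

lemma boundary_centre:
  assumes a: "a \<in> nodes X"
  shows "(if tt X a = 2 then d (a, Suc (tt X a * l)) else 0) = centre X \<xi> \<eta> \<zeta> a"
proof -
  define e where "e b = (if tt X b = 2 then d (b, Suc (tt X b * l)) else 0)" for b
  have m: "2 * mom (stp X b) (\<lambda>k. d (b, k)) (2 * l + 1) = mom (stp X b) (\<lambda>k. d (b, k)) (2 * l) + 
      mom (stp X b) (\<lambda>k. d (b, k)) (2 * l + 2) + e b" for b
    using node_row.mom_centre[OF node_row_conf[OF d]] by (simp add: e_def)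
  have "2 * vacancy X d c (2 * l + 1) = vacancy X d c (2 * l) + vacancy X d c (2 * l + 2) - 
     (\<Sum>b\<in>nodes X. gram X c b * e b)" for c
  proof -
    have "2 * vacancy X d c (2 * l + 1) = - (\<Sum>b\<in>nodes X. gram X c b * (2 * mom (stp X b) (\<lambda>k. d (b, k)) (2 * l + 1)))"
      by (simp add: vacancy_def sum_distrib_left mult_ac)
    thus ?thesis unfolding m by (simp add: vacancy_def sum_distrib_left distrib_left sum.distrib)
  qed
  moreover have "(\<Sum>b\<in>nodes X. gram X c b * e b) = (\<Sum>b\<in>short_nodes X. gram X c b * e b)" for c
    unfolding sum_short[symmetric] by (intro sum.cong) (auto simp: e_def short_nodes_iff tt_2_iff)
  ultimately have g: "(\<Sum>b\<in>short_nodes X. gram X c b * e b) = of_nat (\<xi> c) + of_nat (\<eta> c) - 2 * of_nat (\<zeta> c)"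
    if "c \<in> short_nodes X" for c
    using bv that short_nodes_subset[of X] by (auto simp: boundary_values_def)
  show ?thesis
  proof (cases "a \<in> short_nodes X")
    case True
    have "e a = (\<Sum>b\<in>short_nodes X. D_inv X a b * (\<Sum>c\<in>short_nodes X. gram X b c * e c))"
      using D_inv_gram_vec[OF X True] by simp
    thus ?thesis using True by (simp add: g centre_def flip: e_def)
  next
    case False
    thus ?thesis using a by (auto simp: centre_def short_nodes_iff tt_2_iff)
  qed
qed

lemma boundary_right:
  assumes a: "a \<in> nodes X"
  shows "d (a, tt X a * l + tt X a) + tot (upper (tt X a * l + tt X a) (\<lambda>k. d (a, k))) =
     (ginv_vec X \<xi> a - ginv_vec X \<eta> a - centre X \<xi> \<eta> \<zeta> a) / 2"
  using node_row.mom_diff[OF node_row_conf[OF d], of a l] boundary_mom[OF a] boundary_centre[OF a]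
  by simp

lemma boundary_left:
  assumes a: "a \<in> nodes X" and l: "l > 0"
  shows "d (a, tt X a * l) = (ginv_vec X \<eta> a - ginv_vec X \<xi> a - centre X \<xi> \<eta> \<zeta> a) / 2 +
     tot (\<lambda>k. d (a, k)) - (\<Sum>j=1..<tt X a * l. d (a, tt X a * l - j))"
  using node_row.tot_split[OF node_row_conf[OF d], of a l] boundary_centre[OF a] boundary_right[OF a] l
  by (simp add: field_simps)

text \<open>\<open>D_inv\<close> applied to \<open>\<zeta> - (\<xi> + \<eta>) / 2\<close> is
  \<open>- centre / 2\<close>. In this form \<open>phi\<close> is a sum over single rows, to be
  matched row by row with the energy.\<close>

lemma phi_eq: "phi X \<xi> \<eta> \<zeta> = (\<Sum>a\<in>nodes X.
    (of_nat (\<xi> a) - of_nat (\<eta> a)) * (ginv_vec X \<xi> a - ginv_vec X \<eta> a) / 4 +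
    ((of_nat (\<xi> a) + of_nat (\<eta> a)) / 2 - of_nat (\<zeta> a)) * centre X \<xi> \<eta> \<zeta> a / 2)"
proof -
  have "(\<Sum>b\<in>short_nodes X. D_inv X a b * (of_nat (\<zeta> a) - of_nat (\<xi> a + \<eta> a) / 2) *
           (of_nat (\<zeta> b) - of_nat (\<xi> b + \<eta> b) / 2)) =
      ((of_nat (\<xi> a) + of_nat (\<eta> a)) / 2 - of_nat (\<zeta> a)) * centre X \<xi> \<eta> \<zeta> a / 2" 
    if "a \<in> short_nodes X" for a
  proof -
    have "(\<Sum>b\<in>short_nodes X. D_inv X a b * (of_nat (\<zeta> a) - of_nat (\<xi> a + \<eta> a) / 2) *
           (of_nat (\<zeta> b) - of_nat (\<xi> b + \<eta> b) / 2)) =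
       (\<Sum>b\<in>short_nodes X. ((of_nat (\<xi> a) + of_nat (\<eta> a)) / 2 - of_nat (\<zeta> a)) / 2 *
         (D_inv X a b * (of_nat (\<xi> b) + of_nat (\<eta> b) - 2 * of_nat (\<zeta> b))))"
      by (intro sum.cong refl) (simp add: field_simps)
    also have "\<dots> = ((of_nat (\<xi> a) + of_nat (\<eta> a)) / 2 - of_nat (\<zeta> a)) / 2 * centre X \<xi> \<eta> \<zeta> a"
      using that by (simp add: centre_def sum_distrib_left)
    finally show ?thesis by simp
  qed
  hence "(\<Sum>a\<in>short_nodes X. \<Sum>b\<in>short_nodes X. D_inv X a b * (of_nat (\<zeta> a) - of_nat (\<xi> a + \<eta> a) / 2) *
           (of_nat (\<zeta> b) - of_nat (\<xi> b + \<eta> b) / 2)) =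
      (\<Sum>a\<in>short_nodes X. ((of_nat (\<xi> a) + of_nat (\<eta> a)) / 2 - of_nat (\<zeta> a)) * centre X \<xi> \<eta> \<zeta> a / 2)"
    by (intro sum.cong refl) simp
  also have "\<dots> = (\<Sum>a\<in>nodes X. ((of_nat (\<xi> a) + of_nat (\<eta> a)) / 2 - of_nat (\<zeta> a)) * centre X \<xi> \<eta> \<zeta> a / 2)"
    unfolding sum_short[symmetric] by (intro sum.cong) (auto simp: centre_def)
  finally have 1: "(\<Sum>a\<in>short_nodes X. \<Sum>b\<in>short_nodes X. D_inv X a b * (of_nat (\<zeta> a) - of_nat (\<xi> a + \<eta> a) / 2) *
           (of_nat (\<zeta> b) - of_nat (\<xi> b + \<eta> b) / 2)) =
      (\<Sum>a\<in>nodes X. ((of_nat (\<xi> a) + of_nat (\<eta> a)) / 2 - of_nat (\<zeta> a)) * centre X \<xi> \<eta> \<zeta> a / 2)" .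
  have 2: "(\<Sum>b\<in>nodes X. gram_inv X a b * (of_nat (\<eta> b) - of_nat (\<xi> b))) = ginv_vec X \<eta> a - ginv_vec X \<xi> a" for a
    by (simp add: ginv_vec_def right_diff_distrib sum_subtractf)
  have 3: "1 / 2 * ((\<Sum>a\<in>nodes X. (of_nat (\<eta> a) - of_nat (\<xi> a)) * (ginv_vec X \<eta> a - ginv_vec X \<xi> a)) / 2) =
     (\<Sum>a\<in>nodes X. (of_nat (\<xi> a) - of_nat (\<eta> a)) * (ginv_vec X \<xi> a - ginv_vec X \<eta> a) / 4)"
    unfolding sum_divide_distrib sum_distrib_left by (intro sum.cong refl) (simp add: field_simps)
  show ?thesis
    unfolding phi_def Let_def weight_form_comb[OF X] 1 2 3 sum.distrib ..
qed

text \<open>In each row the vacancy number is \<open>\<eta>\<close> plus that of the right half, or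
  \<open>\<xi>\<close> plus that of the left half. The constants \<open>\<xi>\<close>,
  \<open>\<zeta>\<close>, \<open>\<eta>\<close> multiply the masses on the left, in the middle and
  on the right. The row total contained in the left mass is exactly the term of the last column of
  \<open>lower_conf\<close>.\<close>

lemma energy_split:
  "1 / 2 * pair_sum X (quad_vec X d) d = phi X \<xi> \<eta> \<zeta> +
     1 / 2 * pair_sum X (quad_vec X (upper_conf X l d)) (upper_conf X l d) +
     1 / 2 * pair_sum X (quad_vec X (lower_conf X l d)) (lower_conf X l d)"
proof -
  let ?U = "upper_conf X l d" and ?W = "lower_conf X l d"
  define F where "F a = (of_nat (\<xi> a) - of_nat (\<eta> a)) * (ginv_vec X \<xi> a - ginv_vec X \<eta> a) / 4 +
    ((of_nat (\<xi> a) + of_nat (\<eta> a)) / 2 - of_nat (\<zeta> a)) * centre X \<xi> \<eta> \<zeta> a / 2" for a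
  have "sum' (\<lambda>i. quad_vec X d (a, i) * d (a, i)) {1..} =
     sum' (\<lambda>i. quad_vec X ?U (a, i) * ?U (a, i)) {1..} + sum' (\<lambda>i. quad_vec X ?W (a, i) * ?W (a, i)) {1..} +
     2 * F a"
    if a: "a \<in> nodes X" for a
  proof -
    interpret node_row "stp X a" "tt X a" l "tt X a * l" "\<lambda>k. d (a, k)" by (rule node_row_conf[OF d])
    define c t u where "c = stp X a" and "t = tt X a" and "u = tt X a * l"
    define D where "D = (\<lambda>k. d (a, k))"
    define V where "V = vacancy X d a"
    define VU where "VU = vacancy X ?U a"
    define VW where "VW = vacancy X ?W a"
    define e where "e = centre X \<xi> \<eta> \<zeta> a"
    define S where "S = D (u + t) + tot (upper (u + t) D)"
    have xi: "V (2 * l) = of_nat (\<xi> a)" and eta: "V (2 * l + 2) = of_nat (\<eta> a)"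
      using bv a by (simp_all add: boundary_values_def V_def)
    have e: "(if t = 2 then D (Suc u) else 0) = e"
      unfolding e_def t_def u_def D_def by (rule boundary_centre[OF a])
    have S: "S = (ginv_vec X \<xi> a - ginv_vec X \<eta> a - e) / 2"
      using boundary_right[OF a] by (simp add: S_def D_def u_def t_def e_def)
    have ze: "(if t = 2 then V (c * Suc u) * D (Suc u) else 0) = of_nat (\<zeta> a) * e"
    proof (cases "t = 2")
      case True
      hence "a \<in> short_nodes X" "c * Suc u = 2 * l + 1"
        using a by (auto simp: t_def short_nodes_iff tt_2_iff u_def c_def stp_def)
      thus ?thesis using bv True e by (simp add: boundary_values_def V_def)
    next
      case False
      thus ?thesis using e by simp
    qed
    \<comment> \<open>At \<open>2 l\<close> the reflected function is evaluated at the old origin,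
      where \<open>V\<close> vanishes.\<close>
    have W2l: "u > 0 \<Longrightarrow> VW (2 * l) = - of_nat (\<xi> a)"
      using vacancy_low[OF d, of "2 * l" l a] xi by (simp add: V_def VW_def)
    \<comment> \<open>For \<open>l = 0\<close> the left half is empty, which is consistent because
      position \<open>2 l\<close> is then the origin.\<close>
    have u0: "\<xi> a = 0" if "\<not> u > 0"
      using xi that u_pos by (simp add: u_def V_def)
    have low: "sum' (\<lambda>i. quad_vec X ?W (a, i) * ?W (a, i)) {1..} =
       - (\<Sum>j=1..<u. VW (c * j) * D (u - j)) - (if u > 0 then of_nat (\<xi> a) * tot D else 0)"
    proof -
      have "sum' (\<lambda>i. quad_vec X ?W (a, i) * ?W (a, i)) {1..} = 
         sum' (\<lambda>i. - VW (c * i) * lower u D i) {1..}"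
        using a by (intro sum.cong' refl) (simp add: quad_vec_vacancy VW_def lower_conf_def u_def D_def c_def)
      also have "\<dots> = (\<Sum>j=1..<u. - VW (c * j) * lower u D j) + (if u > 0 then - VW (c * u) * lower u D u else 0)"
        unfolding u_def D_def by (rule lower_sum) simp
      also have "(\<Sum>j=1..<u. - VW (c * j) * lower u D j) = - (\<Sum>j=1..<u. VW (c * j) * D (u - j))"
        by (simp add: lower_def sum_negf)
      finally show ?thesis using W2l unfolding cu[folded c_def u_def] by (simp add: lower_def)
    qed
    have up: "sum' (\<lambda>i. quad_vec X ?U (a, i) * ?U (a, i)) {1..} = sum' (\<lambda>j. - VU (c * j) * D (u + t + j)) {1..}"
      using a by (intro sum.cong' refl) (simp add: quad_vec_vacancy VU_def upper_conf_def upper_def u_def t_def D_def c_def)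
    have "sum' (\<lambda>i. quad_vec X d (a, i) * d (a, i)) {1..} = sum' (\<lambda>i. - V (c * i) * D i) {1..}"
      by (simp add: quad_vec_vacancy V_def c_def D_def)
    also have "\<dots> = (\<Sum>j=1..<u. - V (c * (u - j)) * D (u - j)) + (if u > 0 then - V (c * u) * D u else 0) +
     (if t = 2 then - V (c * Suc u) * D (Suc u) else 0) + - V (c * (u + t)) * D (u + t) +
       sum' (\<lambda>j. - V (c * (u + t + j)) * D (u + t + j)) {1..}"
      unfolding u_def t_def D_def by (rule row_split) simp
    also have "sum' (\<lambda>j. - V (c * (u + t + j)) * D (u + t + j)) {1..} = 
       sum' (\<lambda>j. (- of_nat (\<eta> a) + - VU (c * j)) * D (u + t + j)) {1..}"
      using vacancy_up[OF d, of a l] eta unfolding u_def t_def c_def cutj 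
      by (intro sum.cong' refl) (simp add: V_def VU_def)
    also have "\<dots> = - of_nat (\<eta> a) * tot (upper (u + t) D) + sum' (\<lambda>i. quad_vec X ?U (a, i) * ?U (a, i)) {1..}"
      unfolding up unfolding u_def t_def D_def sum'_up_add sum'_up_const ..
    also have "(\<Sum>j=1..<u. - V (c * (u - j)) * D (u - j)) = 
       - of_nat (\<xi> a) * (\<Sum>j=1..<u. D (u - j)) - (\<Sum>j=1..<u. VW (c * j) * D (u - j))"
    proof -
      have "- V (c * (u - j)) * D (u - j) = - of_nat (\<xi> a) * D (u - j) - VW (c * j) * D (u - j)" if "j \<in> {1..<u}" for j
      proof -
        have "c * j \<le> c * u" using that by (intro mult_le_mono2) simp
        hence "c * j \<le> 2 * l" unfolding cu[folded c_def u_def] .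
        moreover have "c * (u - j) = 2 * l - c * j" unfolding diff_mult_distrib2 cu[folded c_def u_def] ..
        ultimately have "V (c * (u - j)) = of_nat (\<xi> a) + VW (c * j)"
          using vacancy_low[OF d, of "c * j" l a] xi by (simp add: V_def VW_def)
        thus ?thesis by (simp add: algebra_simps)
      qed
      hence "(\<Sum>j=1..<u. - V (c * (u - j)) * D (u - j)) =
         (\<Sum>j=1..<u. - of_nat (\<xi> a) * D (u - j) - VW (c * j) * D (u - j))"
        by (rule sum.cong[OF refl])
      thus ?thesis unfolding sum_subtractf sum_distrib_left .
    qed
    also have "(if u > 0 then - V (c * u) * D u else 0) = - of_nat (\<xi> a) * (if u > 0 then D u else 0)"
      unfolding cu[folded c_def u_def] xi by simp
    also have "(if t = 2 then - V (c * Suc u) * D (Suc u) else 0) = - of_nat (\<zeta> a) * e"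
      using ze by auto
    also have "- V (c * (u + t)) * D (u + t) = - of_nat (\<eta> a) * D (u + t)"
      unfolding cut[folded c_def u_def t_def] eta ..
    also have "- of_nat (\<xi> a) * (\<Sum>j=1..<u. D (u - j)) - (\<Sum>j=1..<u. VW (c * j) * D (u - j)) + 
       - of_nat (\<xi> a) * (if u > 0 then D u else 0) + - of_nat (\<zeta> a) * e + - of_nat (\<eta> a) * D (u + t) +
       (- of_nat (\<eta> a) * tot (upper (u + t) D) + sum' (\<lambda>i. quad_vec X ?U (a, i) * ?U (a, i)) {1..}) =
       sum' (\<lambda>i. quad_vec X ?U (a, i) * ?U (a, i)) {1..} + sum' (\<lambda>i. quad_vec X ?W (a, i) * ?W (a, i)) {1..} +
       (of_nat (\<xi> a) * (e + S) - of_nat (\<zeta> a) * e - of_nat (\<eta> a) * S)"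
    proof (cases "u > 0")
      case True
      have ts: "tot D = (\<Sum>j=1..<u. D (u - j)) + (if u > 0 then D u else 0) +
          (if t = 2 then D (Suc u) else 0) + D (u + t) + tot (upper (u + t) D)"
        unfolding D_def u_def t_def by (rule tot_split)
      have "tot D = (\<Sum>j=1..<u. D (u - j)) + D u + e + S"
        using ts True unfolding e S_def by simp
      thus ?thesis using True unfolding low S_def by (simp add: algebra_simps)
    next
      case False
      thus ?thesis using u0 unfolding low S_def by (simp add: algebra_simps)
    qed
    also have "of_nat (\<xi> a) * (e + S) - of_nat (\<zeta> a) * e - of_nat (\<eta> a) * S =
      2 * ((of_nat (\<xi> a) - of_nat (\<eta> a)) * (ginv_vec X \<xi> a - ginv_vec X \<eta> a) / 4 +
        ((of_nat (\<xi> a) + of_nat (\<eta> a)) / 2 - of_nat (\<zeta> a)) * e / 2)"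
      unfolding S by (simp add: field_simps)
    finally show ?thesis by (simp only: e_def F_def)
  qed
  hence "pair_sum X (quad_vec X d) d = (\<Sum>a\<in>nodes X. sum' (\<lambda>i. quad_vec X ?U (a, i) * ?U (a, i)) {1..} +
      sum' (\<lambda>i. quad_vec X ?W (a, i) * ?W (a, i)) {1..} + 2 * F a)"
    unfolding pair_sum_def by (intro sum.cong refl)
  also have "\<dots> = pair_sum X (quad_vec X ?U) ?U + pair_sum X (quad_vec X ?W) ?W + 2 * (\<Sum>a\<in>nodes X. F a)"
    unfolding sum.distrib pair_sum_def sum_distrib_left ..
  also have "(\<Sum>a\<in>nodes X. F a) = phi X \<xi> \<eta> \<zeta>"
    unfolding phi_eq F_def ..
  finally show ?thesis by simp
qed

end

section \<open>Reassembling a fluctuation from its boundary data and its halves\<close>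

definition assemble :: "cartan_type \<Rightarrow> nat \<Rightarrow> (nat \<Rightarrow> nat) \<Rightarrow> (nat \<Rightarrow> nat) \<Rightarrow> (nat \<Rightarrow> nat) \<Rightarrow>
    (nat \<times> nat \<Rightarrow> rat) \<Rightarrow> (nat \<times> nat \<Rightarrow> rat) \<Rightarrow> nat \<times> nat \<Rightarrow> rat" where
  "assemble X l \<xi> \<eta> \<zeta> mu ml = (\<lambda>(a, k).
     if (a, k) \<notin> all_index X then 0
     else if k < tt X a * l then ml (a, tt X a * l - k)
     else if k = tt X a * l then
       (ginv_vec X \<eta> a - ginv_vec X \<xi> a - centre X \<xi> \<eta> \<zeta> a) / 2 - (\<Sum>j=1..tt X a * l. ml (a, j))
     else if k < tt X a * l + tt X a then centre X \<xi> \<eta> \<zeta> a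
     else if k = tt X a * l + tt X a then
       (ginv_vec X \<xi> a - ginv_vec X \<eta> a - centre X \<xi> \<eta> \<zeta> a) / 2 - tot (\<lambda>j. mu (a, j))
     else mu (a, k - (tt X a * l + tt X a)))"

lemma level_index_subset: "level_index X l \<subseteq> all_index X"
  by (auto simp: level_index_def all_index_def)

lemma centre_long: "tt X a \<noteq> 2 \<Longrightarrow> centre X \<xi> \<eta> \<zeta> a = 0"
  by (auto simp: centre_def short_nodes_iff tt_2_iff)

text \<open>The hypothesis \<open>xi\<close> is the weight condition of the left half. With it the
  moments at the three central positions come out as prescribed by \<open>\<xi>\<close>,
  \<open>\<eta>\<close> and \<open>centre\<close>, and applying \<open>gram\<close> to them recovers
  the boundary data.\<close>

lemma
  assumes X: "admissible_type X" and mu: "fin_conf X mu" and ml: "fin_conf X ml"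
    and mlH: "\<And>z. ml z \<noteq> 0 \<Longrightarrow> z \<in> level_index X l"
    and xi: "\<And>a. a \<in> nodes X \<Longrightarrow> mom (stp X a) (\<lambda>k. ml (a, k)) (2 * l) = ginv_vec X \<xi> a"
  shows fin_conf_assemble: "fin_conf X (assemble X l \<xi> \<eta> \<zeta> mu ml)" 
    and upper_conf_assemble: "upper_conf X l (assemble X l \<xi> \<eta> \<zeta> mu ml) = mu" 
    and lower_conf_assemble: "lower_conf X l (assemble X l \<xi> \<eta> \<zeta> mu ml) = ml"
    and boundary_assemble: "boundary_values X l (assemble X l \<xi> \<eta> \<zeta> mu ml) \<xi> \<eta> \<zeta>"
proof -
  define d where "d = assemble X l \<xi> \<eta> \<zeta> mu ml"
  note d_eq = d_def[unfolded assemble_def, THEN fun_cong, of "(a, k)" for a k, simplified]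
  from fin_conf_bound[OF mu] obtain K where K: "\<And>a k. k > K \<Longrightarrow> mu (a, k) = 0" by blast
  show d: "fin_conf X d"
    by (rule fin_conf_boundI[of "2 * l + 2 + K"])
       (use K in \<open>auto simp: d_eq tt_def d_def assemble_def split: if_splits prod.splits\<close>)
  show up: "upper_conf X l d = mu"
    by (auto simp: fun_eq_iff upper_conf_def upper_def d_eq all_index_def fin_conf_0[OF mu])
  have up': "upper (tt X a * l + tt X a) (\<lambda>k. d (a, k)) = (\<lambda>j. mu (a, j))" if "a \<in> nodes X" for a
    using that unfolding up[symmetric] by (auto simp: upper_conf_def)
  \<comment> \<open>The left boundary column is chosen to make the row total equal to minus the last
    column of \<open>ml\<close>, which is what \<open>lower\<close> writes there.\<close>
  have tot_d: "tot (\<lambda>k. d (a, k)) = - ml (a, tt X a * l)" if a: "a \<in> nodes X" and l: "l > 0" for a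
  proof -
    have u: "tt X a * l > 0" using l by simp
    have "(\<Sum>j=1..<tt X a * l. d (a, tt X a * l - j)) = (\<Sum>j=1..<tt X a * l. ml (a, j))"
      using a by (intro sum.cong refl) (auto simp: d_eq all_index_def)
    moreover have "(\<Sum>j=1..tt X a * l. ml (a, j)) = (\<Sum>j=1..<tt X a * l. ml (a, j)) + ml (a, tt X a * l)"
      using u by (cases "tt X a * l") (auto simp: atLeastLessThanSuc_atLeastAtMost)
    moreover have "(if tt X a = 2 then d (a, Suc (tt X a * l)) else 0) = centre X \<xi> \<eta> \<zeta> a"
      using a centre_long[of X a] by (auto simp: d_eq all_index_def)
    moreover have "d (a, tt X a * l) = (ginv_vec X \<eta> a - ginv_vec X \<xi> a - centre X \<xi> \<eta> \<zeta> a) / 2 - 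
        (\<Sum>j=1..tt X a * l. ml (a, j))"
      using a u by (auto simp: d_eq all_index_def Suc_le_eq)
    moreover have "d (a, tt X a * l + tt X a) = (ginv_vec X \<xi> a - ginv_vec X \<eta> a - centre X \<xi> \<eta> \<zeta> a) / 2 - 
        tot (\<lambda>j. mu (a, j))"
      using a tt_pos[of X a] by (auto simp: d_eq all_index_def Suc_le_eq)
    ultimately show ?thesis
      using node_row.tot_split[OF node_row_conf[OF d], of a l] u unfolding up'[OF a]
      by (simp add: field_simps)
  qed
  show low: "lower_conf X l d = ml"
  proof (rule ext, clarify)
    fix a j
    consider "a \<notin> nodes X \<or> j = 0 \<or> j > tt X a * l" | "a \<in> nodes X" "0 < j" "j = tt X a * l"
      | "a \<in> nodes X" "0 < j" "j < tt X a * l"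
      by force
    thus "lower_conf X l d (a, j) = ml (a, j)"
    proof cases
      case 1
      hence "(a, j) \<notin> level_index X l" by (auto simp: level_index_def)
      hence "ml (a, j) = 0" using mlH by blast
      thus ?thesis using 1 by (auto simp: lower_conf_def lower_def)
    next
      case 2
      thus ?thesis using tot_d[of a] by (auto simp: lower_conf_def lower_def)
    next
      case 3
      thus ?thesis by (auto simp: lower_conf_def lower_def d_eq all_index_def)
    qed
  qed
  have m0: "mom (stp X a) (\<lambda>k. d (a, k)) (2 * l) = - ginv_vec X \<xi> a" if "a \<in> nodes X" for a
  proof -
    have "lower (tt X a * l) (\<lambda>k. d (a, k)) = (\<lambda>j. ml (a, j))"
      using that unfolding low[symmetric] by (auto simp: lower_conf_def)
    thus ?thesis
      using node_row.mom_low[OF node_row_conf[OF d], of "2 * l" l a] node_row.mom_0[OF node_row_conf[OF d], of a]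
        xi[OF that] by simp
  qed
  have ce: "(if tt X a = 2 then d (a, Suc (tt X a * l)) else 0) = centre X \<xi> \<eta> \<zeta> a" if "a \<in> nodes X" for a
    using that centre_long[of X a] by (auto simp: d_eq all_index_def)
  have m2: "mom (stp X a) (\<lambda>k. d (a, k)) (2 * l + 2) = - ginv_vec X \<eta> a" if "a \<in> nodes X" for a
  proof -
    have "d (a, tt X a * l + tt X a) = (ginv_vec X \<xi> a - ginv_vec X \<eta> a - centre X \<xi> \<eta> \<zeta> a) / 2 - 
        tot (\<lambda>j. mu (a, j))"
      using that tt_pos[of X a] by (auto simp: d_eq all_index_def Suc_le_eq)
    thus ?thesis using node_row.mom_diff[OF node_row_conf[OF d], of a l]
      unfolding up'[OF that] ce[OF that] m0[OF that] by (simp add: field_simps)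
  qed
  have m1: "2 * mom (stp X a) (\<lambda>k. d (a, k)) (2 * l + 1) = - ginv_vec X \<xi> a - ginv_vec X \<eta> a + centre X \<xi> \<eta> \<zeta> a"
    if "a \<in> nodes X" for a
    using node_row.mom_centre[OF node_row_conf[OF d], of a l] 
    unfolding ce[OF that] m0[OF that] m2[OF that] by simp
  have gx: "(\<Sum>b\<in>nodes X. gram X a b * ginv_vec X \<xi> b) = of_nat (\<xi> a)" if "a \<in> nodes X" for \<xi> a
    unfolding ginv_vec_def by (rule gram_gram_inv_vec[OF X that])
  show "boundary_values X l d \<xi> \<eta> \<zeta>"
    unfolding boundary_values_def
  proof (intro conjI ballI)
    fix a assume a: "a \<in> nodes X"
    show "of_nat (\<xi> a) = vacancy X d a (2 * l)" "of_nat (\<eta> a) = vacancy X d a (2 * l + 2)"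
      using gx[OF a] by (simp_all add: vacancy_def m0 m2[simplified] sum_negf)
  next
    fix a assume as: "a \<in> short_nodes X"
    hence a: "a \<in> nodes X" using short_nodes_subset by auto
    have "(\<Sum>b\<in>nodes X. gram X a b * centre X \<xi> \<eta> \<zeta> b) = (\<Sum>b\<in>short_nodes X. gram X a b * centre X \<xi> \<eta> \<zeta> b)"
      unfolding sum_short[symmetric] by (intro sum.cong) (auto simp: centre_def)
    also have "\<dots> = of_nat (\<xi> a) + of_nat (\<eta> a) - 2 * of_nat (\<zeta> a)"
      using gram_D_inv_vec[OF X as, of "\<lambda>b. of_nat (\<xi> b) + of_nat (\<eta> b) - 2 * of_nat (\<zeta> b)"]
      by (simp add: centre_def)
    finally have g: "(\<Sum>b\<in>nodes X. gram X a b * centre X \<xi> \<eta> \<zeta> b) = of_nat (\<xi> a) + of_nat (\<eta> a) - 2 * of_nat (\<zeta> a)" .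
    have "2 * vacancy X d a (2 * l + 1) = - (\<Sum>b\<in>nodes X. gram X a b * (2 * mom (stp X b) (\<lambda>k. d (b, k)) (2 * l + 1)))"
      by (simp add: vacancy_def sum_distrib_left mult_ac)
    also have "\<dots> = - (\<Sum>b\<in>nodes X. gram X a b * (- ginv_vec X \<xi> b - ginv_vec X \<eta> b + centre X \<xi> \<eta> \<zeta> b))"
      using m1 by simp
    also have "\<dots> = 2 * of_nat (\<zeta> a)"
      using gx[OF a] g by (simp add: algebra_simps sum.distrib sum_subtractf)
    finally show "of_nat (\<zeta> a) = vacancy X d a (2 * l + 1)" by simp
  qed
qed

text \<open>The halves and the boundary data leave no freedom: \<open>boundary_left\<close>,
  \<open>boundary_centre\<close> and \<open>boundary_right\<close> force the central
  columns.\<close>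

lemma assemble_unique:
  assumes X: "admissible_type X" and d: "fin_conf X d" and bv: "boundary_values X l d \<xi> \<eta> \<zeta>"
  shows "assemble X l \<xi> \<eta> \<zeta> (upper_conf X l d) (lower_conf X l d) = d"
proof (rule ext, clarify)
  fix a k
  show "assemble X l \<xi> \<eta> \<zeta> (upper_conf X l d) (lower_conf X l d) (a, k) = d (a, k)"
  proof (cases "(a, k) \<in> all_index X")
    case False
    thus ?thesis using fin_conf_0(3)[OF d] by (simp add: assemble_def)
  next
    case True
    hence a: "a \<in> nodes X" and k: "k > 0" by (auto simp: all_index_def)
    have tup: "tot (\<lambda>j. upper_conf X l d (a, j)) = tot (upper (tt X a * l + tt X a) (\<lambda>k. d (a, k)))"
      using a by (simp add: upper_conf_def)
    consider "k < tt X a * l" | "k = tt X a * l" | "tt X a * l < k" "k < tt X a * l + tt X a" 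
      | "k = tt X a * l + tt X a" | "tt X a * l + tt X a < k" by linarith
    thus ?thesis
    proof cases
      case 1
      thus ?thesis using True a k by (auto simp: assemble_def lower_conf_def lower_def)
    next
      case 2
      hence l: "l > 0" and u: "tt X a * l > 0" using k by auto
      have "(\<Sum>j=1..tt X a * l. lower_conf X l d (a, j)) = 
          (\<Sum>j=1..<tt X a * l. lower_conf X l d (a, j)) + lower_conf X l d (a, tt X a * l)"
        using u by (cases "tt X a * l") (auto simp: atLeastLessThanSuc_atLeastAtMost)
      also have "\<dots> = (\<Sum>j=1..<tt X a * l. d (a, tt X a * l - j)) - tot (\<lambda>k. d (a, k))"
        using a u by (simp add: lower_conf_def lower_def)
      finally show ?thesis
        using True 2 boundary_left[OF X d bv a l] by (simp add: assemble_def)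
    next
      case 3
      hence "tt X a = 2" "k = Suc (tt X a * l)" by (auto simp: tt_def split: if_splits)
      thus ?thesis using True 3 boundary_centre[OF X d bv a] by (simp add: assemble_def)
    next
      case 4
      thus ?thesis using True boundary_right[OF X d bv a] tup by (simp add: assemble_def field_simps)
    next
      case 5
      thus ?thesis using True a by (simp add: assemble_def upper_conf_def upper_def)
    qed
  qed
qed

section \<open>Configurations described by moments\<close>

lemma configs_iff:
  assumes H: "H \<subseteq> all_index X" and \<nu>: "finite {z \<in> H. \<nu> z \<noteq> 0}"
  shows "m \<in> configs X H \<nu> lam \<longleftrightarrow> fin_conf X (\<lambda>z. of_nat (m z)) \<and> (\<forall>z. m z \<noteq> 0 \<longrightarrow> z \<in> H) \<and>
     (\<forall>z\<in>H. quad_vec X (\<lambda>z. of_nat (m z)) z \<le> src H \<nu> z) \<and>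
     (\<forall>b\<in>nodes X. wtot (stp X b) (\<lambda>k. of_nat (m (b, k))) =
        of_nat (stp X b) * (sum' (\<lambda>(a, i). of_nat (i * \<nu> (a, i)) * fund_weight X a b) H - lam b))"
proof -
  have "m \<in> configs X H \<nu> lam \<longleftrightarrow> fin_conf X (\<lambda>z. of_nat (m z)) \<and> (\<forall>z. m z \<noteq> 0 \<longrightarrow> z \<in> H) \<and>
     (\<forall>z\<in>H. pp X H \<nu> (\<lambda>z. of_nat (m z)) z \<ge> 0) \<and>
     (\<forall>b\<in>nodes X. sum' (\<lambda>(a, i). of_nat (i * m (a, i)) * simple_root a b) H =
        sum' (\<lambda>(a, i). of_nat (i * \<nu> (a, i)) * fund_weight X a b) H - lam b)"
    using H by (auto simp: configs_def fin_conf_def)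
  also have "\<dots> \<longleftrightarrow> fin_conf X (\<lambda>z. of_nat (m z)) \<and> (\<forall>z. m z \<noteq> 0 \<longrightarrow> z \<in> H) \<and>
     (\<forall>z\<in>H. quad_vec X (\<lambda>z. of_nat (m z)) z \<le> src H \<nu> z) \<and>
     (\<forall>b\<in>nodes X. wtot (stp X b) (\<lambda>k. of_nat (m (b, k))) =
        of_nat (stp X b) * (sum' (\<lambda>(a, i). of_nat (i * \<nu> (a, i)) * fund_weight X a b) H - lam b))"
  proof (intro conj_cong refl ball_cong)
    assume m: "fin_conf X (\<lambda>z. of_nat (m z))" and mH: "\<forall>z. m z \<noteq> 0 \<longrightarrow> z \<in> H"
    show "(0 \<le> pp X H \<nu> (\<lambda>z. of_nat (m z)) z) = (quad_vec X (\<lambda>z. of_nat (m z)) z \<le> src H \<nu> z)" for z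
      by (subst pp_eq[OF m H]) (use mH in auto)
    from fin_conf_bound[OF m] obtain K where K: "\<And>a k. k > K \<Longrightarrow> m (a, k) = 0" by auto
    fix b assume b: "b \<in> nodes X"
    define g where "g = (\<lambda>(a, i). of_nat (i * m (a, i)) * simple_root a b)"
    have gb: "(a, k) \<in> H \<and> k \<le> K" if "g (a, k) \<noteq> 0" for a k
    proof -
      have "m (a, k) \<noteq> 0" using that by (auto simp: g_def)
      thus ?thesis using K[of k a] mH by (meson not_le)
    qed
    have "sum' g H = (\<Sum>a\<in>nodes X. \<Sum>k=1..K. g (a, k))"
      by (rule sum.G_sites(1)[OF H, of _ K]) (use gb in blast)
    also have "\<dots> = (\<Sum>a\<in>nodes X. if a = b then (\<Sum>k=1..K. of_nat (k * m (b, k))) else 0)"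
      by (intro sum.cong refl) (auto simp: g_def simple_root_def)
    also have "\<dots> = (\<Sum>k=1..K. of_nat (k * m (b, k)))" using b by simp
    finally have 1: "sum' g H = (\<Sum>k=1..K. of_nat (k * m (b, k)))" .
    have "wtot (stp X b) (\<lambda>k. of_nat (m (b, k))) = (\<Sum>k=1..K. of_nat (stp X b * k) * of_nat (m (b, k)))"
      unfolding wtot_def by (rule sum.G_atLeast_1) (use K in auto)
    also have "\<dots> = of_nat (stp X b) * sum' g H"
      unfolding 1 by (simp add: sum_distrib_left mult_ac)
    finally have 2: "wtot (stp X b) (\<lambda>k. of_nat (m (b, k))) = of_nat (stp X b) * sum' g H" .
    show "(sum' (\<lambda>(a, i). of_nat (i * m (a, i)) * simple_root a b) H =
        sum' (\<lambda>(a, i). of_nat (i * \<nu> (a, i)) * fund_weight X a b) H - lam b) =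
      (wtot (stp X b) (\<lambda>k. of_nat (m (b, k))) =
        of_nat (stp X b) * (sum' (\<lambda>(a, i). of_nat (i * \<nu> (a, i)) * fund_weight X a b) H - lam b))"
      unfolding 2 g_def[symmetric] by (simp add: stp_def)
  qed
  finally show ?thesis .
qed

lemma weight_W_power:
  assumes X: "admissible_type X" and r: "r \<in> nodes X" and s: "s \<ge> 1" and b: "b \<in> nodes X"
  shows "of_nat (stp X b) * sum' (\<lambda>(a, i). of_nat (i * W_power r s L (a, i)) * fund_weight X a b) (all_index X) =
    of_nat (s * L) * gram_inv X b r"
proof -
  have "sum' (\<lambda>(a, i). of_nat (i * W_power r s L (a, i)) * fund_weight X a b) (all_index X) = 
     sum' (\<lambda>(a, i). of_nat (i * W_power r s L (a, i)) * fund_weight X a b) {(r, s)}"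
    using r s by (intro sum.mono_neutral_right') (auto simp: all_index_def W_power_def split: if_splits)
  also have "of_nat (stp X b) * \<dots> = of_nat (s * L) * gram_inv X b r"
    using b r by (simp add: W_power_def fund_weight_eq[OF X r] of_nat_tt_stp gram_inv_sym)
  finally show ?thesis .
qed

lemma weight_W_vec:
  assumes X: "admissible_type X" and H: "H \<subseteq> all_index X" "\<And>a. a \<in> nodes X \<Longrightarrow> \<eta> a \<noteq> 0 \<Longrightarrow> (a, 1) \<in> H"
    and b: "b \<in> nodes X"
  shows "of_nat (stp X b) * sum' (\<lambda>(a, i). of_nat (i * W_vec \<eta> (a, i)) * fund_weight X a b) H = ginv_vec X \<eta> b"
proof -
  define g where "g = (\<lambda>(a, i). of_nat (i * W_vec \<eta> (a, i)) * fund_weight X a b)"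
  have "sum' g H = (\<Sum>a\<in>nodes X. \<Sum>k=1..1. g (a, k))"
    by (rule sum.G_sites(1)[OF H(1)]) (use H(2) in \<open>auto simp: g_def W_vec_def split: if_splits\<close>)
  also have "of_nat (stp X b) * \<dots> = ginv_vec X \<eta> b"
    using b by (auto simp: g_def W_vec_def fund_weight_eq[OF X] of_nat_tt_stp gram_inv_sym ginv_vec_def
        sum_distrib_left intro!: sum.cong)
  finally show ?thesis by (simp add: g_def)
qed

section \<open>Positivity and finiteness\<close>

text \<open>Termwise the inequality \<open>2 x y \<le> x^2 + y^2\<close> for
  \<open>x = v a * w b\<close> and \<open>y = v b * w a\<close>, reversed by the sign of the
  off-diagonal entry. The defect is the sum over pairs of
  \<open>- g a b * w a * w b * (v a / w a - v b / w b)^2 / 2\<close>, the ground state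
  representation of the form.\<close>

lemma Stieltjes_form_ge:
  fixes g :: "'i \<Rightarrow> 'i \<Rightarrow> rat"
  assumes J: "finite J" and sym: "\<And>a b. g a b = g b a" and off: "\<And>a b. a \<noteq> b \<Longrightarrow> g a b \<le> 0"
    and w: "\<And>a. a \<in> J \<Longrightarrow> w a > 0"
  shows "(\<Sum>a\<in>J. (\<Sum>b\<in>J. g a b * w b) * (v a)\<^sup>2 / w a) \<le> (\<Sum>a\<in>J. \<Sum>b\<in>J. g a b * v a * v b)"
proof -
  define h where "h a b = g a b * w b * (v a)\<^sup>2 / w a" for a b
  have "(h a b + h b a) / 2 \<le> g a b * v a * v b" if "a \<in> J" "b \<in> J" for a b
  proof (cases "a = b")
    case True
    thus ?thesis using w[OF that(1)] by (simp add: h_def power2_eq_square)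
  next
    case False
    have "0 \<le> (v a * w b - v b * w a)\<^sup>2" by simp
    hence "2 * (v a * v b) * (w a * w b) \<le> (v a)\<^sup>2 * (w b)\<^sup>2 + (v b)\<^sup>2 * (w a)\<^sup>2"
      by (simp add: power2_eq_square algebra_simps)
    hence "2 * (v a * v b) \<le> w b * (v a)\<^sup>2 / w a + w a * (v b)\<^sup>2 / w b"
      using w[OF that(1)] w[OF that(2)] by (simp add: field_simps power2_eq_square)
    from mult_left_mono_neg[OF this off[OF False]] show ?thesis
      by (simp add: h_def sym[of b a] algebra_simps)
  qed
  hence "(\<Sum>a\<in>J. \<Sum>b\<in>J. (h a b + h b a) / 2) \<le> (\<Sum>a\<in>J. \<Sum>b\<in>J. g a b * v a * v b)"
    by (intro sum_mono)
  moreover have "(\<Sum>a\<in>J. \<Sum>b\<in>J. h b a) = (\<Sum>a\<in>J. \<Sum>b\<in>J. h a b)"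
    by (rule sum.swap)
  hence "(\<Sum>a\<in>J. \<Sum>b\<in>J. (h a b + h b a) / 2) = (\<Sum>a\<in>J. \<Sum>b\<in>J. h a b)"
    by (simp add: sum_divide_distrib[symmetric] sum.distrib)
  moreover have "(\<Sum>b\<in>J. g a b * w b) * (v a)\<^sup>2 / w a = (\<Sum>b\<in>J. h a b)" for a
    by (simp add: h_def sum_distrib_right sum_divide_distrib)
  ultimately show ?thesis by simp
qed

text \<open>Minimum principle for M-matrices: at a node \<open>c\<close> where \<open>v / w\<close>
  is least, a negative quotient \<open>x\<close> would give \<open>g v \<le> x (g w) < 0\<close> at
  \<open>c\<close>.\<close>

lemma Stieltjes_monotone:
  fixes g :: "'i \<Rightarrow> 'i \<Rightarrow> rat"
  assumes J: "finite J" and off: "\<And>a b. a \<noteq> b \<Longrightarrow> g a b \<le> 0"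
    and w: "\<And>a. a \<in> J \<Longrightarrow> w a > 0" and gw: "\<And>a. a \<in> J \<Longrightarrow> (\<Sum>b\<in>J. g a b * w b) > 0"
    and gv: "\<And>a. a \<in> J \<Longrightarrow> (\<Sum>b\<in>J. g a b * v b) \<ge> 0" and a: "a \<in> J"
  shows "v a \<ge> 0"
proof -
  define c where "c = arg_min_on (\<lambda>b. v b / w b) J"
  have c: "c \<in> J" and cmin: "\<And>b. b \<in> J \<Longrightarrow> v c / w c \<le> v b / w b"
    using J a arg_min_if_finite[of J "\<lambda>b. v b / w b"] by (auto simp: c_def not_less)
  define x where "x = v c / w c"
  have "x \<ge> 0"
  proof (rule ccontr)
    assume x: "\<not> x \<ge> 0"
    have "(\<Sum>b\<in>J. g c b * v b) \<le> (\<Sum>b\<in>J. g c b * (x * w b))"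
    proof (rule sum_mono)
      fix b assume b: "b \<in> J"
      show "g c b * v b \<le> g c b * (x * w b)"
      proof (cases "b = c")
        case True
        thus ?thesis using w[OF c] by (simp add: x_def)
      next
        case False
        have "x * w b \<le> v b" using cmin[OF b] w[OF b] by (simp add: x_def field_simps)
        thus ?thesis using off[of c b] False by (intro mult_left_mono_neg) auto
      qed
    qed
    also have "\<dots> = x * (\<Sum>b\<in>J. g c b * w b)"
      by (simp add: sum_distrib_left mult_ac)
    also have "\<dots> < 0" using x gw[OF c] by (intro mult_neg_pos) auto
    finally show False using gv[OF c] by simp
  qed
  hence "0 \<le> v a / w a" using cmin[OF a] by (simp add: x_def)
  thus ?thesis using w[OF a] by (simp add: zero_le_divide_iff)
qed

text \<open>Twice the pairing of \<open>\<Lambda>_a\<close> with the Weyl vector: a positive vector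
  which \<open>gram\<close> maps to the all-ones vector.\<close>

definition ground :: "cartan_type \<Rightarrow> nat \<Rightarrow> rat" where
  "ground X a = (\<Sum>b\<in>nodes X. gram_inv X a b)"

lemma ground_pos: "a \<in> nodes X \<Longrightarrow> ground X a > 0"
  unfolding ground_def by (intro sum_pos) (auto intro: gram_inv_pos)

lemma gram_ground:
  assumes "admissible_type X" "a \<in> nodes X"
  shows "(\<Sum>b\<in>nodes X. gram X a b * ground X b) = 1"
  using gram_gram_inv_vec[OF assms, of "\<lambda>_. 1"] by (simp add: ground_def)

lemma gram_form_ge:
  assumes X: "admissible_type X"
  shows "(\<Sum>a\<in>nodes X. (v a)\<^sup>2 / ground X a) \<le> (\<Sum>a\<in>nodes X. \<Sum>b\<in>nodes X. gram X a b * v a * v b)"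
proof -
  have "(\<Sum>a\<in>nodes X. (v a)\<^sup>2 / ground X a) = 
     (\<Sum>a\<in>nodes X. (\<Sum>b\<in>nodes X. gram X a b * ground X b) * (v a)\<^sup>2 / ground X a)"
    using gram_ground[OF X] by simp
  also have "\<dots> \<le> (\<Sum>a\<in>nodes X. \<Sum>b\<in>nodes X. gram X a b * v a * v b)"
    by (rule Stieltjes_form_ge) (auto simp: gram_sym[of X] gram_offdiag ground_pos)
  finally show ?thesis .
qed

text \<open>
  This makes the last column of the reflected lower configuration non-negative; no vacancy number
  controls it directly.
\<close>

lemma tot_nonpos:
  assumes X: "admissible_type X" and d: "fin_conf X d"
    and v2: "\<And>a. a \<in> nodes X \<Longrightarrow> vacancy X d a 2 \<ge> 0"
    and v1: "\<And>a. a \<in> short_nodes X \<Longrightarrow> vacancy X d a 1 \<ge> 0"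
    and a: "a \<in> nodes X"
  shows "tot (\<lambda>k. d (a, k)) \<le> 0"
proof -
  from fin_conf_bound[OF d] obtain K where K: "\<And>a k. k > K \<Longrightarrow> d (a, k) = 0" by blast
  have tot: "tot (\<lambda>k. d (b, k)) = (\<Sum>k=1..K. d (b, k))" for b
    unfolding tot_def by (rule sum.G_atLeast_1) (use K in auto)
  have m1: "mom (stp X b) (\<lambda>k. d (b, k)) 1 = tot (\<lambda>k. d (b, k))" for b
    unfolding tot by (subst mom_eq_sum[of K]) (use K stp_pos[of X b] in \<open>auto simp: min_def Suc_le_eq intro!: sum.cong\<close>)
  have m2: "mom (stp X b) (\<lambda>k. d (b, k)) 2 = 2 * tot (\<lambda>k. d (b, k))" if "\<not> short_root X b" for b
    unfolding tot using that
    by (subst mom_eq_sum[of K]) (use K in \<open>auto simp: stp_def sum_distrib_left min_absorb1 intro!: sum.cong\<close>)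
  \<comment> \<open>Every row has a column at position 2, so all vacancy numbers there are
    controlled and the minimum principle applies to the whole diagram. It settles the long rows,
    whose moment at 2 is twice the total.\<close>
  have "- mom (stp X b) (\<lambda>k. d (b, k)) 2 \<ge> 0" if "b \<in> nodes X" for b
  proof (rule Stieltjes_monotone[where J = "nodes X" and g = "gram X" and w = "ground X" and a = b
        and v = "\<lambda>b. - mom (stp X b) (\<lambda>k. d (b, k)) 2"])
    fix a assume a: "a \<in> nodes X"
    show "0 < ground X a" "0 < (\<Sum>b\<in>nodes X. gram X a b * ground X b)"
      using a by (auto simp: ground_pos gram_ground[OF X])
    show "0 \<le> (\<Sum>b\<in>nodes X. gram X a b * (- mom (stp X b) (\<lambda>k. d (b, k)) 2))"
      using v2[OF a] by (simp add: vacancy_def sum_negf)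
  qed (use that in \<open>auto simp: gram_offdiag\<close>)
  hence long: "tot (\<lambda>k. d (b, k)) \<le> 0" if "b \<in> nodes X - short_nodes X" for b
    using that m2[of b] by (fastforce simp: short_nodes_iff)
  have split: "(\<Sum>b\<in>nodes X. f b) = (\<Sum>b\<in>short_nodes X. f b) + (\<Sum>b\<in>nodes X - short_nodes X. f b)" for f :: "nat \<Rightarrow> rat"
    using sum.subset_diff[OF short_nodes_subset[of X] finite_nodes, of f] by simp
  \<comment> \<open>At position 1 only the short rows are controlled. The long totals already have
    the right sign and enter through off-diagonal entries, so dropping them keeps the inequality on
    the short block.\<close>
  have "- tot (\<lambda>k. d (b, k)) \<ge> 0" if "b \<in> short_nodes X" for b
  proof (rule Stieltjes_monotone[where J = "short_nodes X" and g = "gram X" and w = "ground X" and a = b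
        and v = "\<lambda>b. - tot (\<lambda>k. d (b, k))"])
    fix a assume a: "a \<in> short_nodes X"
    hence an: "a \<in> nodes X" using short_nodes_subset by auto
    show "0 < ground X a" using an by (rule ground_pos)
    have "(\<Sum>b\<in>nodes X - short_nodes X. gram X a b * ground X b) \<le> 0"
      using a ground_pos[of _ X] by (intro sum_nonpos mult_nonpos_nonneg gram_offdiag) (auto intro: less_imp_le)
    thus "0 < (\<Sum>b\<in>short_nodes X. gram X a b * ground X b)"
      using gram_ground[OF X an] unfolding split by linarith
    have "(\<Sum>b\<in>nodes X - short_nodes X. gram X a b * (- tot (\<lambda>k. d (b, k)))) \<le> 0"
      using a long by (intro sum_nonpos mult_nonpos_nonneg gram_offdiag) auto
    moreover have "(\<Sum>b\<in>nodes X. gram X a b * (- tot (\<lambda>k. d (b, k)))) \<ge> 0"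
      using v1[OF a] unfolding vacancy_def m1 by (simp add: sum_negf)
    ultimately show "0 \<le> (\<Sum>b\<in>short_nodes X. gram X a b * (- tot (\<lambda>k. d (b, k))))"
      unfolding split by linarith
  qed (use that in \<open>auto simp: gram_offdiag\<close>)
  with long a show ?thesis by (cases "a \<in> short_nodes X") auto
qed

section \<open>The energy as a sum over unit intervals\<close>

definition tail :: "cartan_type \<Rightarrow> (nat \<times> nat \<Rightarrow> rat) \<Rightarrow> nat \<Rightarrow> nat \<Rightarrow> nat \<Rightarrow> rat" where
  "tail X d K i a = (\<Sum>k=1..K. if i \<le> stp X a * k then d (a, k) else 0)"

text \<open>\<open>tail\<close> is the slope of \<open>mom\<close> between \<open>i - 1\<close> and
  \<open>i\<close>. Writing \<open>min x y\<close> as the number of positive \<open>i\<close> not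
  exceeding either turns the energy into a sum of values of the form \<open>gram\<close>, one for
  each unit interval; \<open>2 * K\<close> intervals suffice because \<open>stp\<close> is at most
  2.\<close>

lemma energy_tail:
  assumes K: "\<And>a k. k > K \<Longrightarrow> d (a, k) = 0"
  shows "pair_sum X (quad_vec X d) d =
    (\<Sum>i=1..2 * K. \<Sum>a\<in>nodes X. \<Sum>b\<in>nodes X. gram X a b * tail X d K i a * tail X d K i b)"
proof -
  define ind where "ind i z = (if i \<le> stp X (fst z) * snd z then 1 else 0 :: rat)" for i and z :: "nat \<times> nat"
  define B where "B = nodes X \<times> {1..K}"
  have mn: "(of_nat (min (stp X (fst z) * snd z) (stp X (fst w) * snd w)) :: rat) = (\<Sum>i=1..2*K. ind i z * ind i w)"
    if "z \<in> B" "w \<in> B" for z w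
  proof -
    have le: "stp X (fst z) * snd z \<le> 2 * K" if "z \<in> B" for z
      using that by (intro mult_le_mono) (auto simp: stp_def B_def)
    have "(\<Sum>i=1..2*K. ind i z * ind i w) = 
       (\<Sum>i\<in>{1..2*K}. if i \<in> {1..min (stp X (fst z) * snd z) (stp X (fst w) * snd w)} then 1 else 0)"
      by (intro sum.cong refl) (auto simp: ind_def)
    also have "\<dots> = (\<Sum>i\<in>{1..2*K} \<inter> {1..min (stp X (fst z) * snd z) (stp X (fst w) * snd w)}. 1)"
      by (rule sum.inter_restrict[symmetric]) simp
    also have "{1..2*K} \<inter> {1..min (stp X (fst z) * snd z) (stp X (fst w) * snd w)} = 
        {1..min (stp X (fst z) * snd z) (stp X (fst w) * snd w)}"
      using le[OF that(1)] by auto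
    finally show ?thesis by simp
  qed
  have "pair_sum X (quad_vec X d) d = (\<Sum>z\<in>B. \<Sum>w\<in>B. 
     gram X (fst z) (fst w) * of_nat (min (stp X (fst z) * snd z) (stp X (fst w) * snd w)) * d w * d z)"
    using K by (simp add: pair_sum_eq_sum[of K] quad_vec_eq_sum[of K] B_def sum_distrib_right)
  also have "\<dots> = (\<Sum>z\<in>B. \<Sum>w\<in>B. \<Sum>i=1..2*K. gram X (fst z) (fst w) * (ind i z * d z) * (ind i w * d w))"
    by (intro sum.cong refl, subst mn) (simp_all add: sum_distrib_left sum_distrib_right mult_ac)
  also have "\<dots> = (\<Sum>i=1..2*K. \<Sum>z\<in>B. \<Sum>w\<in>B. gram X (fst z) (fst w) * (ind i z * d z) * (ind i w * d w))"
    by (subst sum.swap[of _ "{1..2*K}"], subst sum.swap[of _ "{1..2*K}"]) simp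
  also have "\<dots> = (\<Sum>i=1..2 * K. \<Sum>a\<in>nodes X. \<Sum>b\<in>nodes X. gram X a b * tail X d K i a * tail X d K i b)"
  proof (intro sum.cong refl)
    fix i
    have t: "tail X d K i a = (\<Sum>k=1..K. ind i (a, k) * d (a, k))" for a
      unfolding tail_def by (intro sum.cong refl) (simp add: ind_def)
    have "(\<Sum>z\<in>B. \<Sum>w\<in>B. gram X (fst z) (fst w) * (ind i z * d z) * (ind i w * d w)) =
      (\<Sum>a\<in>nodes X. \<Sum>j=1..K. \<Sum>b\<in>nodes X. \<Sum>k=1..K. gram X a b * (ind i (a, j) * d (a, j)) * (ind i (b, k) * d (b, k)))"
      by (simp add: B_def sum.cartesian_product')
    also have "\<dots> = (\<Sum>a\<in>nodes X. \<Sum>b\<in>nodes X. gram X a b * tail X d K i a * tail X d K i b)"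
      unfolding t
      by (rule sum.cong[OF refl], subst sum.swap, rule sum.cong[OF refl])
         (simp only: mult.assoc sum_product, simp only: sum_distrib_left)
    finally show "(\<Sum>z\<in>B. \<Sum>w\<in>B. gram X (fst z) (fst w) * (ind i z * d z) * (ind i w * d w)) =
      (\<Sum>a\<in>nodes X. \<Sum>b\<in>nodes X. gram X a b * tail X d K i a * tail X d K i b)" .
  qed
  finally show ?thesis .
qed

lemma energy_nonneg:
  assumes X: "admissible_type X" and d: "fin_conf X d"
  shows "pair_sum X (quad_vec X d) d \<ge> 0"
proof -
  from fin_conf_bound[OF d] obtain K where K: "\<And>a k. k > K \<Longrightarrow> d (a, k) = 0" by blast
  have et: "pair_sum X (quad_vec X d) d =
      (\<Sum>i=1..2 * K. \<Sum>a\<in>nodes X. \<Sum>b\<in>nodes X. gram X a b * tail X d K i a * tail X d K i b)"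
    by (rule energy_tail) (rule K)
  show ?thesis unfolding et
    by (intro sum_nonneg order.trans[OF _ gram_form_ge[OF X]])
       (auto intro!: divide_nonneg_pos ground_pos)
qed

text \<open>The energy bounds the sum of the squared slopes, which are integers, so each slope is at
  most \<open>C\<close> in absolute value and each column, a difference of two slopes, at most
  \<open>2 * C\<close>. Beyond \<open>B0\<close> the slopes are nonnegative and decreasing: a
  nonzero one at \<open>i\<close> makes every interval from \<open>B0 + 1\<close> to
  \<open>i\<close> cost at least 1, hence \<open>i \<le> B0 + C\<close>.\<close>

lemma finite_energy_le:
  assumes X: "admissible_type X"
  shows "finite {d. fin_conf X d \<and> (\<forall>z. d z \<in> \<int>) \<and> (\<forall>a\<in>nodes X. \<forall>k. B0 < stp X a * k \<longrightarrow> d (a, k) \<ge> 0) \<and>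
     pair_sum X (quad_vec X d) d \<le> N}" (is "finite ?S")
proof -
  define W where "W = (\<Sum>a\<in>nodes X. ground X a)"
  have W: "ground X a \<le> W" if "a \<in> nodes X" for a
    unfolding W_def using that by (intro member_le_sum) (auto intro: less_imp_le ground_pos)
  \<comment> \<open>By \<open>gram_form_ge\<close> each unit interval costs at least its squared
    slopes divided by \<open>ground\<close>, hence at least their sum divided by
    \<open>W\<close>.\<close>
  define C where "C = nat \<lceil>N * W\<rceil>"
  define Box where "Box = nodes X \<times> {1..B0 + C}"
  define V where "V = (of_int ` {- 2 * int C..2 * int C} :: rat set)"
  have "?S \<subseteq> {d. \<forall>z. (z \<in> Box \<longrightarrow> d z \<in> V) \<and> (z \<notin> Box \<longrightarrow> d z = 0)}"
  proof (clarify)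
    fix d a k
    assume d: "fin_conf X d" and int: "\<forall>z. d z \<in> \<int>"
      and pos: "\<forall>a\<in>nodes X. \<forall>k. B0 < stp X a * k \<longrightarrow> d (a, k) \<ge> 0"
      and le: "pair_sum X (quad_vec X d) d \<le> N"
    from fin_conf_bound[OF d] obtain K where K: "\<And>a k. k > K \<Longrightarrow> d (a, k) = 0" by blast
    have et: "pair_sum X (quad_vec X d) d =
      (\<Sum>i=1..2 * K. \<Sum>a\<in>nodes X. \<Sum>b\<in>nodes X. gram X a b * tail X d K i a * tail X d K i b)"
      by (rule energy_tail) (rule K)
    define M where "M = tail X d K"
    have Mint: "M i a \<in> \<int>" for i a
      unfolding M_def tail_def using int by (intro Ints_sum) auto
    have M0: "M i a = 0" if "i > 2 * K" for i a
    proof -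
      have "stp X a * k \<le> 2 * K" if "k \<in> {1..K}" for k
        using that by (intro mult_le_mono) (auto simp: stp_def)
      thus ?thesis using that unfolding M_def tail_def by (intro sum.neutral) force
    qed
    have sq: "(\<Sum>i=1..2*K. \<Sum>a\<in>nodes X. (M i a)\<^sup>2) \<le> of_nat C"
    proof (cases "nodes X = {}")
      case False
      hence W0: "W > 0" unfolding W_def by (intro sum_pos) (auto intro: ground_pos)
      have "(\<Sum>i=1..2*K. \<Sum>a\<in>nodes X. (M i a)\<^sup>2) / W = (\<Sum>i=1..2*K. \<Sum>a\<in>nodes X. (M i a)\<^sup>2 / W)"
        by (simp add: sum_divide_distrib)
      also have "\<dots> \<le> (\<Sum>i=1..2*K. \<Sum>a\<in>nodes X. (M i a)\<^sup>2 / ground X a)"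
        using W ground_pos[of _ X] by (intro sum_mono divide_left_mono mult_pos_pos W0) auto
      also have "\<dots> \<le> pair_sum X (quad_vec X d) d"
        unfolding et M_def by (intro sum_mono gram_form_ge[OF X])
      finally have "(\<Sum>i=1..2*K. \<Sum>a\<in>nodes X. (M i a)\<^sup>2) / W \<le> N"
        using le by linarith
      hence "(\<Sum>i=1..2*K. \<Sum>a\<in>nodes X. (M i a)\<^sup>2) \<le> N * W"
        using W0 by (simp add: pos_divide_le_eq)
      thus ?thesis unfolding C_def using le_of_int_ceiling[of "N * W"] of_nat_nat by linarith
    qed simp
    have single: "(\<Sum>i\<in>I. (M i a)\<^sup>2) \<le> of_nat C" if "a \<in> nodes X" "I \<subseteq> {1..2*K}" for a I
    proof -
      have "(\<Sum>i\<in>I. (M i a)\<^sup>2) \<le> (\<Sum>i\<in>I. \<Sum>a\<in>nodes X. (M i a)\<^sup>2)"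
        using that by (intro sum_mono member_le_sum) auto
      also have "\<dots> \<le> (\<Sum>i=1..2*K. \<Sum>a\<in>nodes X. (M i a)\<^sup>2)"
        using that by (intro sum_mono2 sum_nonneg) auto
      finally show ?thesis using sq by linarith
    qed
    have Msq: "\<bar>x\<bar> \<le> x\<^sup>2" if x: "x \<in> \<int>" for x :: rat
    proof -
      from x obtain i where i: "x = of_int i" by (auto elim: Ints_cases)
      have "\<bar>i\<bar> \<le> i\<^sup>2"
      proof (cases "i = 0")
        case False
        hence "\<bar>i\<bar> * 1 \<le> \<bar>i\<bar> * \<bar>i\<bar>" by (intro mult_left_mono) auto
        thus ?thesis by (simp add: power2_eq_square)
      qed simp
      hence "(of_int \<bar>i\<bar> :: rat) \<le> of_int (i\<^sup>2)" by (simp only: of_int_le_iff)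
      thus ?thesis by (simp add: i)
    qed
    have Mle: "\<bar>M i a\<bar> \<le> of_nat C" if "a \<in> nodes X" "i \<ge> 1" for i a
    proof (cases "i \<le> 2 * K")
      case True
      thus ?thesis using single[of a "{i}"] Msq[OF Mint[of i a]] that by auto
    next
      case False
      thus ?thesis using M0[of i a] by simp
    qed
    have dM: "d (a, k) = M (stp X a * k) a - M (Suc (stp X a * k)) a" if k: "k \<ge> 1" for a k
    proof -
      have "M (stp X a * k) a - M (Suc (stp X a * k)) a = (\<Sum>k'=1..K. if k' = k then d (a, k) else 0)"
        unfolding M_def tail_def sum_subtractf[symmetric]
        using stp_pos[of X a] by (intro sum.cong refl) (auto simp: Suc_le_eq)
      also have "\<dots> = d (a, k)" using k K[of k a] by (auto simp: not_le)
      finally show ?thesis by simp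
    qed
    have Mmono: "M j a \<le> M i a" if "a \<in> nodes X" "B0 < i" "i \<le> j" for i j a
      unfolding M_def tail_def using that pos by (intro sum_mono) (auto simp: not_le)
    have Mpos: "0 \<le> M i a" if "a \<in> nodes X" "B0 < i" for i a
      using Mmono[OF that, of "max i (Suc (2 * K))"] M0[of "max i (Suc (2 * K))" a] by simp
    have Mz: "M i a = 0" if a: "a \<in> nodes X" and i: "B0 + C < i" for i a
    proof (rule ccontr)
      assume nz: "M i a \<noteq> 0"
      hence iK: "i \<le> 2 * K" using M0[of i a] by (meson not_le)
      from Mint[of i a] obtain z where z: "M i a = of_int z" by (auto elim: Ints_cases)
      have "M i a > 0" using nz Mpos[OF a, of i] i by simp
      hence "M i a \<ge> 1" by (simp add: z)
      hence "1 \<le> (M j a)\<^sup>2" if "j \<in> {Suc B0..i}" for j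
        using Mmono[OF a, of j i] that by (intro one_le_power) auto
      hence "(\<Sum>j\<in>{Suc B0..i}. 1) \<le> (\<Sum>j\<in>{Suc B0..i}. (M j a)\<^sup>2)" by (rule sum_mono)
      also have "\<dots> \<le> of_nat C" using iK by (intro single a) auto
      finally have "(of_nat (Suc i - Suc B0) :: rat) \<le> of_nat C" by simp
      hence "Suc i - Suc B0 \<le> C" by (simp only: of_nat_le_iff)
      thus False using i by linarith
    qed
    show "((a, k) \<in> Box \<longrightarrow> d (a, k) \<in> V) \<and> ((a, k) \<notin> Box \<longrightarrow> d (a, k) = 0)"
    proof (intro conjI impI)
      assume "(a, k) \<in> Box"
      hence a: "a \<in> nodes X" and k: "k \<ge> 1" by (auto simp: Box_def)
      have "stp X a * k \<ge> 1" using k stp_pos[of X a] by (simp add: Suc_le_eq)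
      hence "\<bar>d (a, k)\<bar> \<le> of_nat (2 * C)"
        using Mle[OF a, of "stp X a * k"] Mle[OF a, of "Suc (stp X a * k)"] dM[OF k, of a] by simp
      moreover from int obtain z where z: "d (a, k) = of_int z" by (metis Ints_cases)
      ultimately have "(of_int \<bar>z\<bar> :: rat) \<le> of_int (int (2 * C))" by simp
      hence "\<bar>z\<bar> \<le> int (2 * C)" by (simp only: of_int_le_iff)
      thus "d (a, k) \<in> V" unfolding V_def z by (intro imageI) auto
    next
      assume nB: "(a, k) \<notin> Box"
      show "d (a, k) = 0"
      proof (cases "a \<in> nodes X \<and> k \<ge> 1")
        case True
        hence "B0 + C < k" using nB by (auto simp: Box_def)
        also have "k \<le> stp X a * k" by (simp add: stp_def)
        finally show ?thesis using True Mz[of a] dM[of k a] by simp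
      next
        case False
        thus ?thesis using fin_conf_0[OF d] by (cases k) auto
      qed
    qed
  qed
  moreover have "finite {d. \<forall>z. (z \<in> Box \<longrightarrow> d z \<in> V) \<and> (z \<notin> Box \<longrightarrow> d z = 0)}"
    by (rule finite_set_of_finite_funs) (auto simp: Box_def V_def)
  ultimately show ?thesis by (rule finite_subset)
qed

section \<open>Integrality and additivity of the energy\<close>

lemma half_quadratic_Ints:
  fixes B :: "'i \<Rightarrow> 'i \<Rightarrow> rat"
  assumes "finite S" and sym: "\<And>z w. B z w = B w z" and "\<And>z w. B z w \<in> \<int>" and "\<And>z. B z z / 2 \<in> \<int>"
    and "\<And>z. m z \<in> \<int>"
  shows "1 / 2 * (\<Sum>z\<in>S. \<Sum>w\<in>S. B z w * m w * m z) \<in> \<int>"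
  using assms(1)
proof induction
  case (insert x S)
  have "(\<Sum>w\<in>S. B w x * m x * m w) = (\<Sum>w\<in>S. B x w * m w * m x)"
    by (intro sum.cong refl) (simp add: sym[of _ x])
  hence "1 / 2 * (\<Sum>z\<in>insert x S. \<Sum>w\<in>insert x S. B z w * m w * m z) =
     B x x / 2 * m x * m x + (\<Sum>w\<in>S. B x w * m w * m x) + 1 / 2 * (\<Sum>z\<in>S. \<Sum>w\<in>S. B z w * m w * m z)"
    using insert by (simp add: sum.distrib algebra_simps)
  also have "\<dots> \<in> \<int>"
  proof (intro Ints_add insert.IH)
    show "B x x / 2 * m x * m x \<in> \<int>" using assms(4,5) by (intro Ints_mult)
    show "(\<Sum>w\<in>S. B x w * m w * m x) \<in> \<int>" using assms(3,5) by (intro Ints_sum Ints_mult)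
  qed
  finally show ?case .
qed simp

lemma energy_Ints:
  assumes m: "fin_conf X m" and int: "\<And>z. m z \<in> \<int>"
  shows "1 / 2 * pair_sum X (quad_vec X m) m \<in> \<int>"
proof -
  from fin_conf_bound[OF m] obtain K where K: "\<And>a k. k > K \<Longrightarrow> m (a, k) = 0" by blast
  define B where "B z w = gram X (fst z) (fst w) * of_nat (min (stp X (fst z) * snd z) (stp X (fst w) * snd w))" for z w
  have "pair_sum X (quad_vec X m) m = (\<Sum>z\<in>nodes X \<times> {1..K}. \<Sum>w\<in>nodes X \<times> {1..K}. B z w * m w * m z)"
    using K by (simp add: pair_sum_eq_sum[of K] quad_vec_eq_sum[of K] B_def sum_distrib_right)
  moreover have "1 / 2 * (\<Sum>z\<in>nodes X \<times> {1..K}. \<Sum>w\<in>nodes X \<times> {1..K}. B z w * m w * m z) \<in> \<int>"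
  proof (rule half_quadratic_Ints)
    show "B z w = B w z" for z w by (simp add: B_def gram_sym[of X "fst z"] min.commute)
    show "B z w \<in> \<int>" for z w unfolding B_def by (rule gram_min_Ints)
    show "B z z / 2 \<in> \<int>" for z unfolding B_def gram_diag_min by simp
  qed (use int in auto)
  ultimately show ?thesis by simp
qed

lemma quad_vec_Ints:
  assumes m: "fin_conf X m" and int: "\<And>z. m z \<in> \<int>"
  shows "quad_vec X m z \<in> \<int>"
proof -
  from fin_conf_bound[OF m] obtain K where K: "\<And>a k. k > K \<Longrightarrow> m (a, k) = 0" by blast
  show ?thesis
    by (subst quad_vec_eq_sum[of K]) (use K int in \<open>auto intro!: Ints_sum Ints_mult gram_min_Ints\<close>)
qed

lemma fin_conf_add:
  assumes m: "fin_conf X m" and d: "fin_conf X d"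
  shows "fin_conf X (\<lambda>z. m z + d z)"
proof -
  from fin_conf_bound[OF m] obtain K1 where K1: "\<And>a k. k > K1 \<Longrightarrow> m (a, k) = 0" by blast
  from fin_conf_bound[OF d] obtain K2 where K2: "\<And>a k. k > K2 \<Longrightarrow> d (a, k) = 0" by blast
  show ?thesis
    by (rule fin_conf_boundI[of "max K1 K2"]) (use K1 K2 fin_conf_0[OF m] fin_conf_0[OF d] in auto)
qed

lemma quad_vec_add:
  assumes m: "fin_conf X m" and d: "fin_conf X d"
  shows "quad_vec X (\<lambda>z. m z + d z) z = quad_vec X m z + quad_vec X d z"
proof -
  from fin_conf_bound[OF m] obtain K1 where K1: "\<And>a k. k > K1 \<Longrightarrow> m (a, k) = 0" by blast
  from fin_conf_bound[OF d] obtain K2 where K2: "\<And>a k. k > K2 \<Longrightarrow> d (a, k) = 0" by blast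
  show ?thesis using K1 K2
    by (simp add: quad_vec_eq_sum[of "max K1 K2"] distrib_left sum.distrib)
qed

lemma wtot_add:
  assumes m: "fin_conf X m" and d: "fin_conf X d"
  shows "wtot c (\<lambda>k. m (b, k) + d (b, k)) = wtot c (\<lambda>k. m (b, k)) + wtot c (\<lambda>k. d (b, k))"
proof -
  from fin_conf_bound[OF m] obtain K1 where K1: "\<And>a k. k > K1 \<Longrightarrow> m (a, k) = 0" by blast
  from fin_conf_bound[OF d] obtain K2 where K2: "\<And>a k. k > K2 \<Longrightarrow> d (a, k) = 0" by blast
  have w: "wtot c f = (\<Sum>k=1..max K1 K2. of_nat (c * k) * f k)" if "\<And>k. k > max K1 K2 \<Longrightarrow> f k = 0" for f
    unfolding wtot_def by (rule sum.G_atLeast_1) (use that in auto)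
  show ?thesis using K1 K2 by (subst (1 2 3) w) (auto simp: distrib_left sum.distrib)
qed

text \<open>Completion of the square: by symmetry of the form the two mixed terms are equal, so
  subtracting the linear form with coefficients \<open>quad_vec X m\<close> removes everything
  linear in \<open>d\<close>.\<close>

lemma energy_add:
  assumes m: "fin_conf X m" and d: "fin_conf X d"
  shows "1 / 2 * pair_sum X (quad_vec X (\<lambda>z. m z + d z)) (\<lambda>z. m z + d z) - pair_sum X (quad_vec X m) (\<lambda>z. m z + d z) =
     1 / 2 * pair_sum X (quad_vec X d) d - 1 / 2 * pair_sum X (quad_vec X m) m"
proof -
  from fin_conf_bound[OF m] obtain K1 where K1: "\<And>a k. k > K1 \<Longrightarrow> m (a, k) = 0" by blast
  from fin_conf_bound[OF d] obtain K2 where K2: "\<And>a k. k > K2 \<Longrightarrow> d (a, k) = 0" by blast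
  define K where "K = max K1 K2"
  have Km: "m (a, k) = 0" if "k > K" for a k using K1 that by (simp add: K_def)
  have Kd: "d (a, k) = 0" if "k > K" for a k using K2 that by (simp add: K_def)
  define B where "B = nodes X \<times> {1..K}"
  have ps: "pair_sum X f (\<lambda>z. m z + d z) = (\<Sum>z\<in>B. f z * m z) + (\<Sum>z\<in>B. f z * d z)"
    "pair_sum X f m = (\<Sum>z\<in>B. f z * m z)" "pair_sum X f d = (\<Sum>z\<in>B. f z * d z)" for f
    using Km Kd by (simp_all add: pair_sum_eq_sum[of K] B_def distrib_left sum.distrib)
  have "(\<Sum>z\<in>B. quad_vec X m z * d z) = (\<Sum>z\<in>B. \<Sum>w\<in>B. gram X (fst z) (fst w) * of_nat (min (stp X (fst z) * snd z) (stp X (fst w) * snd w)) * m w * d z)"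
    using Km by (simp add: quad_vec_eq_sum[of K] B_def sum_distrib_right)
  also have "\<dots> = (\<Sum>w\<in>B. \<Sum>z\<in>B. gram X (fst z) (fst w) * of_nat (min (stp X (fst z) * snd z) (stp X (fst w) * snd w)) * m w * d z)"
    by (rule sum.swap)
  also have "\<dots> = (\<Sum>z\<in>B. quad_vec X d z * m z)"
    using Kd by (simp add: quad_vec_eq_sum[of K] B_def sum_distrib_right)
       (intro sum.cong refl, simp add: gram_sym min.commute mult_ac)
  finally have s: "(\<Sum>z\<in>B. quad_vec X m z * d z) = (\<Sum>z\<in>B. quad_vec X d z * m z)" .
  show ?thesis unfolding ps quad_vec_add[OF m d] using s
    by (simp add: distrib_right sum.distrib algebra_simps)
qed

section \<open>Fluctuations around the reference point\<close>

definition central :: "cartan_type \<Rightarrow> nat \<Rightarrow> nat \<times> nat \<Rightarrow> bool" where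
  "central X l z \<longleftrightarrow> 2 * l \<le> stp X (fst z) * snd z \<and> stp X (fst z) * snd z \<le> 2 * l + 2"

text \<open>Central columns carry no sign condition: the reference point grows there with
  \<open>L\<close>, so any fixed value becomes admissible eventually. This makes the index set of
  the limit the same for all \<open>L\<close>.\<close>

definition fluctuations :: "cartan_type \<Rightarrow> nat \<Rightarrow> weight \<Rightarrow> (nat \<times> nat \<Rightarrow> rat) set" where
  "fluctuations X l lam = {d. fin_conf X d \<and> (\<forall>z. d z \<in> \<int>) \<and>
     (\<forall>z\<in>all_index X. \<not> central X l z \<longrightarrow> d z \<ge> 0) \<and> (\<forall>z\<in>all_index X. quad_vec X d z \<le> 0) \<and>
     (\<forall>b\<in>nodes X. wtot (stp X b) (\<lambda>k. d (b, k)) = - of_nat (stp X b) * lam b)}"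

text \<open>Cut off to the index set because \<open>m_zero\<close> can be nonzero at column 0, as
  for \<open>s = 1\<close>.\<close>

definition ref_conf :: "cartan_type \<Rightarrow> nat \<Rightarrow> nat \<Rightarrow> nat \<Rightarrow> nat \<times> nat \<Rightarrow> rat" where
  "ref_conf X r l L z = (if z \<in> all_index X then m_zero X r (2 * l + 1) L z else 0)"

definition slope :: "cartan_type \<Rightarrow> nat \<Rightarrow> nat \<Rightarrow> nat \<times> nat \<Rightarrow> rat" where
  "slope X r l = (\<lambda>(a, k). if stp X a * k = 2 * l + 1 then gap X r a else edge X r a)"

definition energy :: "cartan_type \<Rightarrow> (nat \<times> nat \<Rightarrow> rat) \<Rightarrow> rat" where
  "energy X d = 1 / 2 * pair_sum X (quad_vec X d) d"

lemma finite_configs: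
  assumes H: "H \<subseteq> all_index X" and \<nu>: "finite {z \<in> H. \<nu> z \<noteq> 0}"
  shows "finite (configs X H \<nu> lam)"
proof -
  define c where "c b = of_nat (stp X b) * (sum' (\<lambda>(a, i). of_nat (i * \<nu> (a, i)) * fund_weight X a b) H - lam b)" for b
  \<comment> \<open>One bound for two purposes: the weight condition gives
    \<open>k * m (b, k) \<le> C\<close>, which limits both the entries and the columns that can be
    occupied.\<close>
  define C where "C = (\<Sum>b\<in>nodes X. nat \<lceil>\<bar>c b\<bar>\<rceil>)"
  have "configs X H \<nu> lam \<subseteq> {m. \<forall>z. (z \<in> nodes X \<times> {1..C} \<longrightarrow> m z \<in> {..C}) \<and> (z \<notin> nodes X \<times> {1..C} \<longrightarrow> m z = 0)}"
  proof
    fix m assume "m \<in> configs X H \<nu> lam"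
    hence m: "fin_conf X (\<lambda>z. of_nat (m z))" 
      and "\<forall>b\<in>nodes X. wtot (stp X b) (\<lambda>k. of_nat (m (b, k))) = c b"
      unfolding configs_iff[OF H \<nu>] c_def by auto
    hence w: "wtot (stp X b) (\<lambda>k. of_nat (m (b, k))) = c b" if "b \<in> nodes X" for b
      using that by blast
    from fin_conf_bound[OF m] obtain K where K: "\<And>a k. k > K \<Longrightarrow> m (a, k) = 0" by auto
    have le: "k * m (b, k) \<le> C" if b: "b \<in> nodes X" for b k
    proof (cases "k \<in> {1..K}")
      case True
      have "(of_nat (k * m (b, k)) :: rat) \<le> of_nat (stp X b * k) * of_nat (m (b, k))"
        using stp_pos[of X b] by (simp add: stp_def)
      also have "\<dots> \<le> (\<Sum>k=1..K. of_nat (stp X b * k) * of_nat (m (b, k)))"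
        using True by (intro member_le_sum) auto
      also have "\<dots> = c b"
        unfolding w[OF b, symmetric] wtot_def by (rule sum.G_atLeast_1[symmetric]) (use K in auto)
      also have "\<dots> \<le> of_nat (nat \<lceil>\<bar>c b\<bar>\<rceil>)"
        by (metis abs_ge_self order.trans real_nat_ceiling_ge of_nat_ceiling)
      also have "\<dots> \<le> of_nat C"
        unfolding C_def of_nat_le_iff using b by (intro member_le_sum) auto
      finally show ?thesis by (simp only: of_nat_le_iff)
    next
      case False
      thus ?thesis using K[of k b] by (cases k) auto
    qed
    have "m z \<le> C" if zB: "z \<in> nodes X \<times> {1..C}" for z
    proof -
      obtain b k where z: "z = (b, k)" "b \<in> nodes X" "k \<ge> 1" using zB by auto
      have "1 * m z \<le> k * m z" using z by (intro mult_le_mono1)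
      thus ?thesis using le[OF z(2), of k] unfolding z(1) by linarith
    qed
    moreover have "m z = 0" if "z \<notin> nodes X \<times> {1..C}" for z
    proof (rule ccontr)
      assume nz: "m z \<noteq> 0"
      hence "z \<in> all_index X" using fin_conf_0(3)[OF m, of z] by auto
      then obtain b k where z: "z = (b, k)" "b \<in> nodes X" "k \<ge> 1" by (auto simp: all_index_def)
      have "k * 1 \<le> k * m z" using nz by (intro mult_le_mono2) simp
      hence "k \<le> C" using le[OF z(2), of k] unfolding z(1) by linarith
      thus False using z that by auto
    qed
    ultimately show "m \<in> {m. \<forall>z. (z \<in> nodes X \<times> {1..C} \<longrightarrow> m z \<in> {..C}) \<and> (z \<notin> nodes X \<times> {1..C} \<longrightarrow> m z = 0)}"
      by auto
  qed
  moreover have "finite {m. \<forall>z. (z \<in> nodes X \<times> {1..C} \<longrightarrow> m z \<in> {..C}) \<and> (z \<notin> nodes X \<times> {1..C} \<longrightarrow> m z = (0::nat))}"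
    by (rule finite_set_of_finite_funs) auto
  ultimately show ?thesis by (rule finite_subset)
qed

lemma finite_supp_W_power: "finite {z \<in> H. W_power r s L z \<noteq> 0}"
  by (rule finite_subset[of _ "{(r, s)}"]) (auto simp: W_power_def split: if_splits)

lemma finite_supp_W_vec: "H \<subseteq> all_index X \<Longrightarrow> finite {z \<in> H. W_vec \<eta> z \<noteq> 0}"
  by (rule finite_subset[of _ "nodes X \<times> {1}"]) (auto simp: W_vec_def all_index_def split: if_splits)

context
  fixes X :: cartan_type and r l :: nat
  assumes X: "admissible_type X" and r: "r \<in> short_nodes X"
begin

lemma r_node: "r \<in> nodes X" using r short_nodes_subset by auto

lemma ref_eq:
  assumes "a \<in> nodes X" "k \<ge> 1"
  shows "ref_conf X r l L (a, k) = (if central X l (a, k) then of_nat L * slope X r l (a, k) else 0)"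
proof -
  have "ref_conf X r l L (a, k) = of_nat L *
    (if stp X a * k + 1 = 2 * l + 1 \<or> stp X a * k = 2 * l + 1 + 1 then edge X r a
     else if stp X a * k = 2 * l + 1 then gap X r a else 0)"
    using assms m_zero_eq[OF r assms(1), of "2 * l + 1"] by (simp add: ref_conf_def all_index_def)
  thus ?thesis by (auto simp: slope_def central_def)
qed

lemma slope_pos:
  assumes "(a, k) \<in> all_index X"
  shows "slope X r l (a, k) > 0"
proof -
  have "a \<in> short_nodes X" if "stp X a * k = 2 * l + 1"
  proof -
    have "odd (stp X a * k)" using that by simp
    thus ?thesis using assms by (auto simp: short_nodes_iff all_index_def stp_def split: if_splits)
  qed
  thus ?thesis using assms edge_pos[OF X r] gap_pos[OF X r] by (auto simp: slope_def all_index_def)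
qed

lemma fin_conf_ref: "fin_conf X (ref_conf X r l L)"
proof (rule fin_conf_boundI[of "2 * l + 2"])
  show "ref_conf X r l L (a, k) = 0" if "k > 2 * l + 2" for a k
  proof (cases "a \<in> nodes X")
    case True
    have "k \<le> stp X a * k" by (simp add: stp_def)
    hence "\<not> central X l (a, k)" using that unfolding central_def fst_conv snd_conv by linarith
    thus ?thesis using True that by (simp add: ref_eq)
  qed (simp add: ref_conf_def all_index_def)
qed (simp add: ref_conf_def)

lemma ref_outside: "z \<notin> all_index X \<Longrightarrow> ref_conf X r l L z = 0"
  by (simp add: ref_conf_def)

lemma ref_Ints:
  assumes "L_modulus X dvd L"
  shows "ref_conf X r l L z \<in> \<int>"
proof (cases "z \<in> all_index X")
  case True
  then obtain a k where z: "z = (a, k)" "a \<in> nodes X" "k \<ge> 1" by (auto simp: all_index_def)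
  show ?thesis using edge_gap_Ints[OF X r z(2) assms] z by (simp add: ref_eq slope_def)
qed (simp add: ref_conf_def)

lemma ref_row:
  assumes a: "a \<in> nodes X"
  shows "\<And>j. j \<in> {1..<tt X a * l} \<Longrightarrow> ref_conf X r l L (a, tt X a * l - j) = 0"
    and "tt X a * l > 0 \<Longrightarrow> ref_conf X r l L (a, tt X a * l) = of_nat L * edge X r a"
    and "(if tt X a = 2 then x * ref_conf X r l L (a, Suc (tt X a * l)) else 0) = x * (of_nat L * gap X r a)"
    and "ref_conf X r l L (a, tt X a * l + tt X a) = of_nat L * edge X r a"
    and "\<And>j. j \<ge> 1 \<Longrightarrow> ref_conf X r l L (a, tt X a * l + tt X a + j) = 0"
proof -
  show "ref_conf X r l L (a, tt X a * l - j) = 0" if "j \<in> {1..<tt X a * l}" for j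
    using that a by (subst ref_eq) (auto simp: central_def tt_def stp_def split: if_splits)
  show "tt X a * l > 0 \<Longrightarrow> ref_conf X r l L (a, tt X a * l) = of_nat L * edge X r a"
    using a by (subst ref_eq) (auto simp: central_def slope_def tt_def stp_def Suc_le_eq split: if_splits)
  show "(if tt X a = 2 then x * ref_conf X r l L (a, Suc (tt X a * l)) else 0) = x * (of_nat L * gap X r a)"
    using a by (subst ref_eq) (auto simp: central_def slope_def tt_def stp_def gap_def split: if_splits)
  show "ref_conf X r l L (a, tt X a * l + tt X a) = of_nat L * edge X r a"
    using a by (subst ref_eq) (auto simp: central_def slope_def tt_def stp_def Suc_le_eq split: if_splits)
  show "ref_conf X r l L (a, tt X a * l + tt X a + j) = 0" if "j \<ge> 1" for j
    using that a by (subst ref_eq) (auto simp: central_def tt_def stp_def split: if_splits)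
qed

lemma mom_ref:
  assumes a: "a \<in> nodes X"
  shows "mom (stp X a) (\<lambda>k. ref_conf X r l L (a, k)) x =
    of_nat L * (of_nat (min x (2 * l) + min x (2 * l + 2)) * edge X r a + of_nat (min x (2 * l + 1)) * gap X r a)"
proof -
  interpret node_row "stp X a" "tt X a" l "tt X a * l" "\<lambda>k. ref_conf X r l L (a, k)"
    by (rule node_row_conf[OF fin_conf_ref])
  have 1: "(\<Sum>j=1..<tt X a * l. of_nat (min x (stp X a * (tt X a * l - j))) * ref_conf X r l L (a, tt X a * l - j)) = 0"
    using ref_row(1)[OF a] by (intro sum.neutral) auto
  \<comment> \<open>For \<open>l = 0\<close> this column does not exist, but then the factor
    \<open>min x 0\<close> vanishes too.\<close>
  have 2: "(if tt X a * l > 0 then of_nat (min x (2 * l)) * ref_conf X r l L (a, tt X a * l) else 0) = 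
      of_nat (min x (2 * l)) * (of_nat L * edge X r a)"
    using ref_row(2)[OF a] by (auto simp: Suc_le_eq)
  have 3: "sum' (\<lambda>j. of_nat (min x (2 * l + 2 + stp X a * j)) * ref_conf X r l L (a, tt X a * l + tt X a + j)) {1..} = 0"
    using ref_row(5)[OF a] by (subst sum.G_atLeast_1[of 0]) auto
  show ?thesis
    unfolding mom_split 1 2 3 ref_row(3)[OF a] ref_row(4)[OF a] by (simp add: algebra_simps)
qed

lemma wtot_ref:
  assumes a: "a \<in> nodes X"
  shows "wtot (stp X a) (\<lambda>k. ref_conf X r l L (a, k)) = of_nat ((2 * l + 1) * L) * gram_inv X a r"
proof -
  interpret node_row "stp X a" "tt X a" l "tt X a * l" "\<lambda>k. ref_conf X r l L (a, k)"
    by (rule node_row_conf[OF fin_conf_ref])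
  have 1: "(\<Sum>j=1..<tt X a * l. of_nat (stp X a * (tt X a * l - j)) * ref_conf X r l L (a, tt X a * l - j)) = 0"
    using ref_row(1)[OF a] by (intro sum.neutral) auto
  have 2: "(if tt X a * l > 0 then of_nat (2 * l) * ref_conf X r l L (a, tt X a * l) else 0) = 
      of_nat (2 * l) * (of_nat L * edge X r a)"
    using ref_row(2)[OF a] by (auto simp: Suc_le_eq)
  have 3: "sum' (\<lambda>j. of_nat (2 * l + 2 + stp X a * j) * ref_conf X r l L (a, tt X a * l + tt X a + j)) {1..} = 0"
    using ref_row(5)[OF a] by (subst sum.G_atLeast_1[of 0]) auto
  show ?thesis
    unfolding wtot_split 1 2 3 ref_row(3)[OF a] ref_row(4)[OF a] edge_def by (simp add: field_simps)
qed

text \<open>At \<open>x \<noteq> 2 l + 1\<close> one has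
  \<open>min x (2 l) + min x (2 l + 2) = 2 min x (2 l + 1)\<close>, so by
  \<open>2 * edge + gap = gram_inv\<close> the central columns act like a single one at position
  \<open>2 l + 1\<close>, and \<open>gram\<close> turns it into the source of node \<open>r\<close>.
  At \<open>x = 2 l + 1\<close> the moment falls short by \<open>L * edge\<close>; only short rows
  have a column there, and their rows of \<open>gram\<close> annihilate \<open>edge\<close>.\<close>

lemma quad_vec_ref:
  assumes z: "z \<in> all_index X"
  shows "quad_vec X (ref_conf X r l L) z = src (all_index X) (W_power r (2 * l + 1) L) z"
proof -
  from z obtain a i where zz: "z = (a, i)" "a \<in> nodes X" "i \<ge> 1" by (auto simp: all_index_def)
  define x where "x = stp X a * i"
  have qz: "quad_vec X (ref_conf X r l L) z = (\<Sum>b\<in>nodes X. gram X a b * mom (stp X b) (\<lambda>k. ref_conf X r l L (b, k)) x)"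
    by (simp add: zz(1) quad_vec_def x_def)
  have g: "(\<Sum>b\<in>nodes X. gram X a b * gram_inv X b r) = (if a = r then 1 else 0)"
    by (rule gram_inverse[OF X zz(2) r_node])
  have ar: "min i (2 * l + 1) = min x (2 * l + 1)" if "a = r"
    using that r by (simp add: x_def stp_def short_nodes_iff)
  show ?thesis
  proof (cases "x = 2 * l + 1")
    case False
    have "mom (stp X b) (\<lambda>k. ref_conf X r l L (b, k)) x = of_nat L * of_nat (min x (2 * l + 1)) * gram_inv X b r"
      if "b \<in> nodes X" for b
    proof -
      have "min x (2 * l) + min x (2 * l + 2) = 2 * min x (2 * l + 1)" using False by (auto simp: min_def)
      thus ?thesis unfolding mom_ref[OF that] edge_def by (simp only:) (simp add: field_simps)
    qed
    hence "quad_vec X (ref_conf X r l L) z = of_nat L * of_nat (min x (2 * l + 1)) * (\<Sum>b\<in>nodes X. gram X a b * gram_inv X b r)"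
      unfolding qz by (simp add: sum_distrib_left mult_ac)
    thus ?thesis using ar zz by (simp add: g src_W_power)
  next
    case True
    hence "odd (stp X a * i)" by (simp add: x_def)
    hence as: "a \<in> short_nodes X" using zz(2) by (auto simp: short_nodes_iff stp_def split: if_splits)
    have "mom (stp X b) (\<lambda>k. ref_conf X r l L (b, k)) x = 
        of_nat L * of_nat (2 * l + 1) * gram_inv X b r - of_nat L * edge X r b"
      if "b \<in> nodes X" for b
      unfolding mom_ref[OF that] True edge_def by (simp add: field_simps)
    hence "quad_vec X (ref_conf X r l L) z = (\<Sum>b\<in>nodes X. gram X a b * 
        (of_nat L * of_nat (2 * l + 1) * gram_inv X b r - of_nat L * edge X r b))"
      unfolding qz by (intro sum.cong refl) simp
    also have "\<dots> = of_nat L * of_nat (2 * l + 1) * (\<Sum>b\<in>nodes X. gram X a b * gram_inv X b r)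
       - of_nat L * (\<Sum>b\<in>nodes X. gram X a b * edge X r b)"
      unfolding right_diff_distrib sum_subtractf sum_distrib_left by (simp only: mult_ac)
    finally have "quad_vec X (ref_conf X r l L) z = of_nat L * of_nat (2 * l + 1) * (\<Sum>b\<in>nodes X. gram X a b * gram_inv X b r)
       - of_nat L * (\<Sum>b\<in>nodes X. gram X a b * edge X r b)" .
    moreover have "(\<Sum>b\<in>nodes X. gram X a b * edge X r b) = 0"
    proof -
      have "(\<Sum>b\<in>nodes X. gram X a b * gap X r b) = (\<Sum>b\<in>short_nodes X. gram X a b * D_inv X b r)"
        unfolding sum_short[symmetric] by (intro sum.cong) (auto simp: gap_def short_nodes_iff)
      also have "\<dots> = (if a = r then 1 else 0)"
        by (rule D_inv_inverse[OF X as r])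
      finally have "(\<Sum>b\<in>nodes X. gram X a b * (gram_inv X b r - gap X r b)) = 0"
        using g by (simp add: right_diff_distrib sum_subtractf)
      thus ?thesis unfolding edge_def times_divide_eq_right sum_divide_distrib[symmetric] by simp
    qed
    ultimately show ?thesis using ar True zz by (simp add: g src_W_power distrib_left)
  qed
qed

lemma pair_sum_ref:
  "pair_sum X (src (all_index X) (W_power r (2 * l + 1) L)) m = pair_sum X (quad_vec X (ref_conf X r l L)) m"
  unfolding pair_sum_def
  by (intro sum.cong sum.cong' refl) (auto simp: quad_vec_ref all_index_def)

lemma cc_ref:
  "cc X (all_index X) (W_power r (2 * l + 1) L) (m_zero X r (2 * l + 1) L) = - energy X (ref_conf X r l L)"
proof -
  have "cc X (all_index X) (W_power r (2 * l + 1) L) (m_zero X r (2 * l + 1) L) =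
      cc X (all_index X) (W_power r (2 * l + 1) L) (ref_conf X r l L)"
    unfolding cc_def by (intro arg_cong2[where f = "(-)"] arg_cong2[where f = "(*)"] sum.cong' refl) (auto simp: ref_conf_def)
  also have "\<dots> = - energy X (ref_conf X r l L)"
    by (subst cc_eq[OF fin_conf_ref order.refl _ finite_supp_W_power])
       (use ref_outside in \<open>auto simp: pair_sum_ref[simplified] energy_def\<close>)
  finally show ?thesis .
qed

lemma cc_shift:
  assumes d: "fin_conf X d" and m: "\<And>z. of_nat (m z) = ref_conf X r l L z + d z"
  shows "cc X (all_index X) (W_power r (2 * l + 1) L) (\<lambda>z. of_nat (m z)) = energy X d - energy X (ref_conf X r l L)"
proof -
  note fc = fin_conf_add[OF fin_conf_ref d]
  have supp: "z \<in> all_index X" if "ref_conf X r l L z + d z \<noteq> 0" for z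
    using that ref_outside fin_conf_0(3)[OF d] by fastforce
  have "cc X (all_index X) (W_power r (2 * l + 1) L) (\<lambda>z. ref_conf X r l L z + d z) =
    1 / 2 * pair_sum X (quad_vec X (\<lambda>z. ref_conf X r l L z + d z)) (\<lambda>z. ref_conf X r l L z + d z) -
    pair_sum X (src (all_index X) (W_power r (2 * l + 1) L)) (\<lambda>z. ref_conf X r l L z + d z)"
    by (rule cc_eq[OF fc order.refl _ finite_supp_W_power]) (rule supp)
  thus ?thesis unfolding m pair_sum_ref energy_add[OF fin_conf_ref d] energy_def .
qed

lemma pp_shift:
  assumes d: "fin_conf X d" and m: "\<And>z. of_nat (m z) = ref_conf X r l L z + d z" and z: "z \<in> all_index X"
  shows "pp X (all_index X) (W_power r (2 * l + 1) L) (\<lambda>z. of_nat (m z)) z = - quad_vec X d z"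
proof -
  note fc = fin_conf_add[OF fin_conf_ref d]
  have supp: "z \<in> all_index X" if "ref_conf X r l L z + d z \<noteq> 0" for z
    using that ref_outside fin_conf_0(3)[OF d] by fastforce
  have "pp X (all_index X) (W_power r (2 * l + 1) L) (\<lambda>z. ref_conf X r l L z + d z) z =
    src (all_index X) (W_power r (2 * l + 1) L) z - quad_vec X (\<lambda>z. ref_conf X r l L z + d z) z"
    by (rule pp_eq[OF fc order.refl]) (rule supp)
  thus ?thesis unfolding m quad_vec_add[OF fin_conf_ref d] quad_vec_ref[OF z] by simp
qed

lemma configs_fluctuations:
  assumes L: "L_modulus X dvd L"
  shows "bij_betw (\<lambda>d z. nat \<lfloor>ref_conf X r l L z + d z\<rfloor>)
     {d \<in> fluctuations X l lam. \<forall>z\<in>all_index X. ref_conf X r l L z + d z \<ge> 0}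
     (configs X (all_index X) (W_power r (2 * l + 1) L) lam)"
proof (rule bij_betw_byWitness[where f' = "\<lambda>m z. of_nat (m z) - ref_conf X r l L z"])
  let ?C = "{d \<in> fluctuations X l lam. \<forall>z\<in>all_index X. ref_conf X r l L z + d z \<ge> 0}"
  have rnd: "of_nat (nat \<lfloor>ref_conf X r l L z + d z\<rfloor>) = ref_conf X r l L z + d z" if "d \<in> ?C" for d z
  proof -
    have "d z \<in> \<int>" using that unfolding fluctuations_def by blast
    hence "ref_conf X r l L z + d z \<in> \<int>" by (intro Ints_add ref_Ints[OF L])
    then obtain i where i: "ref_conf X r l L z + d z = of_int i" by (auto elim: Ints_cases)
    have "ref_conf X r l L z + d z \<ge> 0"
      using that fin_conf_0(3)[of X d z] by (cases "z \<in> all_index X") (auto simp: fluctuations_def ref_conf_def)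
    thus ?thesis unfolding i by simp
  qed
  show "\<forall>d\<in>?C. (\<lambda>z. of_nat (nat \<lfloor>ref_conf X r l L z + d z\<rfloor>) - ref_conf X r l L z) = d"
    using rnd by (simp add: fun_eq_iff)
  show "\<forall>m\<in>configs X (all_index X) (W_power r (2 * l + 1) L) lam.
      (\<lambda>z. nat \<lfloor>ref_conf X r l L z + (of_nat (m z) - ref_conf X r l L z)\<rfloor>) = m"
    by simp
  have conf: "m \<in> configs X (all_index X) (W_power r (2 * l + 1) L) lam \<longleftrightarrow>
     fin_conf X (\<lambda>z. ref_conf X r l L z + d z) \<and> (\<forall>z\<in>all_index X. quad_vec X d z \<le> 0) \<and>
     (\<forall>b\<in>nodes X. wtot (stp X b) (\<lambda>k. d (b, k)) = - of_nat (stp X b) * lam b)"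
    if d: "fin_conf X d" and m: "\<And>z. of_nat (m z) = ref_conf X r l L z + d z" for d m
  proof -
    have "m z \<noteq> 0 \<Longrightarrow> z \<in> all_index X" for z
      using m[of z] fin_conf_0(3)[OF d, of z] by (cases "z \<in> all_index X") (auto simp: ref_conf_def)
    thus ?thesis
      unfolding configs_iff[OF order.refl finite_supp_W_power] m quad_vec_add[OF fin_conf_ref d]
        wtot_add[OF fin_conf_ref d]
      using weight_W_power[OF X r_node, of "2 * l + 1" _ L]
      by (auto simp: quad_vec_ref wtot_ref right_diff_distrib)
  qed
  show "(\<lambda>d z. nat \<lfloor>ref_conf X r l L z + d z\<rfloor>) ` ?C \<subseteq> configs X (all_index X) (W_power r (2 * l + 1) L) lam"
  proof clarify
    fix d assume d: "d \<in> fluctuations X l lam" "\<forall>z\<in>all_index X. ref_conf X r l L z + d z \<ge> 0"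
    hence fd: "fin_conf X d" by (simp add: fluctuations_def)
    show "(\<lambda>z. nat \<lfloor>ref_conf X r l L z + d z\<rfloor>) \<in> configs X (all_index X) (W_power r (2 * l + 1) L) lam"
      using conf[OF fd, of "\<lambda>z. nat \<lfloor>ref_conf X r l L z + d z\<rfloor>"] rnd[of d] d fin_conf_add[OF fin_conf_ref fd]
      by (auto simp: fluctuations_def)
  qed
  show "(\<lambda>m z. of_nat (m z) - ref_conf X r l L z) ` configs X (all_index X) (W_power r (2 * l + 1) L) lam \<subseteq> ?C"
  proof (rule image_subsetI)
    fix m assume m: "m \<in> configs X (all_index X) (W_power r (2 * l + 1) L) lam"
    define d where "d = (\<lambda>z. of_nat (m z) - ref_conf X r l L z)"
    have fm: "fin_conf X (\<lambda>z. of_nat (m z))"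
      using m unfolding configs_iff[OF order.refl finite_supp_W_power] by blast
    have fd: "fin_conf X d"
    proof -
      have "fin_conf X (\<lambda>z. - ref_conf X r l L z)" using fin_conf_ref by (simp add: fin_conf_def)
      from fin_conf_add[OF fm this] show ?thesis by (simp add: d_def)
    qed
    have md: "of_nat (m z) = ref_conf X r l L z + d z" for z by (simp add: d_def)
    have "d z \<in> \<int>" for z unfolding d_def using ref_Ints[OF L] by auto
    moreover have "d z \<ge> 0" if zH: "z \<in> all_index X" and "\<not> central X l z" for z
    proof -
      obtain a k where "z = (a, k)" "a \<in> nodes X" "k \<ge> 1" using zH by (auto simp: all_index_def)
      thus ?thesis using that by (simp add: d_def ref_eq)
    qed
    ultimately have "d \<in> ?C" using conf[OF fd md] m fd by (auto simp: fluctuations_def d_def)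
    thus "(\<lambda>z. of_nat (m z) - ref_conf X r l L z) \<in> ?C" by (simp add: d_def)
  qed
qed

end

section \<open>The limiting terms and their fibres\<close>

definition lim_factor :: "cartan_type \<Rightarrow> nat \<Rightarrow> (nat \<times> nat \<Rightarrow> rat) \<Rightarrow> nat \<times> nat \<Rightarrow> rat fps" where
  "lim_factor X l d z = (if central X l z then inverse (qp (nat \<lfloor>- quad_vec X d z\<rfloor>))
     else qb (nat \<lfloor>- quad_vec X d z\<rfloor>) (nat \<lfloor>d z\<rfloor>))"

definition lim_term :: "cartan_type \<Rightarrow> nat \<Rightarrow> (nat \<times> nat \<Rightarrow> rat) \<Rightarrow> rat fls" where
  "lim_term X l d = fls_X_intpow \<lfloor>energy X d\<rfloor> * fps_to_fls (prod' (lim_factor X l d) (all_index X))"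

definition cell_factor :: "cartan_type \<Rightarrow> (nat \<Rightarrow> nat) \<Rightarrow> (nat \<times> nat \<Rightarrow> rat) \<Rightarrow> nat \<times> nat \<Rightarrow> rat fps" where
  "cell_factor X \<eta> m z = qb (nat \<lfloor>of_nat (\<eta> (fst z)) - quad_vec X m z\<rfloor>) (nat \<lfloor>m z\<rfloor>)"

definition boundary_data ::
  "cartan_type \<Rightarrow> nat \<Rightarrow> (nat \<times> nat \<Rightarrow> rat) \<Rightarrow> (nat \<Rightarrow> nat) \<times> (nat \<Rightarrow> nat) \<times> (nat \<Rightarrow> nat)" where
  "boundary_data X l d =
     (\<lambda>a. if a \<in> nodes X then nat \<lfloor>vacancy X d a (2 * l)\<rfloor> else 0,
      \<lambda>a. if a \<in> nodes X then nat \<lfloor>vacancy X d a (2 * l + 2)\<rfloor> else 0,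
      \<lambda>a. if a \<in> short_nodes X then nat \<lfloor>vacancy X d a (2 * l + 1)\<rfloor> else 0)"

lemma of_nat_nat_floor: "x \<in> \<int> \<Longrightarrow> x \<ge> 0 \<Longrightarrow> of_nat (nat \<lfloor>x\<rfloor>) = (x :: rat)"
  by (auto elim!: Ints_cases)

lemma fls_X_intpow_add: "fls_X_intpow (i + j) = (fls_X_intpow i * fls_X_intpow j :: rat fls)"
  by (simp add: fls_X_intpow_times_fls_X_intpow)

lemma prod_fls_X_intpow: "(\<Prod>z\<in>S. fls_X_intpow (f z)) = (fls_X_intpow (\<Sum>z\<in>S. f z) :: rat fls)"
proof (induction S rule: infinite_finite_induct)
  case (insert x F)
  thus ?case by (simp only: prod.insert sum.insert fls_X_intpow_add not_False_eq_True)
qed simp_all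

lemma prod'_fps_to_fls: "prod' (\<lambda>z. fps_to_fls (f z)) A = fps_to_fls (prod' f A :: rat fps)"
  by (simp add: prod.G_def fps_to_fls_prod)

lemma qpow_fls_X: "qpow (fls_X :: rat fls) x = fls_X_intpow \<lfloor>x\<rfloor>"
  by (simp add: qpow_def)

lemma qpow_inverse_fls_X: "qpow (inverse fls_X :: rat fls) x = fls_X_intpow (- \<lfloor>x\<rfloor>)"
proof -
  have "qpow (inverse fls_X :: rat fls) x = fls_X powi (- \<lfloor>x\<rfloor>)"
    by (simp only: qpow_def power_int_inverse power_int_minus)
  thus ?thesis by simp
qed

lemma qbinomial_inverse_fls_X:
  "p \<ge> 0 \<Longrightarrow> qbinomial (inverse fls_X) p m = fls_X_intpow (- (p * int m)) * fps_to_fls (qb (nat p) m)"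
  using qbinomial_inverse[of "fls_X :: rat fls" p m] by (simp add: qbinomial_fls_X)

text \<open>
  Inverting \<open>q\<close> turns the exponent \<open>c\<close> into \<open>- c - \<Sum> p m\<close>, which is again the pure quadratic form.
\<close>

lemma fermionic_term_inverse:
  assumes H: "H \<subseteq> all_index X" and H1: "\<And>a i. (a, i) \<in> H \<Longrightarrow> (a, 1) \<in> H"
    and m: "m \<in> configs X H (W_vec \<eta>) lam"
  defines "M \<equiv> (\<lambda>z. of_nat (m z) :: rat)"
  shows "qpow (inverse fls_X) (cc X H (W_vec \<eta>) M) *
      prod' (\<lambda>z. qbinomial (inverse fls_X) \<lfloor>pp X H (W_vec \<eta>) M z\<rfloor> (m z)) H =
    fls_X_intpow \<lfloor>energy X M\<rfloor> * fps_to_fls (prod' (cell_factor X \<eta> M) H)"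
proof -
  note fs = finite_supp_W_vec[OF H, of \<eta>]
  have M: "fin_conf X M" and mH: "\<And>z. m z \<noteq> 0 \<Longrightarrow> z \<in> H" and p0: "\<And>z. z \<in> H \<Longrightarrow> quad_vec X M z \<le> src H (W_vec \<eta>) z"
    using m unfolding configs_iff[OF H fs] M_def by auto
  have MH: "z \<in> H" if "M z \<noteq> 0" for z using mH that by (auto simp: M_def)
  define S where "S = {z. m z \<noteq> 0}"
  have S: "finite S" "S \<subseteq> H" using M mH by (auto simp: S_def fin_conf_def M_def)
  define p where "p z = of_nat (\<eta> (fst z)) - quad_vec X M z" for z
  have src: "src H (W_vec \<eta>) z = of_nat (\<eta> (fst z))" if "z \<in> H" for z
  proof -
    obtain a i where z: "z = (a, i)" by force
    have "i \<ge> 1" using that H z by (auto simp: all_index_def)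
    thus ?thesis using src_W_vec[of a H i \<eta>] H1 that z by auto
  qed
  have pp: "pp X H (W_vec \<eta>) M z = p z" if "z \<in> H" for z
    using that by (subst pp_eq[OF M H]) (use MH in \<open>auto simp: src p_def\<close>)
  have pge: "p z \<ge> 0" if "z \<in> H" for z using p0[OF that] src[OF that] by (simp add: p_def)
  have pint: "p z \<in> \<int>" for z unfolding p_def by (intro Ints_diff quad_vec_Ints[OF M]) (auto simp: M_def)
  have pair: "pair_sum X f M = (\<Sum>z\<in>S. f z * M z)" for f
  proof -
    from fin_conf_bound[OF M] obtain K where K: "\<And>a k. k > K \<Longrightarrow> M (a, k) = 0" by blast
    have "z \<in> nodes X \<times> {1..K}" if "z \<in> S" for z
    proof -
      have "M z \<noteq> 0" "z \<in> all_index X" using that S H by (auto simp: S_def M_def)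
      thus ?thesis using K[of "snd z" "fst z"] by (cases z) (auto simp: all_index_def not_less[symmetric])
    qed
    hence "(\<Sum>z\<in>nodes X \<times> {1..K}. f z * M z) = (\<Sum>z\<in>S. f z * M z)"
      by (intro sum.mono_neutral_right) (auto simp: S_def M_def)
    thus ?thesis by (subst pair_sum_eq_sum[of K]) (use K in auto)
  qed
  have cc: "cc X H (W_vec \<eta>) M = energy X M - (\<Sum>z\<in>S. of_nat (\<eta> (fst z)) * M z)"
  proof -
    have "cc X H (W_vec \<eta>) M = 1 / 2 * pair_sum X (quad_vec X M) M - pair_sum X (src H (W_vec \<eta>)) M"
      by (rule cc_eq[OF M H _ fs]) (rule MH)
    also have "pair_sum X (src H (W_vec \<eta>)) M = (\<Sum>z\<in>S. of_nat (\<eta> (fst z)) * M z)"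
      unfolding pair using S by (intro sum.cong refl) (auto simp: src)
    finally show ?thesis by (simp add: energy_def)
  qed
  have eint: "energy X M \<in> \<int>" unfolding energy_def by (rule energy_Ints[OF M]) (simp add: M_def)
  \<comment> \<open>With \<open>cc = E - \<Sigma> \<eta> m\<close> and
    \<open>\<Sigma> p m = \<Sigma> \<eta> m - 2 E\<close> the inverted exponent
    \<open>- cc - \<Sigma> p m\<close> is \<open>E\<close>.\<close>
  have ex: "- \<lfloor>cc X H (W_vec \<eta>) M\<rfloor> + (\<Sum>z\<in>S. - (\<lfloor>p z\<rfloor> * int (m z))) = \<lfloor>energy X M\<rfloor>"
  proof -
    have "(\<Sum>z\<in>S. of_nat (\<eta> (fst z)) * M z) \<in> \<int>" by (intro Ints_sum Ints_mult) (auto simp: M_def)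
    hence "cc X H (W_vec \<eta>) M \<in> \<int>" unfolding cc using eint by auto
    hence "(of_int (- \<lfloor>cc X H (W_vec \<eta>) M\<rfloor> + (\<Sum>z\<in>S. - (\<lfloor>p z\<rfloor> * int (m z)))) :: rat) =
        - cc X H (W_vec \<eta>) M - (\<Sum>z\<in>S. p z * M z)"
      using pint by (simp add: M_def sum_negf)
    also have "(\<Sum>z\<in>S. p z * M z) = (\<Sum>z\<in>S. of_nat (\<eta> (fst z)) * M z) - 2 * energy X M"
      by (simp add: p_def energy_def pair left_diff_distrib sum_subtractf)
    also have "- cc X H (W_vec \<eta>) M - \<dots> = energy X M" unfolding cc by simp
    also have "energy X M = of_int \<lfloor>energy X M\<rfloor>" using eint by simp
    finally show ?thesis by (simp only: of_int_eq_iff)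
  qed
  have q: "qbinomial (inverse fls_X) \<lfloor>pp X H (W_vec \<eta>) M z\<rfloor> (m z) =
      fls_X_intpow (- (\<lfloor>p z\<rfloor> * int (m z))) * fps_to_fls (cell_factor X \<eta> M z)" if "z \<in> H" for z
    unfolding pp[OF that] using pge[OF that]
    by (subst qbinomial_inverse_fls_X) (auto simp: cell_factor_def p_def M_def)
  have triv: "cell_factor X \<eta> M z = 1" if "z \<notin> S" for z using that by (simp add: cell_factor_def S_def M_def)
  have "prod' (\<lambda>z. qbinomial (inverse fls_X) \<lfloor>pp X H (W_vec \<eta>) M z\<rfloor> (m z)) H =
      prod' (\<lambda>z. fls_X_intpow (- (\<lfloor>p z\<rfloor> * int (m z))) * fps_to_fls (cell_factor X \<eta> M z)) H"
    by (intro prod.cong' refl q)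
  also have "\<dots> = prod' (\<lambda>z. fls_X_intpow (- (\<lfloor>p z\<rfloor> * int (m z))) * fps_to_fls (cell_factor X \<eta> M z)) S"
    using S triv by (intro prod.mono_neutral_right') (auto simp: S_def)
  also have "\<dots> = fls_X_intpow (\<Sum>z\<in>S. - (\<lfloor>p z\<rfloor> * int (m z))) * (\<Prod>z\<in>S. fps_to_fls (cell_factor X \<eta> M z))"
    using S by (simp only: prod.eq_sum prod.distrib prod_fls_X_intpow)
  also have "(\<Prod>z\<in>S. fps_to_fls (cell_factor X \<eta> M z)) = fps_to_fls (prod' (cell_factor X \<eta> M) S)"
    using S by (simp add: fps_to_fls_prod)
  also have "prod' (cell_factor X \<eta> M) S = prod' (cell_factor X \<eta> M) H"
    using S triv by (intro prod.mono_neutral_left') auto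
  finally show ?thesis
    unfolding qpow_inverse_fls_X ex[symmetric] fls_X_intpow_add by (simp only: mult.assoc)
qed

lemma level_index_1: "(a, i) \<in> level_index X l \<Longrightarrow> (a, 1) \<in> level_index X l"
  unfolding level_index_def mem_Collect_eq prod.case by (elim conjE, intro conjI) (assumption, simp, linarith)

lemma all_index_1: "(a, i) \<in> all_index X \<Longrightarrow> (a, 1) \<in> all_index X"
  by (auto simp: all_index_def)

context
  fixes X :: cartan_type and l :: nat and lam :: weight and d
  assumes X: "admissible_type X" and dT: "d \<in> fluctuations X l lam"
begin

lemma fluct_fin: "fin_conf X d" and fluct_int: "d z \<in> \<int>"
  using dT unfolding fluctuations_def by blast+

lemma vacancy_site:
  assumes "a \<in> nodes X"
  shows "vacancy X d a (stp X a * k) \<in> \<int>" "vacancy X d a (stp X a * k) \<ge> 0"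
proof -
  have "quad_vec X d (a, k) \<in> \<int>" by (rule quad_vec_Ints[OF fluct_fin fluct_int])
  thus "vacancy X d a (stp X a * k) \<in> \<int>" by (simp add: quad_vec_vacancy)
  show "vacancy X d a (stp X a * k) \<ge> 0"
  proof (cases "k = 0")
    case False
    hence "quad_vec X d (a, k) \<le> 0" using assms dT by (auto simp: fluctuations_def all_index_def)
    thus ?thesis by (simp add: quad_vec_vacancy)
  qed simp
qed

lemma site_2l: "stp X a * (tt X a * l) = 2 * l" "stp X a * (tt X a * l + tt X a) = 2 * l + 2"
  "a \<in> short_nodes X \<Longrightarrow> stp X a * Suc (tt X a * l) = 2 * l + 1"
  by (auto simp: stp_def tt_def short_nodes_iff)

lemma boundary_data_values:
  assumes "boundary_data X l d = (\<xi>, \<eta>, \<zeta>)"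
  shows "boundary_values X l d \<xi> \<eta> \<zeta>"
proof -
  have e: "\<xi> = (\<lambda>a. if a \<in> nodes X then nat \<lfloor>vacancy X d a (2 * l)\<rfloor> else 0)"
      "\<eta> = (\<lambda>a. if a \<in> nodes X then nat \<lfloor>vacancy X d a (2 * l + 2)\<rfloor> else 0)"
      "\<zeta> = (\<lambda>a. if a \<in> short_nodes X then nat \<lfloor>vacancy X d a (2 * l + 1)\<rfloor> else 0)"
    using assms by (simp_all add: boundary_data_def)
  have "of_nat (nat \<lfloor>vacancy X d a (2 * l)\<rfloor>) = vacancy X d a (2 * l)"
       "of_nat (nat \<lfloor>vacancy X d a (2 * l + 2)\<rfloor>) = vacancy X d a (2 * l + 2)" if "a \<in> nodes X" for a
    using vacancy_site[OF that, of "tt X a * l"] vacancy_site[OF that, of "tt X a * l + tt X a"]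
    unfolding site_2l by (auto intro!: of_nat_nat_floor)
  moreover have "of_nat (nat \<lfloor>vacancy X d a (2 * l + 1)\<rfloor>) = vacancy X d a (2 * l + 1)" if "a \<in> short_nodes X" for a
    using vacancy_site[of a "Suc (tt X a * l)"] that unfolding site_2l(3)[OF that]
    by (auto intro!: of_nat_nat_floor simp: short_nodes_iff)
  ultimately show ?thesis by (auto simp: boundary_values_def e)
qed

lemma upper_conf_nat: "of_nat (nat \<lfloor>upper_conf X l d z\<rfloor>) = upper_conf X l d z"
proof -
  obtain a j where z: "z = (a, j)" by force
  have "upper_conf X l d z \<in> \<int>" using fluct_int by (auto simp: z upper_conf_def upper_def)
  moreover have "upper_conf X l d z \<ge> 0"
  proof -
    have "d (a, tt X a * l + tt X a + j) \<ge> 0" if "a \<in> nodes X" "j \<noteq> 0"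
      using that dT by (auto simp: fluctuations_def all_index_def central_def tt_def stp_def)
    thus ?thesis by (auto simp: z upper_conf_def upper_def)
  qed
  ultimately show ?thesis by (rule of_nat_nat_floor)
qed

text \<open>All but the last column are columns of \<open>d\<close> left of the centre; the last one
  is minus a row total, for which \<open>tot_nonpos\<close> is needed.\<close>

lemma lower_conf_nat: "of_nat (nat \<lfloor>lower_conf X l d z\<rfloor>) = lower_conf X l d z"
proof -
  obtain a j where z: "z = (a, j)" by force
  from fin_conf_bound[OF fluct_fin] obtain K where K: "\<And>a k. k > K \<Longrightarrow> d (a, k) = 0" by blast
  have "tot (\<lambda>k. d (a, k)) = (\<Sum>k=1..K. d (a, k))"
    unfolding tot_def by (rule sum.G_atLeast_1) (use K in auto)
  hence "tot (\<lambda>k. d (a, k)) \<in> \<int>" using fluct_int by (auto intro: Ints_sum)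
  hence "lower_conf X l d z \<in> \<int>" using fluct_int by (auto simp: z lower_conf_def lower_def)
  moreover have "lower_conf X l d z \<ge> 0"
  proof -
    have "d (a, tt X a * l - j) \<ge> 0" if "a \<in> nodes X" "j \<noteq> 0" "j < tt X a * l"
      using that dT by (auto simp: fluctuations_def all_index_def central_def tt_def stp_def)
    moreover have "tot (\<lambda>k. d (a, k)) \<le> 0" if "a \<in> nodes X"
    proof (rule tot_nonpos[OF X fluct_fin _ _ that])
      show "vacancy X d a 2 \<ge> 0" if "a \<in> nodes X" for a
        using vacancy_site(2)[OF that, of "tt X a"] tt_stp[of X a] by (simp add: mult.commute)
      show "vacancy X d a 1 \<ge> 0" if "a \<in> short_nodes X" for a
        using vacancy_site(2)[of a 1] that by (simp add: short_nodes_iff stp_def)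
    qed
    ultimately show ?thesis by (auto simp: z lower_conf_def lower_def)
  qed
  ultimately show ?thesis by (rule of_nat_nat_floor)
qed

context
  fixes \<xi> \<eta> \<zeta>
  assumes bd: "boundary_data X l d = (\<xi>, \<eta>, \<zeta>)"
begin

lemma data_bv: "boundary_values X l d \<xi> \<eta> \<zeta>"
  by (rule boundary_data_values[OF bd])

lemma xi_zero: "l = 0 \<Longrightarrow> \<xi> a = 0"
  using bd by (auto simp: boundary_data_def)

text \<open>Moving the origin to \<open>2 l + 2\<close> removes the moment there, minus
  \<open>ginv_vec\<close> of \<open>\<eta>\<close>, from the weight of the row; what remains is the
  weight condition of \<open>W(\<eta>)\<close>.\<close>

lemma upper_mem: "(\<lambda>z. nat \<lfloor>upper_conf X l d z\<rfloor>) \<in> configs X (all_index X) (W_vec \<eta>) lam"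
  unfolding configs_iff[OF order.refl finite_supp_W_vec[OF order.refl]] upper_conf_nat
proof (intro conjI allI ballI impI)
  show fu: "fin_conf X (upper_conf X l d)" by (rule fin_conf_upper_conf[OF fluct_fin])
  show "z \<in> all_index X" if "nat \<lfloor>upper_conf X l d z\<rfloor> \<noteq> 0" for z
    using that fin_conf_0(3)[OF fu, of z] by (cases "z \<in> all_index X") auto
  fix z assume z: "z \<in> all_index X"
  then obtain a j where zz: "z = (a, j)" "a \<in> nodes X" "j \<ge> 1" by (auto simp: all_index_def)
  have "vacancy X d a (stp X a * (tt X a * l + tt X a + j)) \<ge> 0" by (rule vacancy_site(2)[OF zz(2)])
  hence "vacancy X d a (2 * l + 2 + stp X a * j) \<ge> 0"
    unfolding distrib_left[of _ "_ + _"] site_2l(2) .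
  thus "quad_vec X (upper_conf X l d) z \<le> src (all_index X) (W_vec \<eta>) z"
    using zz data_bv by (simp add: src_W_vec all_index_def quad_vec_vacancy vacancy_up[OF fluct_fin, simplified] boundary_values_def)
next
  fix b assume b: "b \<in> nodes X"
  have "wtot (stp X b) (\<lambda>k. upper_conf X l d (b, k)) = wtot (stp X b) (\<lambda>k. d (b, k)) + ginv_vec X \<eta> b"
    using node_row.wtot_up[OF node_row_conf[OF fluct_fin], of b l] boundary_mom(2)[OF X fluct_fin data_bv b] b
    by (simp add: upper_conf_def)
  also have "wtot (stp X b) (\<lambda>k. d (b, k)) = - of_nat (stp X b) * lam b"
    using dT b by (simp add: fluctuations_def)
  finally show "wtot (stp X b) (\<lambda>k. upper_conf X l d (b, k)) = of_nat (stp X b) *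
      (sum' (\<lambda>(a, i). of_nat (i * W_vec \<eta> (a, i)) * fund_weight X a b) (all_index X) - lam b)"
    unfolding right_diff_distrib 
    by (subst weight_W_vec[OF X order.refl _ b]) (auto simp: all_index_def)
qed

text \<open>All columns lie at or below position \<open>2 l\<close>, so the weight of a row is its
  moment at \<open>2 l\<close>. That position is the old origin, so the moment is just
  \<open>ginv_vec\<close> of \<open>\<xi>\<close>; this is why the left half has weight 0.\<close>

lemma lower_mem: "(\<lambda>z. nat \<lfloor>lower_conf X l d z\<rfloor>) \<in> configs X (level_index X l) (W_vec \<xi>) (\<lambda>_. 0)"
  unfolding configs_iff[OF level_index_subset finite_supp_W_vec[OF level_index_subset]] lower_conf_nat
proof (intro conjI allI ballI impI)
  show "fin_conf X (lower_conf X l d)" by (rule fin_conf_lower_conf[OF fluct_fin])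
  show "z \<in> level_index X l" if "nat \<lfloor>lower_conf X l d z\<rfloor> \<noteq> 0" for z
    using that by (cases z) (auto simp: lower_conf_def lower_def level_index_def split: if_splits)
  fix z assume z: "z \<in> level_index X l"
  then obtain a j where zz: "z = (a, j)" "a \<in> nodes X" "j \<ge> 1" "j \<le> tt X a * l" by (auto simp: level_index_def)
  have "stp X a * j \<le> stp X a * (tt X a * l)" using zz by simp
  hence le: "stp X a * j \<le> 2 * l" unfolding site_2l .
  have "vacancy X d a (stp X a * (tt X a * l - j)) \<ge> 0" by (rule vacancy_site(2)[OF zz(2)])
  hence "vacancy X d a (2 * l - stp X a * j) \<ge> 0"
    unfolding diff_mult_distrib2 site_2l(1) .
  moreover have "(a, 1) \<in> level_index X l" using z level_index_1 zz(1) by blast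
  ultimately show "quad_vec X (lower_conf X l d) z \<le> src (level_index X l) (W_vec \<xi>) z"
    using zz data_bv by (simp add: src_W_vec quad_vec_vacancy vacancy_low[OF fluct_fin le] boundary_values_def)
next
  fix b assume b: "b \<in> nodes X"
  have "wtot (stp X b) (\<lambda>k. lower_conf X l d (b, k)) = mom (stp X b) (\<lambda>k. lower_conf X l d (b, k)) (2 * l)"
    unfolding wtot_def mom_def
  proof (rule sum.cong'[OF refl])
    fix k
    have "stp X b * k \<le> stp X b * (tt X b * l)" if "k \<le> tt X b * l" using that by simp
    hence "min (2 * l) (stp X b * k) = stp X b * k" if "k \<le> tt X b * l" using that unfolding site_2l by (simp add: min_absorb2)
    thus "of_nat (stp X b * k) * lower_conf X l d (b, k) = of_nat (min (2 * l) (stp X b * k)) * lower_conf X l d (b, k)"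
      by (cases "k \<le> tt X b * l") (simp_all add: lower_conf_def lower_def)
  qed
  also have "\<dots> = ginv_vec X \<xi> b"
    using node_row.mom_low[OF node_row_conf[OF fluct_fin], of "2 * l" l b] node_row.mom_0[OF node_row_conf[OF fluct_fin], of b]
      boundary_mom(1)[OF X fluct_fin data_bv b] b by (simp add: lower_conf_def)
  also have "\<dots> = of_nat (stp X b) *
      sum' (\<lambda>(a, i). of_nat (i * W_vec \<xi> (a, i)) * fund_weight X a b) (level_index X l)"
  proof (rule weight_W_vec[OF X level_index_subset _ b, symmetric])
    fix a assume a: "a \<in> nodes X" "\<xi> a \<noteq> 0"
    hence "l > 0" using xi_zero by (cases l) auto
    hence "tt X a * l > 0" by simp
    thus "(a, 1) \<in> level_index X l" using a by (simp add: level_index_def Suc_le_eq)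
  qed
  finally show "wtot (stp X b) (\<lambda>k. lower_conf X l d (b, k)) = of_nat (stp X b) *
      (sum' (\<lambda>(a, i). of_nat (i * W_vec \<xi> (a, i)) * fund_weight X a b) (level_index X l) - 0)"
    by (simp only: diff_zero)
qed

text \<open>Vacancy numbers of the halves are those of \<open>d\<close>, so off the centre the
  q-binomials are simply redistributed; the central factors supply the denominators.\<close>

lemma lim_factor_split:
  "prod' (lim_factor X l d) (all_index X) =
     prod' (cell_factor X \<eta> (upper_conf X l d)) (all_index X) *
     prod' (cell_factor X \<xi> (lower_conf X l d)) (level_index X l) *
     ((\<Prod>a\<in>nodes X. inverse (qp (\<eta> a)) * inverse (qp (\<xi> a))) * (\<Prod>a\<in>short_nodes X. inverse (qp (\<zeta> a))))"
proof -
  let ?U = "upper_conf X l d" and ?W = "lower_conf X l d"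
  from fin_conf_bound[OF fluct_fin] obtain K where K: "\<And>a k. k > K \<Longrightarrow> d (a, k) = 0" by blast
  from fin_conf_bound[OF fin_conf_upper_conf[OF fluct_fin]] obtain K2 where K2: "\<And>a k. k > K2 \<Longrightarrow> ?U (a, k) = 0" by blast
  have lf1: "lim_factor X l d (a, k) = 1" if "k > max K (2 * l + 2)" for a k
  proof -
    have "k \<le> stp X a * k" by (simp add: stp_def)
    hence "\<not> central X l (a, k)" using that unfolding central_def fst_conv snd_conv by linarith
    thus ?thesis using that K by (simp add: lim_factor_def)
  qed
  \<comment> \<open>Column 0 is no site, yet it counts as central when \<open>l = 0\<close>; its
    vacancy number is 0, so the factor is \<open>1 / (q)_0\<close>.\<close>
  have "lim_factor X l d (a, 0) = 1" if "a \<in> nodes X" for a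
    using that fin_conf_0(1)[OF fluct_fin] by (auto simp: lim_factor_def central_def quad_vec_vacancy fps_inverse_one')
  note lf0 = this
  have "prod' (lim_factor X l d) (all_index X) = (\<Prod>a\<in>nodes X. prod' (\<lambda>k. lim_factor X l d (a, k)) {1..})"
  proof (rule prod.G_sites(2)[OF order.refl, where K = "max K (2 * l + 2)"])
    fix a k assume nz: "lim_factor X l d (a, k) \<noteq> 1" and a: "a \<in> nodes X"
    have "k \<noteq> 0" using nz lf0[OF a] by (cases "k = 0") auto
    moreover have "k \<le> max K (2 * l + 2)" using nz lf1[of k a] by (meson not_le)
    ultimately show "(a, k) \<in> all_index X \<and> k \<le> max K (2 * l + 2)"
      using a by (simp add: all_index_def)
  qed
  also have "\<dots> = (\<Prod>a\<in>nodes X. prod' (\<lambda>k. cell_factor X \<eta> ?U (a, k)) {1..} * 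
      prod' (\<lambda>k. cell_factor X \<xi> ?W (a, k)) {1..} * (inverse (qp (\<eta> a)) * inverse (qp (\<xi> a))) * 
      (if a \<in> short_nodes X then inverse (qp (\<zeta> a)) else 1))"
  proof (intro prod.cong refl)
    fix a assume a: "a \<in> nodes X"
    define u t where "u = tt X a * l" and "t = tt X a"
    have site: "stp X a * u = 2 * l" "stp X a * (u + t) = 2 * l + 2" using site_2l[of a] by (simp_all add: u_def t_def)
    have t: "t = 1 \<or> t = 2" by (auto simp: t_def tt_def)
    have fin: "finite {k. lim_factor X l d (a, k) \<noteq> 1}"
    proof (rule finite_subset)
      show "{k. lim_factor X l d (a, k) \<noteq> 1} \<subseteq> {..max K (2 * l + 2)}"
        unfolding atMost_def using lf1 by (intro Collect_mono impI) (meson not_le)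
    qed simp
    have 1: "lim_factor X l d (a, u - j) = cell_factor X \<xi> ?W (a, j)" if j: "j \<in> {1..<u}" for j
    proof -
      have "stp X a * j < stp X a * u" "0 < stp X a * j" using j by auto
      hence le: "stp X a * j \<le> 2 * l" "0 < stp X a * j" unfolding site by auto
      have e: "stp X a * (u - j) = 2 * l - stp X a * j" unfolding diff_mult_distrib2 site ..
      have "\<not> central X l (a, u - j)" using le unfolding central_def fst_conv snd_conv e by linarith
      moreover have "vacancy X d a (2 * l - stp X a * j) = of_nat (\<xi> a) + vacancy X ?W a (stp X a * j)"
        using data_bv a by (simp add: vacancy_low[OF fluct_fin le(1)] boundary_values_def)
      moreover have "?W (a, j) = d (a, u - j)"
        using j a by (auto simp: lower_conf_def lower_def u_def)
      ultimately show ?thesis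
        unfolding lim_factor_def cell_factor_def quad_vec_vacancy e by (simp add: add.commute)
    qed
    \<comment> \<open>For \<open>l = 0\<close> there is no left boundary column; the factor for
      \<open>\<xi>\<close> is then trivial because \<open>\<xi> = 0\<close>.\<close>
    have 2: "(if u > 0 then lim_factor X l d (a, u) else 1) = inverse (qp (\<xi> a))"
    proof (cases "u > 0")
      case True
      have "vacancy X d a (2 * l) = of_nat (\<xi> a)" using data_bv a by (simp add: boundary_values_def)
      thus ?thesis using True by (simp add: lim_factor_def central_def site quad_vec_vacancy)
    next
      case False
      hence "l = 0" by (simp add: u_def)
      thus ?thesis using False xi_zero by (simp add: fps_inverse_one')
    qed
    have 3: "(if t = 2 then lim_factor X l d (a, Suc u) else 1) = (if a \<in> short_nodes X then inverse (qp (\<zeta> a)) else 1)"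
    proof (cases "a \<in> short_nodes X")
      case True
      have e: "stp X a * Suc u = 2 * l + 1" using site_2l(3)[OF True] by (simp only: u_def)
      have "vacancy X d a (2 * l + 1) = of_nat (\<zeta> a)" using data_bv True by (simp add: boundary_values_def)
      thus ?thesis using True unfolding lim_factor_def central_def fst_conv snd_conv e quad_vec_vacancy
        by (simp add: t_def tt_2_iff short_nodes_iff)
    next
      case False
      thus ?thesis using a by (simp add: t_def tt_2_iff short_nodes_iff)
    qed
    have 4: "lim_factor X l d (a, u + t) = inverse (qp (\<eta> a))"
    proof -
      have "vacancy X d a (2 * l + 2) = of_nat (\<eta> a)" using data_bv a by (simp add: boundary_values_def)
      thus ?thesis unfolding lim_factor_def central_def fst_conv snd_conv site quad_vec_vacancy by simp
    qed
    have 5: "prod' (\<lambda>j. lim_factor X l d (a, u + t + j)) {1..} = prod' (\<lambda>k. cell_factor X \<eta> ?U (a, k)) {1..}"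
    proof (intro prod.cong' refl)
      fix j :: nat assume j: "j \<in> {1..}"
      have e: "stp X a * (u + t + j) = 2 * l + 2 + stp X a * j" unfolding distrib_left[of _ "_ + _"] site ..
      have "0 < stp X a * j" using j by simp
      hence "\<not> central X l (a, u + t + j)" unfolding central_def fst_conv snd_conv e by linarith
      thus "lim_factor X l d (a, u + t + j) = cell_factor X \<eta> ?U (a, j)"
        using j a data_bv vacancy_up[OF fluct_fin, of a l "stp X a * j"]
        unfolding lim_factor_def cell_factor_def quad_vec_vacancy e 
        by (simp add: boundary_values_def upper_conf_def upper_def u_def t_def add.commute)
    qed
    have 6: "prod' (\<lambda>k. cell_factor X \<xi> ?W (a, k)) {1..} = (\<Prod>j=1..<u. cell_factor X \<xi> ?W (a, j))"
    proof -
      have "prod' (\<lambda>k. cell_factor X \<xi> ?W (a, k)) {1..} = (\<Prod>j=1..u. cell_factor X \<xi> ?W (a, j))"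
        by (rule prod.G_atLeast_1) (simp add: cell_factor_def lower_conf_def lower_def u_def)
      also have "\<dots> = (\<Prod>j=1..<u. cell_factor X \<xi> ?W (a, j))"
      proof (cases u)
        case (Suc v)
        \<comment> \<open>The vacancy number of the reflected last column is that of
          \<open>d\<close> at the origin, hence 0, and its q-binomial is 1. So this extra column,
          which has no counterpart among the columns of \<open>d\<close> left of the centre, does
          not disturb the factorisation.\<close>
        have "of_nat (\<xi> a) - quad_vec X ?W (a, u) = 0"
          using vacancy_low[OF fluct_fin order.refl, of a l] data_bv a
          by (simp add: quad_vec_vacancy site boundary_values_def)
        hence "cell_factor X \<xi> ?W (a, u) = 1" by (simp add: cell_factor_def)
        thus ?thesis using Suc by (simp add: atLeastLessThanSuc_atLeastAtMost)
      qed simp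
      finally show ?thesis .
    qed
    have "prod' (\<lambda>k. lim_factor X l d (a, k)) {1..} = (\<Prod>j=1..<u. lim_factor X l d (a, u - j)) *
       (if u > 0 then lim_factor X l d (a, u) else 1) * (if t = 2 then lim_factor X l d (a, Suc u) else 1) *
       lim_factor X l d (a, u + t) * prod' (\<lambda>j. lim_factor X l d (a, u + t + j)) {1..}"
      by (rule prod.G_split[OF fin t])
    also have "(\<Prod>j=1..<u. lim_factor X l d (a, u - j)) = prod' (\<lambda>k. cell_factor X \<xi> ?W (a, k)) {1..}"
      unfolding 6 by (intro prod.cong refl 1)
    finally show "prod' (\<lambda>k. lim_factor X l d (a, k)) {1..} = prod' (\<lambda>k. cell_factor X \<eta> ?U (a, k)) {1..} * 
      prod' (\<lambda>k. cell_factor X \<xi> ?W (a, k)) {1..} * (inverse (qp (\<eta> a)) * inverse (qp (\<xi> a))) * 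
      (if a \<in> short_nodes X then inverse (qp (\<zeta> a)) else 1)"
      unfolding 2 3 4 5 by (simp only: mult_ac)
  qed
  also have "\<dots> = (\<Prod>a\<in>nodes X. prod' (\<lambda>k. cell_factor X \<eta> ?U (a, k)) {1..}) * 
      (\<Prod>a\<in>nodes X. prod' (\<lambda>k. cell_factor X \<xi> ?W (a, k)) {1..}) *
      (\<Prod>a\<in>nodes X. inverse (qp (\<eta> a)) * inverse (qp (\<xi> a))) * 
      (\<Prod>a\<in>nodes X. if a \<in> short_nodes X then inverse (qp (\<zeta> a)) else 1)"
    by (simp only: prod.distrib)
  also have "(\<Prod>a\<in>nodes X. if a \<in> short_nodes X then inverse (qp (\<zeta> a)) else 1) = (\<Prod>a\<in>short_nodes X. inverse (qp (\<zeta> a)))"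
    using short_nodes_subset[of X] by (simp add: prod.inter_restrict[symmetric] Int_absorb1)
  also have "(\<Prod>a\<in>nodes X. prod' (\<lambda>k. cell_factor X \<eta> ?U (a, k)) {1..}) = prod' (cell_factor X \<eta> ?U) (all_index X)"
  proof (rule prod.G_sites(2)[OF order.refl, where K = K2, symmetric])
    fix a k assume "cell_factor X \<eta> ?U (a, k) \<noteq> 1" "a \<in> nodes X"
    hence nz: "?U (a, k) \<noteq> 0" by (auto simp: cell_factor_def)
    thus "(a, k) \<in> all_index X \<and> k \<le> K2"
      using fin_conf_0(3)[OF fin_conf_upper_conf[OF fluct_fin], of "(a, k)"] K2[of k a] by (meson not_le)
  qed
  also have "(\<Prod>a\<in>nodes X. prod' (\<lambda>k. cell_factor X \<xi> ?W (a, k)) {1..}) = prod' (cell_factor X \<xi> ?W) (level_index X l)"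
  proof (rule prod.G_sites(2)[OF level_index_subset, where K = "2 * l", symmetric])
    fix a k assume "cell_factor X \<xi> ?W (a, k) \<noteq> 1" "a \<in> nodes X"
    hence "?W (a, k) \<noteq> 0" by (auto simp: cell_factor_def)
    hence "(a, k) \<in> level_index X l" by (auto simp: lower_conf_def lower_def level_index_def split: if_splits)
    thus "(a, k) \<in> level_index X l \<and> k \<le> 2 * l" by (auto simp: level_index_def tt_def split: if_splits)
  qed
  finally show ?thesis by (simp only: mult.assoc)
qed

end

end

lemma lim_term_eq:
  assumes X: "admissible_type X" and d: "d \<in> fluctuations X l lam" and bd: "boundary_data X l d = (\<xi>, \<eta>, \<zeta>)"
  defines "mu \<equiv> (\<lambda>z. nat \<lfloor>upper_conf X l d z\<rfloor>)" and "ml \<equiv> (\<lambda>z. nat \<lfloor>lower_conf X l d z\<rfloor>)"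
  shows "lim_term X l d = qpow fls_X (phi X \<xi> \<eta> \<zeta>) *
    (qpow (inverse fls_X) (cc X (all_index X) (W_vec \<eta>) (\<lambda>z. of_nat (mu z))) *
      prod' (\<lambda>z. qbinomial (inverse fls_X) \<lfloor>pp X (all_index X) (W_vec \<eta>) (\<lambda>z. of_nat (mu z)) z\<rfloor> (mu z)) (all_index X)) *
    (qpow (inverse fls_X) (cc X (level_index X l) (W_vec \<xi>) (\<lambda>z. of_nat (ml z))) *
      prod' (\<lambda>z. qbinomial (inverse fls_X) \<lfloor>pp X (level_index X l) (W_vec \<xi>) (\<lambda>z. of_nat (ml z)) z\<rfloor> (ml z)) (level_index X l)) /
    ((\<Prod>a\<in>nodes X. qpoch fls_X (\<eta> a) * qpoch fls_X (\<xi> a)) * (\<Prod>a\<in>short_nodes X. qpoch fls_X (\<zeta> a)))"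
proof -
  let ?U = "upper_conf X l d" and ?W = "lower_conf X l d"
  have fd: "fin_conf X d" and di: "\<And>z. d z \<in> \<int>" using fluct_fin[OF X d] fluct_int[OF X d] by blast+
  have mu: "(\<lambda>z. of_nat (mu z)) = ?U" and ml: "(\<lambda>z. of_nat (ml z)) = ?W"
    unfolding mu_def ml_def using upper_conf_nat[OF X d] lower_conf_nat[OF X d] by auto
  have fU: "fin_conf X ?U" and fW: "fin_conf X ?W"
    using fin_conf_upper_conf[OF fd] fin_conf_lower_conf[OF fd] by auto
  have eU: "energy X ?U \<in> \<int>" unfolding energy_def
    by (rule energy_Ints[OF fU]) (simp add: mu[symmetric])
  have eW: "energy X ?W \<in> \<int>" unfolding energy_def
    by (rule energy_Ints[OF fW]) (simp add: ml[symmetric])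
  have ed: "energy X d \<in> \<int>" unfolding energy_def by (rule energy_Ints[OF fd di])
  have sp: "energy X d = phi X \<xi> \<eta> \<zeta> + energy X ?U + energy X ?W"
    unfolding energy_def by (rule energy_split[OF X fd boundary_data_values[OF X d bd]])
  \<comment> \<open>Integrality of \<open>phi\<close> is read off from the three energies instead of
    from the congruences.\<close>
  hence "phi X \<xi> \<eta> \<zeta> = energy X d - energy X ?U - energy X ?W" by simp
  hence ph: "phi X \<xi> \<eta> \<zeta> \<in> \<int>" using eU eW ed by (metis Ints_diff)
  have fl: "\<lfloor>energy X d\<rfloor> = \<lfloor>phi X \<xi> \<eta> \<zeta>\<rfloor> + \<lfloor>energy X ?U\<rfloor> + \<lfloor>energy X ?W\<rfloor>"
    unfolding sp using ph eU eW by (auto elim!: Ints_cases)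
  have up: "qpow (inverse fls_X) (cc X (all_index X) (W_vec \<eta>) (\<lambda>z. of_nat (mu z))) *
      prod' (\<lambda>z. qbinomial (inverse fls_X) \<lfloor>pp X (all_index X) (W_vec \<eta>) (\<lambda>z. of_nat (mu z)) z\<rfloor> (mu z)) (all_index X) =
      fls_X_intpow \<lfloor>energy X ?U\<rfloor> * fps_to_fls (prod' (cell_factor X \<eta> ?U) (all_index X))"
    unfolding mu[symmetric]
    by (rule fermionic_term_inverse[OF order.refl all_index_1]) (assumption, unfold mu_def, rule upper_mem[OF X d bd])
  have low: "qpow (inverse fls_X) (cc X (level_index X l) (W_vec \<xi>) (\<lambda>z. of_nat (ml z))) *
      prod' (\<lambda>z. qbinomial (inverse fls_X) \<lfloor>pp X (level_index X l) (W_vec \<xi>) (\<lambda>z. of_nat (ml z)) z\<rfloor> (ml z)) (level_index X l) =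
      fls_X_intpow \<lfloor>energy X ?W\<rfloor> * fps_to_fls (prod' (cell_factor X \<xi> ?W) (level_index X l))"
    unfolding ml[symmetric]
    by (rule fermionic_term_inverse[OF level_index_subset level_index_1]) (assumption, unfold ml_def, rule lower_mem[OF X d bd])
  have inv: "fps_to_fls ((\<Prod>a\<in>nodes X. inverse (qp (\<eta> a)) * inverse (qp (\<xi> a))) * (\<Prod>a\<in>short_nodes X. inverse (qp (\<zeta> a)))) =
    inverse ((\<Prod>a\<in>nodes X. qpoch fls_X (\<eta> a) * qpoch fls_X (\<xi> a)) * (\<Prod>a\<in>short_nodes X. qpoch fls_X (\<zeta> a)))"
    by (simp add: fls_times_fps_to_fls fps_to_fls_prod fps_to_fls_inverse_qp prod_inversef[symmetric] o_def prod.distrib)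
  show ?thesis
    unfolding lim_term_def lim_factor_split[OF X d bd] up low fl fls_X_intpow_add qpow_fls_X
      fls_times_fps_to_fls[of "_ * _" "_ * _"] inv divide_inverse
    by (simp only: fls_times_fps_to_fls mult_ac)
qed

text \<open>Here the congruences enter: they make the central columns integral. The other columns
  are copied from the two halves and inherit their signs, and their vacancy numbers are the vacancy
  numbers of the halves; the central vacancy numbers are the boundary data themselves.\<close>

lemma assemble_mem:
  assumes X: "admissible_type X" and rng: "(\<xi>, \<eta>, \<zeta>) \<in> summation_range X (2 * l + 1)"
    and mu: "mu \<in> configs X (all_index X) (W_vec \<eta>) lam"
    and ml: "ml \<in> configs X (level_index X l) (W_vec \<xi>) (\<lambda>_. 0)"
  defines "d \<equiv> assemble X l \<xi> \<eta> \<zeta> (\<lambda>z. of_nat (mu z)) (\<lambda>z. of_nat (ml z))"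
  shows "d \<in> fluctuations X l lam" "boundary_data X l d = (\<xi>, \<eta>, \<zeta>)"
    "upper_conf X l d = (\<lambda>z. of_nat (mu z))" "lower_conf X l d = (\<lambda>z. of_nat (ml z))"
proof -
  have xi0: "\<xi> a = 0" if "l = 0" for a using rng that by (simp add: summation_range_def)
  have out: "\<xi> a = 0" "\<eta> a = 0" if "a \<notin> nodes X" for a using rng that by (auto simp: summation_range_def)
  have outs: "\<zeta> a = 0" if "a \<notin> short_nodes X" for a using rng that by (auto simp: summation_range_def)
  have "congruences X \<xi> \<eta> \<zeta>" using rng by (simp add: summation_range_def)
  note cong = this[unfolded congruences_iff[OF X]]
  note mu' = mu[unfolded configs_iff[OF order.refl finite_supp_W_vec[OF order.refl]]]
  note ml' = ml[unfolded configs_iff[OF level_index_subset finite_supp_W_vec[OF level_index_subset]]]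
  have H1: "(a, 1) \<in> level_index X l" if "a \<in> nodes X" "\<xi> a \<noteq> 0" for a
  proof -
    have "l > 0" using that xi0 by (cases l) auto
    hence "tt X a * l > 0" by simp
    thus ?thesis using that by (simp add: level_index_def Suc_le_eq)
  qed
  have fmu: "fin_conf X (\<lambda>z. of_nat (mu z))" and fml: "fin_conf X (\<lambda>z. of_nat (ml z))" 
    and mlH: "\<And>z. (of_nat (ml z) :: rat) \<noteq> 0 \<Longrightarrow> z \<in> level_index X l"
    using mu' ml' by auto
  \<comment> \<open>No column of \<open>ml\<close> lies beyond \<open>2 l\<close>, so the moment
    there is the whole weight.\<close>
  have xi: "mom (stp X a) (\<lambda>k. of_nat (ml (a, k))) (2 * l) = ginv_vec X \<xi> a" if a: "a \<in> nodes X" for a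
  proof -
    have "mom (stp X a) (\<lambda>k. of_nat (ml (a, k))) (2 * l) = wtot (stp X a) (\<lambda>k. of_nat (ml (a, k)))"
      unfolding wtot_def mom_def
    proof (rule sum.cong'[OF refl])
      fix k
      have "stp X a * k \<le> 2 * l" if "k \<le> tt X a * l"
      proof -
        have "stp X a * k \<le> stp X a * (tt X a * l)" using that by simp
        also have "\<dots> = 2 * l" using tt_stp[of X a] by (simp add: mult.commute mult.left_commute)
        finally show ?thesis .
      qed
      moreover have "(of_nat (ml (a, k)) :: rat) = 0" if "\<not> k \<le> tt X a * l"
        using mlH[of "(a, k)"] that by (auto simp: level_index_def)
      ultimately show "of_nat (min (2 * l) (stp X a * k)) * of_nat (ml (a, k)) = (of_nat (stp X a * k) * of_nat (ml (a, k)) :: rat)"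
        by (cases "k \<le> tt X a * l") (auto simp: min_absorb2)
    qed
    also have "\<dots> = of_nat (stp X a) *
        (sum' (\<lambda>(a', i). of_nat (i * W_vec \<xi> (a', i)) * fund_weight X a' a) (level_index X l) - 0)"
      using ml' a by blast
    also have "\<dots> = ginv_vec X \<xi> a"
      unfolding diff_zero by (rule weight_W_vec[OF X level_index_subset H1 a])
    finally show ?thesis .
  qed
  note as = fmu fml mlH xi
  have fd: "fin_conf X d" unfolding d_def by (rule fin_conf_assemble[OF X as])
  show up: "upper_conf X l d = (\<lambda>z. of_nat (mu z))" unfolding d_def by (rule upper_conf_assemble[OF X as])
  show low: "lower_conf X l d = (\<lambda>z. of_nat (ml z))" unfolding d_def by (rule lower_conf_assemble[OF X as])
  have bv: "boundary_values X l d \<xi> \<eta> \<zeta>" unfolding d_def by (rule boundary_assemble[OF X as])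
  show "boundary_data X l d = (\<xi>, \<eta>, \<zeta>)"
    unfolding boundary_data_def prod.inject fun_eq_iff
  proof (intro conjI allI)
    fix a
    show "(if a \<in> nodes X then nat \<lfloor>vacancy X d a (2 * l)\<rfloor> else 0) = \<xi> a"
    proof (cases "a \<in> nodes X")
      case True
      hence "vacancy X d a (2 * l) = of_nat (\<xi> a)" using bv by (simp add: boundary_values_def)
      thus ?thesis using True by simp
    qed (use out in simp)
    show "(if a \<in> nodes X then nat \<lfloor>vacancy X d a (2 * l + 2)\<rfloor> else 0) = \<eta> a"
    proof (cases "a \<in> nodes X")
      case True
      hence "vacancy X d a (2 * l + 2) = of_nat (\<eta> a)" using bv by (simp add: boundary_values_def)
      thus ?thesis using True by simp
    qed (use out in simp)
    show "(if a \<in> short_nodes X then nat \<lfloor>vacancy X d a (2 * l + 1)\<rfloor> else 0) = \<zeta> a"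
    proof (cases "a \<in> short_nodes X")
      case True
      hence "vacancy X d a (2 * l + 1) = of_nat (\<zeta> a)" using bv by (simp add: boundary_values_def)
      thus ?thesis using True by simp
    qed (use outs in simp)
  qed
  have site: "stp X a * (tt X a * l) = 2 * l" "stp X a * (tt X a * l + tt X a) = 2 * l + 2" for a
    by (auto simp: stp_def tt_def)
  have ints: "(ginv_vec X \<eta> a - ginv_vec X \<xi> a - centre X \<xi> \<eta> \<zeta> a) / 2 \<in> \<int>"
     "(ginv_vec X \<xi> a - ginv_vec X \<eta> a - centre X \<xi> \<eta> \<zeta> a) / 2 \<in> \<int>" "centre X \<xi> \<eta> \<zeta> a \<in> \<int>" if a: "a \<in> nodes X" for a
  proof -
    show c: "centre X \<xi> \<eta> \<zeta> a \<in> \<int>"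
      using cong by (cases "a \<in> short_nodes X") (auto simp: centre_def)
    show e: "(ginv_vec X \<xi> a - ginv_vec X \<eta> a - centre X \<xi> \<eta> \<zeta> a) / 2 \<in> \<int>"
    proof (cases "a \<in> short_nodes X")
      case False
      hence "stp X a = 2" "centre X \<xi> \<eta> \<zeta> a = 0" using a by (auto simp: short_nodes_iff stp_def centre_def)
      thus ?thesis using cong a by (auto simp: diff_divide_distrib dest!: bspec[of _ _ a] intro!: Ints_diff)
    qed (use cong in auto)
    have "(ginv_vec X \<eta> a - ginv_vec X \<xi> a - centre X \<xi> \<eta> \<zeta> a) / 2 =
       - ((ginv_vec X \<xi> a - ginv_vec X \<eta> a - centre X \<xi> \<eta> \<zeta> a) / 2) - centre X \<xi> \<eta> \<zeta> a"
      by (simp add: field_simps)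
    also have "\<dots> \<in> \<int>" by (intro Ints_diff Ints_minus e c)
    finally show "(ginv_vec X \<eta> a - ginv_vec X \<xi> a - centre X \<xi> \<eta> \<zeta> a) / 2 \<in> \<int>" .
  qed
  have totI: "tot (\<lambda>j. of_nat (mu (a, j))) \<in> \<int>" for a
    unfolding tot_def sum.G_def by (auto intro!: Ints_sum)
  have di: "d z \<in> \<int>" for z
  proof -
    obtain a k where z: "z = (a, k)" by force
    have "a \<in> nodes X" if "(a, k) \<in> all_index X" using that by (auto simp: all_index_def)
    thus ?thesis unfolding d_def z assemble_def prod.case
      using ints[of a] totI[of a] by (auto intro!: Ints_diff Ints_sum)
  qed
  have vac: "vacancy X d a (stp X a * k) \<ge> 0" if a: "a \<in> nodes X" for a k
  proof -
    consider "k < tt X a * l" | "k = tt X a * l" | "tt X a * l < k" "k < tt X a * l + tt X a" 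
      | "k = tt X a * l + tt X a" | "tt X a * l + tt X a < k" by linarith
    thus ?thesis
    proof cases
      case 1
      define j where "j = tt X a * l - k"
      have k: "k = tt X a * l - j" "j \<le> tt X a * l" "j > 0" using 1 by (auto simp: j_def)
      have "stp X a * j \<le> stp X a * (tt X a * l)" using k by simp
      hence le: "stp X a * j \<le> 2 * l" unfolding site .
      have e: "stp X a * k = 2 * l - stp X a * j" unfolding k(1) diff_mult_distrib2 site ..
      have mem: "(a, j) \<in> level_index X l" using k a by (simp add: level_index_def)
      have "quad_vec X (\<lambda>z. of_nat (ml z)) (a, j) \<le> src (level_index X l) (W_vec \<xi>) (a, j)"
        using ml' mem by blast
      hence "quad_vec X (\<lambda>z. of_nat (ml z)) (a, j) \<le> of_nat (\<xi> a)"
        using k by (subst (asm) src_W_vec[OF level_index_1[OF mem]]) auto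
      thus ?thesis unfolding e vacancy_low[OF fd le] low
        using bv a by (simp add: quad_vec_vacancy boundary_values_def)
    next
      case 2
      have "vacancy X d a (2 * l) = of_nat (\<xi> a)" using bv a by (simp add: boundary_values_def)
      thus ?thesis unfolding 2 site by simp
    next
      case 3
      hence as: "a \<in> short_nodes X" and k: "stp X a * k = 2 * l + 1"
        using a by (auto simp: short_nodes_iff tt_def stp_def split: if_splits)
      have "vacancy X d a (2 * l + 1) = of_nat (\<zeta> a)" using bv as by (simp add: boundary_values_def)
      thus ?thesis unfolding k by simp
    next
      case 4
      have "vacancy X d a (2 * l + 2) = of_nat (\<eta> a)" using bv a by (simp add: boundary_values_def)
      thus ?thesis unfolding 4 site by simp
    next
      case 5
      define j where "j = k - (tt X a * l + tt X a)"
      have k: "k = tt X a * l + tt X a + j" "j > 0" using 5 by (auto simp: j_def)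
      have e: "stp X a * k = 2 * l + 2 + stp X a * j" unfolding k(1) distrib_left[of _ "_ + _"] site ..
      have mem: "(a, j) \<in> all_index X" using k a by (simp add: all_index_def)
      have "quad_vec X (\<lambda>z. of_nat (mu z)) (a, j) \<le> src (all_index X) (W_vec \<eta>) (a, j)"
        using mu' mem by blast
      hence "quad_vec X (\<lambda>z. of_nat (mu z)) (a, j) \<le> of_nat (\<eta> a)"
        using k by (subst (asm) src_W_vec[OF all_index_1[OF mem]]) auto
      moreover have "vacancy X d a (2 * l + 2) = of_nat (\<eta> a)" using bv a by (simp add: boundary_values_def)
      ultimately show ?thesis unfolding e vacancy_up[OF fd] up
        by (simp add: quad_vec_vacancy)
    qed
  qed
  show "d \<in> fluctuations X l lam"
    unfolding fluctuations_def mem_Collect_eq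
  proof (intro conjI allI ballI impI fd di)
    fix z assume z: "z \<in> all_index X"
    then obtain a k where zz: "z = (a, k)" "a \<in> nodes X" "k \<ge> 1" by (auto simp: all_index_def)
    show "quad_vec X d z \<le> 0" using vac[OF zz(2), of k] by (simp add: zz(1) quad_vec_vacancy)
    assume nc: "\<not> central X l z"
    have "k < tt X a * l \<or> tt X a * l + tt X a < k"
    proof (rule ccontr)
      assume "\<not> ?thesis"
      hence "stp X a * (tt X a * l) \<le> stp X a * k" "stp X a * k \<le> stp X a * (tt X a * l + tt X a)"
        by (auto intro!: mult_le_mono2)
      thus False using nc unfolding site central_def zz(1) fst_conv snd_conv by simp
    qed
    thus "d z \<ge> 0" using z by (auto simp: d_def assemble_def zz(1))
  next
    fix b assume b: "b \<in> nodes X"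
    have "wtot (stp X b) (\<lambda>k. d (b, k)) = - ginv_vec X \<eta> b + wtot (stp X b) (\<lambda>k. upper_conf X l d (b, k))"
      using node_row.wtot_up[OF node_row_conf[OF fd], of b l] boundary_mom(2)[OF X fd bv b] b
      by (simp add: upper_conf_def)
    also have "wtot (stp X b) (\<lambda>k. upper_conf X l d (b, k)) = of_nat (stp X b) *
        (sum' (\<lambda>(a, i). of_nat (i * W_vec \<eta> (a, i)) * fund_weight X a b) (all_index X) - lam b)"
      unfolding up using mu' b by blast
    also have "\<dots> = ginv_vec X \<eta> b - of_nat (stp X b) * lam b"
      unfolding right_diff_distrib
      by (subst weight_W_vec[OF X order.refl _ b]) (auto simp: all_index_def)
    finally show "wtot (stp X b) (\<lambda>k. d (b, k)) = - of_nat (stp X b) * lam b" by simp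
  qed
qed

text \<open>A moment of an integral row at one of its own positions is \<open>stp\<close> times an
  integer, since all positions are multiples of \<open>stp\<close>; the other integrality conditions
  are columns, or sums of columns, of \<open>d\<close>.\<close>

lemma boundary_data_range:
  assumes X: "admissible_type X" and d: "d \<in> fluctuations X l lam"
  shows "boundary_data X l d \<in> summation_range X (2 * l + 1)"
proof -
  obtain \<xi> \<eta> \<zeta> where bd: "boundary_data X l d = (\<xi>, \<eta>, \<zeta>)" by (metis prod_cases3)
  note bv = boundary_data_values[OF X d bd]
  note fd = fluct_fin[OF X d] and di = fluct_int[OF X d]
  from fin_conf_bound[OF fd] obtain K where K: "\<And>a k. k > K \<Longrightarrow> d (a, k) = 0" by blast
  have mI: "mom (stp X a) (\<lambda>k. d (a, k)) (stp X a * x) / of_nat (stp X a) \<in> \<int>" for a x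
  proof -
    have "mom (stp X a) (\<lambda>k. d (a, k)) (stp X a * x) = (\<Sum>k=1..K. of_nat (min (stp X a * x) (stp X a * k)) * d (a, k))"
      by (rule mom_eq_sum) (rule K)
    also have "\<dots> / of_nat (stp X a) = (\<Sum>k=1..K. of_nat (min x k) * d (a, k))"
      unfolding sum_divide_distrib by (intro sum.cong refl) (auto simp: stp_def min_def)
    also have "\<dots> \<in> \<int>" using di by (intro Ints_sum Ints_mult) auto
    finally show ?thesis .
  qed
  have site: "stp X a * (tt X a * l) = 2 * l" "stp X a * (tt X a * l + tt X a) = 2 * l + 2" for a
    by (auto simp: stp_def tt_def)
  have g: "ginv_vec X \<xi> a / of_nat (stp X a) \<in> \<int>" "ginv_vec X \<eta> a / of_nat (stp X a) \<in> \<int>" if a: "a \<in> nodes X" for a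
    using mI[of a "tt X a * l"] mI[of a "tt X a * l + tt X a"] boundary_mom[OF X fd bv a]
    unfolding site by auto
  have c: "centre X \<xi> \<eta> \<zeta> a \<in> \<int>" if a: "a \<in> nodes X" for a
    unfolding boundary_centre[OF X fd bv a, symmetric] using di by auto
  have h: "(ginv_vec X \<xi> a - ginv_vec X \<eta> a - centre X \<xi> \<eta> \<zeta> a) / 2 \<in> \<int>" if a: "a \<in> nodes X" for a
    unfolding boundary_right[OF X fd bv a, symmetric]
  proof (intro Ints_add di)
    show "tot (upper (tt X a * l + tt X a) (\<lambda>k. d (a, k))) \<in> \<int>"
      unfolding tot_def sum.G_def using di by (auto intro!: Ints_sum simp: upper_def)
  qed
  have "congruences X \<xi> \<eta> \<zeta>"
    unfolding congruences_iff[OF X] using g c h short_nodes_subset[of X] by blast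
  moreover have "a \<notin> nodes X \<Longrightarrow> \<xi> a = 0" "a \<notin> nodes X \<Longrightarrow> \<eta> a = 0"
      "a \<notin> short_nodes X \<Longrightarrow> \<zeta> a = 0" "l = 0 \<Longrightarrow> \<xi> a = 0" for a
    using bd by (auto simp: boundary_data_def)
  ultimately show ?thesis unfolding bd by (simp add: summation_range_def)
qed

text \<open>Once the boundary data are fixed, no condition links the two halves; this is why each
  fibre is a product and its sum factors into two fermionic forms.\<close>

lemma fibre_bij:
  assumes X: "admissible_type X" and rng: "(\<xi>, \<eta>, \<zeta>) \<in> summation_range X (2 * l + 1)"
  shows "bij_betw (\<lambda>d. (\<lambda>z. nat \<lfloor>upper_conf X l d z\<rfloor>, \<lambda>z. nat \<lfloor>lower_conf X l d z\<rfloor>))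
    {d \<in> fluctuations X l lam. boundary_data X l d = (\<xi>, \<eta>, \<zeta>)}
    (configs X (all_index X) (W_vec \<eta>) lam \<times> configs X (level_index X l) (W_vec \<xi>) (\<lambda>_. 0))"
proof (rule bij_betw_byWitness[where f' = "\<lambda>(mu, ml). assemble X l \<xi> \<eta> \<zeta> (\<lambda>z. of_nat (mu z)) (\<lambda>z. of_nat (ml z))"])
  show "\<forall>d\<in>{d \<in> fluctuations X l lam. boundary_data X l d = (\<xi>, \<eta>, \<zeta>)}.
      (\<lambda>(mu, ml). assemble X l \<xi> \<eta> \<zeta> (\<lambda>z. of_nat (mu z)) (\<lambda>z. of_nat (ml z)))
       (\<lambda>z. nat \<lfloor>upper_conf X l d z\<rfloor>, \<lambda>z. nat \<lfloor>lower_conf X l d z\<rfloor>) = d"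
  proof
    fix d assume "d \<in> {d \<in> fluctuations X l lam. boundary_data X l d = (\<xi>, \<eta>, \<zeta>)}"
    hence d: "d \<in> fluctuations X l lam" and bd: "boundary_data X l d = (\<xi>, \<eta>, \<zeta>)" by auto
    show "(\<lambda>(mu, ml). assemble X l \<xi> \<eta> \<zeta> (\<lambda>z. of_nat (mu z)) (\<lambda>z. of_nat (ml z)))
       (\<lambda>z. nat \<lfloor>upper_conf X l d z\<rfloor>, \<lambda>z. nat \<lfloor>lower_conf X l d z\<rfloor>) = d"
      unfolding prod.case upper_conf_nat[OF X d] lower_conf_nat[OF X d]
      by (rule assemble_unique[OF X fluct_fin[OF X d] boundary_data_values[OF X d bd]])
  qed
  show "\<forall>c\<in>configs X (all_index X) (W_vec \<eta>) lam \<times> configs X (level_index X l) (W_vec \<xi>) (\<lambda>_. 0).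
      (\<lambda>d. (\<lambda>z. nat \<lfloor>upper_conf X l d z\<rfloor>, \<lambda>z. nat \<lfloor>lower_conf X l d z\<rfloor>))
       ((\<lambda>(mu, ml). assemble X l \<xi> \<eta> \<zeta> (\<lambda>z. of_nat (mu z)) (\<lambda>z. of_nat (ml z))) c) = c"
    using assemble_mem(3,4)[OF X rng] by auto
  show "(\<lambda>d. (\<lambda>z. nat \<lfloor>upper_conf X l d z\<rfloor>, \<lambda>z. nat \<lfloor>lower_conf X l d z\<rfloor>)) `
      {d \<in> fluctuations X l lam. boundary_data X l d = (\<xi>, \<eta>, \<zeta>)}
      \<subseteq> configs X (all_index X) (W_vec \<eta>) lam \<times> configs X (level_index X l) (W_vec \<xi>) (\<lambda>_. 0)"
    using upper_mem[OF X] lower_mem[OF X] by auto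
  show "(\<lambda>(mu, ml). assemble X l \<xi> \<eta> \<zeta> (\<lambda>z. of_nat (mu z)) (\<lambda>z. of_nat (ml z))) `
      (configs X (all_index X) (W_vec \<eta>) lam \<times> configs X (level_index X l) (W_vec \<xi>) (\<lambda>_. 0))
      \<subseteq> {d \<in> fluctuations X l lam. boundary_data X l d = (\<xi>, \<eta>, \<zeta>)}"
    using assemble_mem(1,2)[OF X rng] by auto
qed

lemma finite_fibre:
  assumes X: "admissible_type X" and rng: "t \<in> summation_range X (2 * l + 1)"
  shows "finite {d \<in> fluctuations X l lam. boundary_data X l d = t}"
proof -
  obtain \<xi> \<eta> \<zeta> where t: "t = (\<xi>, \<eta>, \<zeta>)" by (metis prod_cases3)
  have "finite (configs X (all_index X) (W_vec \<eta>) lam \<times> configs X (level_index X l) (W_vec \<xi>) (\<lambda>_. 0))"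
    by (intro finite_cartesian_product finite_configs[OF order.refl finite_supp_W_vec[OF order.refl]]
        finite_configs[OF level_index_subset finite_supp_W_vec[OF level_index_subset]])
  thus ?thesis using bij_betw_finite[OF fibre_bij[OF X rng[unfolded t], of lam]] unfolding t by blast
qed

lemma fibre_sum:
  assumes X: "admissible_type X" and rng: "(\<xi>, \<eta>, \<zeta>) \<in> summation_range X (2 * l + 1)"
  shows "qpow fls_X (phi X \<xi> \<eta> \<zeta>) * MM X (W_vec \<eta>) lam (inverse fls_X) *
      MM_level X l (W_vec \<xi>) (inverse fls_X) /
      ((\<Prod>a\<in>nodes X. qpoch fls_X (\<eta> a) * qpoch fls_X (\<xi> a)) * (\<Prod>a\<in>short_nodes X. qpoch fls_X (\<zeta> a))) =
    (\<Sum>d | d \<in> fluctuations X l lam \<and> boundary_data X l d = (\<xi>, \<eta>, \<zeta>). lim_term X l d)"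
proof -
  define A B where "A = configs X (all_index X) (W_vec \<eta>) lam" and "B = configs X (level_index X l) (W_vec \<xi>) (\<lambda>_. 0)"
  define f g where "f mu = qpow (inverse fls_X :: rat fls) (cc X (all_index X) (W_vec \<eta>) (\<lambda>z. of_nat (mu z))) *
      prod' (\<lambda>z. qbinomial (inverse fls_X) \<lfloor>pp X (all_index X) (W_vec \<eta>) (\<lambda>z. of_nat (mu z)) z\<rfloor> (mu z)) (all_index X)"
    and "g ml = qpow (inverse fls_X :: rat fls) (cc X (level_index X l) (W_vec \<xi>) (\<lambda>z. of_nat (ml z))) *
      prod' (\<lambda>z. qbinomial (inverse fls_X) \<lfloor>pp X (level_index X l) (W_vec \<xi>) (\<lambda>z. of_nat (ml z)) z\<rfloor> (ml z)) (level_index X l)"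
    for mu ml
  define c where "c = qpow (fls_X :: rat fls) (phi X \<xi> \<eta> \<zeta>)"
  define e where "e = (\<Prod>a\<in>nodes X. qpoch (fls_X :: rat fls) (\<eta> a) * qpoch fls_X (\<xi> a)) * (\<Prod>a\<in>short_nodes X. qpoch fls_X (\<zeta> a))"
  have "c * (\<Sum>mu\<in>A. f mu) * (\<Sum>ml\<in>B. g ml) / e = (\<Sum>(mu, ml)\<in>A \<times> B. c * f mu * g ml / e)"
  proof -
    have "c * (\<Sum>mu\<in>A. f mu) * (\<Sum>ml\<in>B. g ml) / e = c / e * (\<Sum>(mu, ml)\<in>A \<times> B. f mu * g ml)"
      by (simp add: sum_product sum.cartesian_product[symmetric] mult.assoc)
    also have "\<dots> = (\<Sum>(mu, ml)\<in>A \<times> B. c * f mu * g ml / e)"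
      unfolding sum_distrib_left by (intro sum.cong refl) (simp add: case_prod_beta mult.assoc)
    finally show ?thesis .
  qed
  also have "\<dots> = (\<Sum>d | d \<in> fluctuations X l lam \<and> boundary_data X l d = (\<xi>, \<eta>, \<zeta>).
      case (\<lambda>z. nat \<lfloor>upper_conf X l d z\<rfloor>, \<lambda>z. nat \<lfloor>lower_conf X l d z\<rfloor>) of (mu, ml) \<Rightarrow> c * f mu * g ml / e)"
    unfolding A_def B_def by (rule sum.reindex_bij_betw[OF fibre_bij[OF X rng], symmetric])
  also have "\<dots> = (\<Sum>d | d \<in> fluctuations X l lam \<and> boundary_data X l d = (\<xi>, \<eta>, \<zeta>). lim_term X l d)"
  proof (intro sum.cong refl)
    fix d assume "d \<in> {d. d \<in> fluctuations X l lam \<and> boundary_data X l d = (\<xi>, \<eta>, \<zeta>)}"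
    hence "d \<in> fluctuations X l lam" "boundary_data X l d = (\<xi>, \<eta>, \<zeta>)" by auto
    from lim_term_eq[OF X this]
    show "(case (\<lambda>z. nat \<lfloor>upper_conf X l d z\<rfloor>, \<lambda>z. nat \<lfloor>lower_conf X l d z\<rfloor>) of (mu, ml) \<Rightarrow> c * f mu * g ml / e) =
       lim_term X l d"
      by (simp only: prod.case c_def e_def f_def g_def)
  qed
  finally show ?thesis
    by (simp only: MM_def MM_level_def fermionic_form_def A_def B_def c_def e_def f_def g_def)
qed

section \<open>The limit\<close>

lemma fls_X_intpow_times_nth: "(fls_X_intpow i * f) $$ k = (f :: rat fls) $$ (k - i)"
  by (simp add: fls_X_intpow_times_conv_shift)

lemma fps_eq_upto_prod':
  assumes f: "finite {z \<in> A. f z \<noteq> 1}" and g: "finite {z \<in> A. g z \<noteq> 1}"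
    and e: "\<And>z. z \<in> A \<Longrightarrow> fps_eq_upto N (f z) (g z)"
  shows "fps_eq_upto N (prod' f A) (prod' g A)"
proof -
  define S where "S = {z \<in> A. f z \<noteq> 1} \<union> {z \<in> A. g z \<noteq> 1}"
  have S: "finite S" "S \<subseteq> A" using f g by (auto simp: S_def)
  have "prod' f A = prod f S" "prod' g A = prod g S"
    using S by (subst prod.mono_neutral_right'[of S A]; auto simp: S_def)+
  thus ?thesis using S e by (auto intro!: fps_eq_upto_prod)
qed

lemma eventually_linear_ge:
  assumes "c > (0::rat)"
  shows "eventually (\<lambda>L. of_nat L * c + x \<ge> y) at_top"
proof -
  from ex_less_of_nat_mult[OF assms] obtain n where n: "y - x < of_nat n * c" by blast
  show ?thesis unfolding eventually_at_top_linorder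
  proof (intro exI allI impI)
    fix L assume "n \<le> L"
    hence "of_nat n * c \<le> of_nat L * c" using assms by (intro mult_right_mono) auto
    thus "of_nat L * c + x \<ge> y" using n by linarith
  qed
qed

text \<open>The term of the normalised sum at the reference point plus \<open>d\<close>. Exponent
  and vacancy numbers depend on \<open>d\<close> alone; \<open>L\<close> enters only through the
  lower entries of the q-binomials.\<close>

definition fluct_term :: "cartan_type \<Rightarrow> nat \<Rightarrow> nat \<Rightarrow> nat \<Rightarrow> (nat \<times> nat \<Rightarrow> rat) \<Rightarrow> rat fls" where
  "fluct_term X r l L d = fls_X_intpow \<lfloor>energy X d\<rfloor> *
     fps_to_fls (prod' (\<lambda>z. qb (nat \<lfloor>- quad_vec X d z\<rfloor>) (nat \<lfloor>ref_conf X r l L z + d z\<rfloor>)) (all_index X))"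

lemma fermionic_fluctuations:
  assumes X: "admissible_type X" and r: "r \<in> short_nodes X" and L: "L_modulus X dvd L"
  shows "qpow fls_X (- cc X (all_index X) (W_power r (2 * l + 1) L) (m_zero X r (2 * l + 1) L)) *
      MM X (W_power r (2 * l + 1) L) lam fls_X =
    (\<Sum>d | d \<in> fluctuations X l lam \<and> (\<forall>z\<in>all_index X. ref_conf X r l L z + d z \<ge> 0). fluct_term X r l L d)"
proof -
  let ?W = "W_power r (2 * l + 1) L" and ?H = "all_index X"
  let ?C = "{d \<in> fluctuations X l lam. \<forall>z\<in>all_index X. ref_conf X r l L z + d z \<ge> 0}"
  define T where "T m = qpow (fls_X :: rat fls) (cc X ?H ?W (\<lambda>z. of_nat (m z))) *
     prod' (\<lambda>z. qbinomial fls_X \<lfloor>pp X ?H ?W (\<lambda>z. of_nat (m z)) z\<rfloor> (m z)) ?H" for m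
  have "qpow fls_X (- cc X ?H ?W (m_zero X r (2 * l + 1) L)) * MM X ?W lam fls_X =
     (\<Sum>m\<in>configs X ?H ?W lam. fls_X_intpow \<lfloor>energy X (ref_conf X r l L)\<rfloor> * T m)"
    unfolding cc_ref[OF X r] MM_def fermionic_form_def T_def[symmetric] sum_distrib_left
    by (simp add: qpow_fls_X)
  also have "\<dots> = (\<Sum>d\<in>?C. fls_X_intpow \<lfloor>energy X (ref_conf X r l L)\<rfloor> * T (\<lambda>z. nat \<lfloor>ref_conf X r l L z + d z\<rfloor>))"
    by (rule sum.reindex_bij_betw[OF configs_fluctuations[OF X r L], symmetric])
  also have "\<dots> = (\<Sum>d\<in>?C. fluct_term X r l L d)"
  proof (intro sum.cong refl)
    fix d assume "d \<in> ?C"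
    hence d: "d \<in> fluctuations X l lam" and pos: "\<And>z. z \<in> all_index X \<Longrightarrow> ref_conf X r l L z + d z \<ge> 0" by auto
    note fd = fluct_fin[OF X d] and di = fluct_int[OF X d]
    define m where "m z = nat \<lfloor>ref_conf X r l L z + d z\<rfloor>" for z
    have m: "of_nat (m z) = ref_conf X r l L z + d z" for z
    proof -
      have "ref_conf X r l L z + d z \<ge> 0"
        using pos[of z] fin_conf_0(3)[OF fd, of z] by (cases "z \<in> all_index X") (auto simp: ref_conf_def)
      thus ?thesis unfolding m_def by (intro of_nat_nat_floor Ints_add ref_Ints[OF X r L] di)
    qed
    have e1: "energy X (ref_conf X r l L) \<in> \<int>" unfolding energy_def
      by (rule energy_Ints[OF fin_conf_ref[OF X r] ref_Ints[OF X r L]])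
    have e2: "energy X d \<in> \<int>" unfolding energy_def by (rule energy_Ints[OF fd di])
    have ex: "\<lfloor>energy X (ref_conf X r l L)\<rfloor> + \<lfloor>energy X d - energy X (ref_conf X r l L)\<rfloor> = \<lfloor>energy X d\<rfloor>"
      using e1 e2 by (auto elim!: Ints_cases)
    have "prod' (\<lambda>z. qbinomial fls_X \<lfloor>pp X ?H ?W (\<lambda>z. of_nat (m z)) z\<rfloor> (m z)) ?H =
       prod' (\<lambda>z. fps_to_fls (qb (nat \<lfloor>- quad_vec X d z\<rfloor>) (m z))) ?H"
    proof (intro prod.cong' refl)
      fix z assume z: "z \<in> ?H"
      hence "quad_vec X d z \<le> 0" using d by (simp add: fluctuations_def)
      thus "qbinomial fls_X \<lfloor>pp X ?H ?W (\<lambda>z. of_nat (m z)) z\<rfloor> (m z) = fps_to_fls (qb (nat \<lfloor>- quad_vec X d z\<rfloor>) (m z))"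
        unfolding pp_shift[OF X r fd m z] by (intro qbinomial_fls_X) simp
    qed
    hence "T m = fls_X_intpow \<lfloor>energy X d - energy X (ref_conf X r l L)\<rfloor> *
        fps_to_fls (prod' (\<lambda>z. qb (nat \<lfloor>- quad_vec X d z\<rfloor>) (m z)) ?H)"
      unfolding T_def cc_shift[OF X r fd m] qpow_fls_X prod'_fps_to_fls by simp
    thus "fls_X_intpow \<lfloor>energy X (ref_conf X r l L)\<rfloor> * T (\<lambda>z. nat \<lfloor>ref_conf X r l L z + d z\<rfloor>) = fluct_term X r l L d"
      unfolding m_def[symmetric] fluct_term_def ex[symmetric] fls_X_intpow_add by (simp only: mult.assoc)
  qed
  finally show ?thesis by simp
qed

lemma finite_central: "finite {z \<in> all_index X. central X l z}"
proof (rule finite_subset)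
  show "{z \<in> all_index X. central X l z} \<subseteq> nodes X \<times> {1..2 * l + 2}"
  proof clarify
    fix a k assume ak: "(a, k) \<in> all_index X" and c: "central X l (a, k)"
    have "k \<le> stp X a * k" by (simp add: stp_def)
    hence "k \<le> 2 * l + 2" using c unfolding central_def fst_conv snd_conv by linarith
    thus "a \<in> nodes X \<and> k \<in> {1..2 * l + 2}" using ak by (simp add: all_index_def)
  qed
qed simp

lemma eventually_fluct_term:
  assumes X: "admissible_type X" and r: "r \<in> short_nodes X" and d: "d \<in> fluctuations X l lam"
  shows "eventually (\<lambda>L. (\<forall>z\<in>all_index X. ref_conf X r l L z + d z \<ge> 0) \<and>
     (\<forall>k\<le>int N. fluct_term X r l L d $$ k = lim_term X l d $$ k)) at_top"
proof -
  note fd = fluct_fin[OF X d] and di = fluct_int[OF X d]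
  \<comment> \<open>Central entries of size at least \<open>N\<close> make each q-binomial agree
    with \<open>1 / (q)_p\<close> up to order \<open>N\<close>, by \<open>qb_eq_upto\<close>;
    positive slopes guarantee this from some \<open>L\<close> on.\<close>
  have "eventually (\<lambda>L. \<forall>z\<in>{z \<in> all_index X. central X l z}. of_nat L * slope X r l z + d z \<ge> of_nat N) at_top"
    using slope_pos[OF X r] by (intro eventually_ball_finite finite_central ballI eventually_linear_ge) auto
  thus ?thesis
  proof eventually_elim
    case (elim L)
    have ref: "ref_conf X r l L z = (if central X l z then of_nat L * slope X r l z else 0)" if "z \<in> all_index X" for z
      using ref_eq[OF X r, of "fst z" "snd z" l L] that by (auto simp: all_index_def)
    have big: "ref_conf X r l L z + d z \<ge> of_nat N" if "z \<in> all_index X" "central X l z" for z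
      using bspec[OF elim, of z] that by (simp add: ref)
    have pos: "ref_conf X r l L z + d z \<ge> 0" if z: "z \<in> all_index X" for z
    proof (cases "central X l z")
      case True
      have "(0::rat) \<le> of_nat N" by simp
      also have "\<dots> \<le> ref_conf X r l L z + d z" by (rule big[OF z True])
      finally show ?thesis .
    next
      case False
      thus ?thesis using d z by (simp add: ref fluctuations_def)
    qed
    have triv: "qb (nat \<lfloor>- quad_vec X d z\<rfloor>) (nat \<lfloor>ref_conf X r l L z + d z\<rfloor>) = 1" "lim_factor X l d z = 1"
      if "z \<in> all_index X" "z \<notin> {z \<in> all_index X. central X l z} \<union> {z. d z \<noteq> 0}" for z
      using that by (auto simp: ref lim_factor_def)
    have fin: "finite ({z \<in> all_index X. central X l z} \<union> {z. d z \<noteq> 0})"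
      using finite_central fd by (auto simp: fin_conf_def)
    have "fps_eq_upto N (prod' (\<lambda>z. qb (nat \<lfloor>- quad_vec X d z\<rfloor>) (nat \<lfloor>ref_conf X r l L z + d z\<rfloor>)) (all_index X))
        (prod' (lim_factor X l d) (all_index X))"
    proof (rule fps_eq_upto_prod')
      show "finite {z \<in> all_index X. qb (nat \<lfloor>- quad_vec X d z\<rfloor>) (nat \<lfloor>ref_conf X r l L z + d z\<rfloor>) \<noteq> 1}"
        by (rule finite_subset[OF _ fin]) (use triv(1) in blast)
      show "finite {z \<in> all_index X. lim_factor X l d z \<noteq> 1}"
        by (rule finite_subset[OF _ fin]) (use triv(2) in blast)
      fix z assume z: "z \<in> all_index X"
      show "fps_eq_upto N (qb (nat \<lfloor>- quad_vec X d z\<rfloor>) (nat \<lfloor>ref_conf X r l L z + d z\<rfloor>)) (lim_factor X l d z)"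
      proof (cases "central X l z")
        case True
        have "int N \<le> \<lfloor>ref_conf X r l L z + d z\<rfloor>" using big[OF z True] by (simp add: le_floor_iff)
        hence "N \<le> nat \<lfloor>ref_conf X r l L z + d z\<rfloor>" by simp
        thus ?thesis using True by (simp add: lim_factor_def qb_eq_upto)
      next
        case False
        thus ?thesis using z by (simp add: lim_factor_def ref)
      qed
    qed
    note eq = this
    have "fluct_term X r l L d $$ k = lim_term X l d $$ k" if k: "k \<le> int N" for k
    proof -
      \<comment> \<open>Shifting by a nonnegative energy only lowers the order of the coefficients
        needed.\<close>
      have "\<lfloor>energy X d\<rfloor> \<ge> 0" using energy_nonneg[OF X fd] by (simp add: energy_def)
      hence "nat (k - \<lfloor>energy X d\<rfloor>) \<le> N" using k by linarith
      with eq show ?thesis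
        unfolding fluct_term_def lim_term_def fls_X_intpow_times_nth by (simp add: fps_eq_upto_def)
    qed
    with pos show ?case by blast
  qed
qed

lemma finite_fluctuations:
  assumes X: "admissible_type X"
  shows "finite {d \<in> fluctuations X l lam. \<lfloor>energy X d\<rfloor> \<le> N}"
proof (rule finite_subset)
  \<comment> \<open>Beyond position \<open>2 l + 2\<close> no column is central, so all columns
    there are nonnegative: this is the \<open>B0\<close> of \<open>finite_energy_le\<close>. The
    bound combines \<open>E < N + 1\<close> with the factor 1/2 in \<open>energy\<close>.\<close>
  show "{d \<in> fluctuations X l lam. \<lfloor>energy X d\<rfloor> \<le> N} \<subseteq> {d. fin_conf X d \<and> (\<forall>z. d z \<in> \<int>) \<and>
      (\<forall>a\<in>nodes X. \<forall>k. 2 * l + 2 < stp X a * k \<longrightarrow> d (a, k) \<ge> 0) \<and>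
      pair_sum X (quad_vec X d) d \<le> 2 * (of_int N + 1)}"
  proof (intro subsetI CollectI conjI ballI allI impI)
    fix d assume "d \<in> {d \<in> fluctuations X l lam. \<lfloor>energy X d\<rfloor> \<le> N}"
    hence d: "d \<in> fluctuations X l lam" and N: "\<lfloor>energy X d\<rfloor> \<le> N" by auto
    show "fin_conf X d" by (rule fluct_fin[OF X d])
    show "d z \<in> \<int>" for z by (rule fluct_int[OF X d])
    show "pair_sum X (quad_vec X d) d \<le> 2 * (of_int N + 1)"
      using N unfolding energy_def floor_le_iff by simp
    fix a k assume a: "a \<in> nodes X" and k: "2 * l + 2 < stp X a * k"
    have "(a, k) \<in> all_index X" using a k by (cases k) (auto simp: all_index_def)
    moreover have "\<not> central X l (a, k)" using k by (simp add: central_def)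
    ultimately show "d (a, k) \<ge> 0" using d by (simp add: fluctuations_def)
  qed
  show "finite {d. fin_conf X d \<and> (\<forall>z. d z \<in> \<int>) \<and>
      (\<forall>a\<in>nodes X. \<forall>k. 2 * l + 2 < stp X a * k \<longrightarrow> d (a, k) \<ge> 0) \<and>
      pair_sum X (quad_vec X d) d \<le> 2 * (of_int N + 1)}"
    by (rule finite_energy_le[OF X])
qed

theorem theorem5p5:
  fixes X :: cartan_type and r s :: nat and lam :: weight
  defines "q \<equiv> (fls_X :: rat fls)"
  defines "rhs_term \<equiv> (\<lambda>(\<xi>, \<eta>, \<zeta>).
      qpow q (phi X \<xi> \<eta> \<zeta>) * MM X (W_vec \<eta>) lam (inverse q) *
      MM_level X ((s - 1) div 2) (W_vec \<xi>) (inverse q) /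
      ((\<Prod>a\<in>nodes X. qpoch q (\<eta> a) * qpoch q (\<xi> a)) *
       (\<Prod>a\<in>short_nodes X. qpoch q (\<zeta> a))))"
  assumes "admissible_type X"
    and "r \<in> nodes X" and "tt X r = 2"
    and "odd s"
    and "lam \<in> weight_lattice X"
  shows "rhs_term summable_on summation_range X s \<and>
    ((\<lambda>L. qpow q (- cc X (all_index X) (W_power r s L) (m_zero X r s L)) *
           MM X (W_power r s L) lam q)
       \<longlongrightarrow> infsum rhs_term (summation_range X s))
      (inf at_top (principal {L. L_modulus X dvd L}))"
proof -
  note X = \<open>admissible_type X\<close>
  have r: "r \<in> short_nodes X" using assms(4,5) by (simp add: short_nodes_iff tt_2_iff)
  from \<open>odd s\<close> obtain l where s: "s = 2 * l + 1" by (elim oddE)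
  define F where "F = inf at_top (principal {L. L_modulus X dvd L})"
  define C where "C L = {d. d \<in> fluctuations X l lam \<and> (\<forall>z\<in>all_index X. ref_conf X r l L z + d z \<ge> 0)}" for L
  have ev: "eventually (\<lambda>L. L_modulus X dvd L) F" by (simp add: F_def eventually_inf_principal)
  have "\<exists>S. (rhs_term has_sum S) (summation_range X s) \<and> ((\<lambda>L. \<Sum>d\<in>C L. fluct_term X r l L d) \<longlongrightarrow> S) F"
  proof (rule graded_limit[where E = "\<lambda>d. \<lfloor>energy X d\<rfloor>" and T = "fluctuations X l lam" and g = "lim_term X l"
        and P = "\<lambda>L. L_modulus X dvd L" and proj = "boundary_data X l"])
    show "0 \<le> \<lfloor>energy X d\<rfloor>" if "d \<in> fluctuations X l lam" for d
      using energy_nonneg[OF X fluct_fin[OF X that]] by (simp add: energy_def)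
    show "finite {d \<in> fluctuations X l lam. \<lfloor>energy X d\<rfloor> \<le> N}" for N
      by (rule finite_fluctuations[OF X])
    show "lim_term X l d $$ k = 0" if "k < \<lfloor>energy X d\<rfloor>" for d k
      using that by (simp add: lim_term_def fls_X_intpow_times_nth)
    show "fluct_term X r l L d $$ k = 0" if "k < \<lfloor>energy X d\<rfloor>" for L d k
      using that by (simp add: fluct_term_def fls_X_intpow_times_nth)
    show "C L \<subseteq> fluctuations X l lam \<and> finite (C L)" if "L_modulus X dvd L" for L
      using bij_betw_finite[OF configs_fluctuations[OF X r that]] finite_configs[OF order.refl finite_supp_W_power]
      by (auto simp: C_def)
    show "eventually (\<lambda>L. L_modulus X dvd L) F" by (rule ev)
    show "eventually (\<lambda>L. d \<in> C L \<and> (\<forall>k\<le>int N. fluct_term X r l L d $$ k = lim_term X l d $$ k)) F"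
      if "d \<in> fluctuations X l lam" for d N
      using eventually_fluct_term[OF X r that, of N] that
      unfolding F_def eventually_inf_principal by (auto simp: C_def elim: eventually_mono)
    show "boundary_data X l d \<in> summation_range X s" if "d \<in> fluctuations X l lam" for d
      unfolding s by (rule boundary_data_range[OF X that])
    show "finite {d \<in> fluctuations X l lam. boundary_data X l d = t}" if "t \<in> summation_range X s" for t
      using finite_fibre[OF X that[unfolded s]] .
    show "rhs_term t = (\<Sum>d | d \<in> fluctuations X l lam \<and> boundary_data X l d = t. lim_term X l d)"
      if "t \<in> summation_range X s" for t
    proof -
      obtain \<xi> \<eta> \<zeta> where t: "t = (\<xi>, \<eta>, \<zeta>)" by (metis prod_cases3)
      show ?thesis using fibre_sum[OF X that[unfolded s t], of lam]
        unfolding t rhs_term_def q_def s prod.case by simp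
    qed
  qed
  then obtain S where S: "(rhs_term has_sum S) (summation_range X s)"
    and lim: "((\<lambda>L. \<Sum>d\<in>C L. fluct_term X r l L d) \<longlongrightarrow> S) F" by blast
  \<comment> \<open>The expansion in fluctuations needs \<open>L\<close> to be a multiple of
    \<open>L_modulus\<close>, which holds eventually along the restricted filter.\<close>
  have "((\<lambda>L. qpow q (- cc X (all_index X) (W_power r s L) (m_zero X r s L)) * MM X (W_power r s L) lam q) \<longlongrightarrow> S) F"
  proof (rule Lim_transform_eventually[OF lim])
    show "eventually (\<lambda>L. (\<Sum>d\<in>C L. fluct_term X r l L d) =
        qpow q (- cc X (all_index X) (W_power r s L) (m_zero X r s L)) * MM X (W_power r s L) lam q) F"
      using ev by eventually_elim (simp only: q_def s C_def fermionic_fluctuations[OF X r])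
  qed
  moreover have "rhs_term summable_on summation_range X s" "infsum rhs_term (summation_range X s) = S"
    using S by (auto simp: summable_on_def intro: infsumI)
  ultimately show ?thesis by (simp add: F_def)
qed

end
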